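(* For every fixed $\lambda>0$, $$\liminf_{N\to\infty}\frac{\mathbb{E}[\omega_{N,\lambda}]}{\log N}\ge\frac{1}{2\lambda},$$ where $N$ ranges over the positive integers and $\omega_{N,\lambda}$ is the tree-completion time of the cylindrical Hastings--Levitov process with parameter $0$, cylinder width $N$ and particle size $\lambda$.
   Context: Fix an integer $N\ge 1$ (cylinder width) and a real $\lambda>0$ (particle size). Let $\mathbb{T}_N=\mathbb{R}/(2\pi N\mathbb{Z})=[0,2\pi N)$ be the base circle and $\mathbb{T}^N=\{z\in\mathbb{C}:\operatorname{Im}z>0\}/(z\sim z+2\pi N)$ the cylinder; $\mathbb{T}_N\times\{0\}$ denotes its boundary circle $\{\operatorname{Im}z=0\}$. Slit maps. The slit map centered at $0$ is the conformal map from $\mathbb{T}^N$ onto $\mathbb{T}^N\setminus[0,i\lambda]$ given by $$S^{N,\lambda}=f_N^{-1}\circ g^{-1}\circ\phi_\delta\circ g\circ f_N,\qquad f_N(z)=e^{-iz/N},\quad g(z)=i\frac{z-1}{z+1},\quad \phi_a(z)=\sqrt{z^2(1-a^2)-a^2}\ (a>0),$$ where $f_N$ maps $\mathbb{T}^N$ onto $\{|z|>1\}$, $g$ maps $\{|z|>1\}$ into the upper half-plane, the branch of the square root is the one for which $\phi_a$ maps the upper half-plane into itself, and $\delta=\delta(N,\lambda)=1-\frac{2}{e^{\lambda/N}+1}\in(0,1)$ (this is the value for which $S^{N,\lambda}(0)=i\lambda$). The map is extended continuously to the boundary circle $\mathbb{T}_N\times\{0\}$. For $x\in\mathbb{T}_N$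 the slit map centered at $x$ is its translate $$S^{N,\lambda}_x(z)=\operatorname{Re}(z)+S^{N,\lambda}(z-x)-\bigl(\operatorname{Re}(z-x)\bmod 2\pi N\bigr),$$ i.e. $S^{N,\lambda}_x(z)=x+S^{N,\lambda}(z-x)$ modulo $2\pi N$; it attaches a vertical slit of length $\lambda$ above $x$. The process $\mathrm{CHL}_N$. Let $P$ be a Poisson point process of intensity $1$ on $\mathbb{R}_+\times\mathbb{T}_N$ (with respect to Lebesgue measure). For $t>0$ the set $P\cap([0,t]\times\mathbb{T}_N)$ is a.s. finite; enumerate it as $(t_1,x_1),\dots,(t_n,x_n)$ with $0<t_1<\dots<t_n\le t$. The aggregate map at time $t$ is $\mathcal{C}^{N,\lambda}_t=S^{N,\lambda}_{x_1}\circ S^{N,\lambda}_{x_2}\circ\cdots\circ S^{N,\lambda}_{x_n}$ (the identity if $n=0$). Trees. The trees at time $t$ are the connected components of $\mathcal{C}^{N,\lambda}_t(\mathbb{T}_N\times\{0\})\setminus(\mathbb{T}_N\times\{0\})$; let $\mathcal{N}_t$ be their number. The tree-completion time $\omega_{N,\lambda}$ is the last time at which a new tree is born on the base circle, i.e. the last time at which $\mathcal{N}_t$ increases; equivalently, after time $\omega_{N,\lambda}$ every newly attached particle joins an already existing tree. *)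

theory Defs
  imports "HOL-Probability.Probability" "HOL-Library.Real_Mod"
begin

section \<open>The cylinder\<close>

text \<open>
  Points of the closed cylinder of width \<open>N\<close> (boundary circle included) are represented by their
  representatives with real part in \<open>[0, 2 \<pi> N)\<close>; \<open>cyl_proj N\<close> is the quotient map.
\<close>

definition half_plane :: "complex set" where
  "half_plane = {z. 0 \<le> Im z}"

definition base_circle :: "nat \<Rightarrow> real set" where
  "base_circle N = {0..<2 * pi * real N}"

definition cyl_points :: "nat \<Rightarrow> complex set" where
  "cyl_points N = {z. Re z \<in> base_circle N \<and> 0 \<le> Im z}"

definition cyl_interior :: "nat \<Rightarrow> complex set" where
  "cyl_interior N = {z. Re z \<in> base_circle N \<and> 0 < Im z}"

definition cyl_boundary :: "nat \<Rightarrow> complex set" where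
  "cyl_boundary N = {z. Re z \<in> base_circle N \<and> Im z = 0}"

definition cyl_proj :: "nat \<Rightarrow> complex \<Rightarrow> complex" where
  "cyl_proj N z = Complex (Re z rmod (2 * pi * real N)) (Im z)"

text \<open>
  The cylinder carries the quotient topology, not the subspace topology of the fundamental domain.
\<close>

definition cyl_openin :: "nat \<Rightarrow> complex set \<Rightarrow> bool" where
  "cyl_openin N U \<longleftrightarrow> U \<subseteq> cyl_points N \<and>
     openin (top_of_set half_plane) {z \<in> half_plane. cyl_proj N z \<in> U}"

definition cylinder :: "nat \<Rightarrow> complex topology" where
  "cylinder N = topology (cyl_openin N)"

lemma istopology_cyl_openin: "istopology (cyl_openin N)"
  unfolding istopology_def
proof (intro conjI allI impI)
  fix S T assume "cyl_openin N S" "cyl_openin N T"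
  moreover have "{z \<in> half_plane. cyl_proj N z \<in> S \<inter> T} =
      {z \<in> half_plane. cyl_proj N z \<in> S} \<inter> {z \<in> half_plane. cyl_proj N z \<in> T}"
    by blast
  ultimately show "cyl_openin N (S \<inter> T)"
    unfolding cyl_openin_def by (auto intro: openin_Int)
next
  fix K assume K: "\<forall>U\<in>K. cyl_openin N U"
  have "{z \<in> half_plane. cyl_proj N z \<in> \<Union>K} = (\<Union>U\<in>K. {z \<in> half_plane. cyl_proj N z \<in> U})"
    by blast
  with K show "cyl_openin N (\<Union>K)"
    unfolding cyl_openin_def by (auto intro!: openin_Union)
qed

lemma openin_cylinder: "openin (cylinder N) U \<longleftrightarrow> cyl_openin N U"
  by (simp add: cylinder_def istopology_cyl_openin)

lemma cyl_proj_in_cyl_points: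
  assumes "N \<ge> 1" "z \<in> half_plane"
  shows "cyl_proj N z \<in> cyl_points N"
  using assms
  by (simp add: cyl_proj_def cyl_points_def base_circle_def half_plane_def rmod_nonneg rmod_less)

lemma cyl_proj_id:
  assumes "z \<in> cyl_points N"
  shows "cyl_proj N z = z"
proof -
  have "0 \<le> Re z" "Re z < 2 * pi * real N"
    using assms by (auto simp: cyl_points_def base_circle_def)
  then have "Re z rmod (2 * pi * real N) = Re z"
    by (intro rmod_unique[where n = 0]) auto
  then show ?thesis
    by (simp add: cyl_proj_def complex_eq_iff)
qed

lemma topspace_cylinder:
  assumes "N \<ge> 1"
  shows "topspace (cylinder N) = cyl_points N"
proof -
  have "{z \<in> half_plane. cyl_proj N z \<in> cyl_points N} = half_plane"
    using cyl_proj_in_cyl_points[OF assms] by blast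
  then have "openin (cylinder N) (cyl_points N)"
    by (simp add: openin_cylinder cyl_openin_def)
  then show ?thesis
    by (metis openin_cylinder cyl_openin_def openin_subset openin_topspace subset_antisym)
qed

lemma quotient_map_cyl_proj:
  assumes "N \<ge> 1"
  shows "quotient_map (top_of_set half_plane) (cylinder N) (cyl_proj N)"
proof -
  have "cyl_proj N ` half_plane = cyl_points N"
  proof
    show "cyl_points N \<subseteq> cyl_proj N ` half_plane"
    proof
      fix z assume z: "z \<in> cyl_points N"
      then have "z \<in> half_plane" by (simp add: cyl_points_def half_plane_def)
      then show "z \<in> cyl_proj N ` half_plane"
        using cyl_proj_id[OF z] by (metis imageI)
    qed
  qed (use cyl_proj_in_cyl_points[OF assms] in blast)
  then show ?thesis
    by (simp add: quotient_map_def topspace_cylinder[OF assms] openin_cylinder cyl_openin_def)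
qed


section \<open>Slit maps\<close>

definition disc_map :: "nat \<Rightarrow> complex \<Rightarrow> complex" where
  "disc_map N z = exp (- \<i> * z / of_nat N)"

definition mobius_map :: "complex \<Rightarrow> complex" where
  "mobius_map z = \<i> * (z - 1) / (z + 1)"

text \<open>
  As \<open>csqrt\<close> takes values of nonnegative real part, \<open>\<i> * csqrt (- w)\<close> is the square root
  of \<open>w\<close> in the closed upper half-plane.
\<close>

definition slit_half_plane :: "real \<Rightarrow> complex \<Rightarrow> complex" where
  "slit_half_plane a z =
     \<i> * csqrt (- (z\<^sup>2 * (1 - (complex_of_real a)\<^sup>2) - (complex_of_real a)\<^sup>2))"

definition slit_delta :: "nat \<Rightarrow> real \<Rightarrow> real" where
  "slit_delta N lam = 1 - 2 / (exp (lam / real N) + 1)"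

definition slit_interior :: "nat \<Rightarrow> real \<Rightarrow> complex \<Rightarrow> complex" where
  "slit_interior N lam =
     inv_into (cyl_interior N) (disc_map N) \<circ> inv_into {w. 1 < norm w} mobius_map
     \<circ> slit_half_plane (slit_delta N lam) \<circ> mobius_map \<circ> disc_map N"

text \<open>
  The limit defining the continuous extension is taken in the cylinder: the two sides of the slit
  have representatives near real part \<open>0\<close> and near real part \<open>2 \<pi> N\<close>.
\<close>

definition slit_map :: "nat \<Rightarrow> real \<Rightarrow> complex \<Rightarrow> complex" where
  "slit_map N lam z =
     (if z \<in> cyl_interior N then slit_interior N lam z
      else (THE w. limitin (cylinder N) (slit_interior N lam) w
                     (atin_within (cylinder N) z (cyl_interior N))))"

definition slit_map_at :: "nat \<Rightarrow> real \<Rightarrow> real \<Rightarrow> complex \<Rightarrow> complex" where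
  "slit_map_at N lam x z =
     cyl_proj N (complex_of_real x + slit_map N lam (cyl_proj N (z - complex_of_real x)))"


section \<open>Poisson point processes\<close>

text \<open>
  \<open>P\<close> is a random set of points; \<open>emeasure (count_space UNIV) (P w \<inter> A)\<close> is its number of points
  in \<open>A\<close>, possibly \<open>\<infinity>\<close>.
\<close>

definition poisson_point_process :: "'w measure \<Rightarrow> 'a measure \<Rightarrow> ('w \<Rightarrow> 'a set) \<Rightarrow> bool" where
  "poisson_point_process M \<mu> P \<longleftrightarrow>
     prob_space M \<and>
     (\<forall>w\<in>space M. P w \<subseteq> space \<mu>) \<and>
     (\<forall>A\<in>sets \<mu>. (\<lambda>w. emeasure (count_space UNIV) (P w \<inter> A)) \<in> borel_measurable M) \<and>
     (\<forall>A\<in>sets \<mu>. emeasure \<mu> A < \<infinity> \<longrightarrow>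
        (\<forall>k::nat. measure M {w \<in> space M. emeasure (count_space UNIV) (P w \<inter> A) = of_nat k} =
           measure \<mu> A ^ k / fact k * exp (- measure \<mu> A))) \<and>
     (\<forall>A\<in>sets \<mu>. emeasure \<mu> A = \<infinity> \<longrightarrow>
        (AE w in M. emeasure (count_space UNIV) (P w \<inter> A) = \<infinity>)) \<and>
     (\<forall>(n::nat) A. A ` {..<n} \<subseteq> sets \<mu> \<and> disjoint_family_on A {..<n} \<longrightarrow>
        prob_space.indep_vars M (\<lambda>_. borel)
          (\<lambda>i w. emeasure (count_space UNIV) (P w \<inter> A i)) {..<n})"

definition arrival_intensity :: "nat \<Rightarrow> (real \<times> real) measure" where
  "arrival_intensity N = restrict_space lborel ({0..} \<times> base_circle N)"


section \<open>The cylindrical Hastings--Levitov process with parameter 0\<close>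

text \<open>
  The functions below are deterministic functions of the set \<open>A\<close> of arrivals \<open>(t, x)\<close>. The
  enumeration by increasing time is meaningful for finitely many arrivals at distinct times, which
  is almost surely the case.
\<close>

definition arrivals_upto :: "(real \<times> real) set \<Rightarrow> real \<Rightarrow> (real \<times> real) list" where
  "arrivals_upto A t = sorted_key_list_of_set fst {p \<in> A. fst p \<le> t}"

definition aggregate_map ::
  "nat \<Rightarrow> real \<Rightarrow> (real \<times> real) set \<Rightarrow> real \<Rightarrow> complex \<Rightarrow> complex" where
  "aggregate_map N lam A t =
     foldr (\<lambda>p h. slit_map_at N lam (snd p) \<circ> h) (arrivals_upto A t) id"

definition trees :: "nat \<Rightarrow> real \<Rightarrow> (real \<times> real) set \<Rightarrow> real \<Rightarrow> complex set set" where
  "trees N lam A t =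
     connected_components_of
       (subtopology (cylinder N) (aggregate_map N lam A t ` cyl_boundary N - cyl_boundary N))"

definition num_trees :: "nat \<Rightarrow> real \<Rightarrow> (real \<times> real) set \<Rightarrow> real \<Rightarrow> nat" where
  "num_trees N lam A t = card (trees N lam A t)"

definition tree_birth_times :: "nat \<Rightarrow> real \<Rightarrow> (real \<times> real) set \<Rightarrow> real set" where
  "tree_birth_times N lam A =
     {t. 0 < t \<and> (\<forall>\<^sub>F s in at_left t. num_trees N lam A s < num_trees N lam A t)}"

text \<open>
  The last birth time as a supremum in \<open>[0, \<infinity>]\<close>; it is \<open>0\<close> if no tree is ever born and \<open>\<infinity>\<close> if
  the birth times are unbounded, both of which have probability \<open>0\<close>.
\<close>

definition tree_completion_time :: "nat \<Rightarrow> real \<Rightarrow> (real \<times> real) set \<Rightarrow> ennreal" where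
  "tree_completion_time N lam A = (SUP t\<in>tree_birth_times N lam A. ennreal t)"

end

theory Submission
  imports Defs "HOL-Real_Asymp.Real_Asymp"
begin

text \<open>
  In the coordinate \<open>u = z / 2N\<close> the map to the half plane is \<open>tan u\<close>, and since \<open>1 + tan\<^sup>2 u = 1 / cos\<^sup>2 u\<close> the slit
  map \<open>S\<close> is given by \<open>cos (S / 2N) = cos (z / 2N) / c\<close> with \<open>c\<^sup>2 = 1 - \<delta>\<^sup>2\<close>. This makes its boundary values and
  its continuity on the cylinder explicit. A particle landing on a point that the aggregate map sends to
  the base circle adds a connected component, so the completion time is at least the time of such a landing.

  Let \<open>L\<close> be the length of the set of points still sent to the base circle, and let \<open>a\<close> be the length of the arc
  that the slit map sends to the slit; \<open>a \<rightarrow> 2 \<lambda>\<close> as \<open>N \<rightarrow> \<infinity>\<close>. A new particle decreases \<open>L\<close> by at most \<open>a\<close>, and by \<open>a L / (2 \<pi> N)\<close>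
  on average. Hence \<open>E [1 / (L + c\<^sub>0)]\<close> grows at most at rate \<open>(1 + \<epsilon>) a\<close> in time, and by Markov's inequality \<open>L\<close> is large with high
  probability up to time \<open>\<theta> log N\<close> if \<open>(1 + \<epsilon>) a \<theta> < 1\<close>. While \<open>L\<close> is large a birth within the next time unit is
  likely. The Poisson process is reduced to independent landing points by cutting time into slots so short
  that no slot receives two particles.
\<close>

section \<open>The slit map in the half strip\<close>

text \<open>The constant comes from a decay rate. Particles arrive at total rate
  \<open>2 \<pi> N\<close> and each removes on average the fraction \<open>a / (2 \<pi> N)\<close>
  of \<open>L\<close>, so heuristically \<open>L\<close> is \<open>2 \<pi> N exp (- a t)\<close>,
  which stays above \<open>log N\<close> until about \<open>log N / a\<close>, with \<open>a\<close>
  close to \<open>2 \<lambda>\<close>. The obstacle is that the mean of \<open>L\<close> does not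
  exclude small values of \<open>L\<close>. Passing to the reciprocal turns a lower tail into an
  upper tail, for which a first moment suffices. The price is the convexity of the reciprocal: when
  \<open>L\<close> is comparable to a single loss \<open>a\<close>, one particle could multiply
  \<open>1 / L\<close> by a large factor. The shift \<open>c\<^sub>0\<close>, a multiple of
  \<open>a\<close> of order \<open>a / \<epsilon>\<close>, caps this effect and leaves only the
  factor \<open>1 + \<epsilon>\<close> in the rate. A second obstacle is that the Poisson process is
  given through counts in disjoint sets only; the landing points, their common law and their
  independence have to be recovered from such counts.\<close>

definition half_strip :: "complex set" where
  "half_strip = {u. 0 \<le> Re u \<and> Re u \<le> pi \<and> 0 \<le> Im u}"

lemma Re_cos_cosh: "Re (cos u) = cos (Re u) * cosh (Im u)" for u :: complex
  by (simp add: Re_cos cosh_def field_simps)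

lemma Im_cos_sinh: "Im (cos u) = - sin (Re u) * sinh (Im u)" for u :: complex
  by (simp add: Im_cos sinh_def field_simps)

text \<open>The half strip is a fundamental domain for the maps
  \<open>u \<mapsto> \<plusminus> u + 2 k \<pi>\<close>, which are the only coincidences of
  \<open>cos\<close>. With the minus sign both points are real and, having real parts that sum to
  \<open>0\<close> or \<open>2 \<pi>\<close>, are the same corner.\<close>

lemma inj_on_cos_half_strip: "inj_on cos half_strip"
proof (rule inj_onI)
  fix u v assume uv: "u \<in> half_strip" "v \<in> half_strip" "cos u = cos v"
  then obtain n where n: "n \<in> \<int>" "u = v + 2 * n * pi \<or> u = - v + 2 * n * pi"
    by (auto simp: complex_cos_eq)
  then obtain k :: int where k: "n = of_int k" by (auto elim: Ints_cases)
  have b: "0 \<le> Re u" "Re u \<le> pi" "0 \<le> Re v" "Re v \<le> pi" "0 \<le> Im u" "0 \<le> Im v"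
    using uv by (auto simp: half_strip_def)
  from n(2) show "u = v"
  proof
    assume e: "u = v + 2 * n * pi"
    then have r: "Re u = Re v + 2 * real_of_int k * pi" by (simp add: k)
    have "\<bar>2 * real_of_int k * pi\<bar> \<le> pi" using r b by linarith
    then have "2 * \<bar>real_of_int k\<bar> * pi \<le> 1 * pi" by (simp add: abs_mult)
    then have "2 * \<bar>real_of_int k\<bar> \<le> 1" using mult_le_cancel_right_pos pi_gt_zero by blast
    then have "k = 0" by linarith
    with e k show ?thesis by simp
  next
    assume e: "u = - v + 2 * n * pi"
    then have r: "Re u + Re v = 2 * real_of_int k * pi" and i: "Im u = - Im v" by (simp_all add: k)
    have i0: "Im u = 0" "Im v = 0" using i b by auto
    have "0 * pi \<le> real_of_int k * pi" "real_of_int k * pi \<le> 1 * pi" using r b by linarith+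
    then have "0 \<le> real_of_int k" "real_of_int k \<le> 1" using mult_le_cancel_right_pos pi_gt_zero by blast+
    then have "k = 0 \<or> k = 1" by linarith
    then have "Re u = Re v" using r b by auto
    then show ?thesis using i0 by (simp add: complex_eq_iff)
  qed
qed

lemma cos_half_strip_Im: "u \<in> half_strip \<Longrightarrow> Im (cos u) \<le> 0"
  by (auto simp: half_strip_def Im_cos_sinh intro!: mult_nonneg_nonneg sin_ge_zero)

lemma cos_half_strip_surj:
  assumes "Im z \<le> 0" shows "\<exists>u\<in>half_strip. cos u = z"
proof -
  define v where "v = (if Re (Arccos z) \<ge> 0 then Arccos z else - Arccos z)"
  have cv: "cos v = z" by (simp add: v_def)
  have rv: "0 \<le> Re v" "Re v \<le> pi" using Re_Arccos_bounds[of z] by (auto simp: v_def)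
  show ?thesis
  proof (cases "Im v \<ge> 0")
    case True then show ?thesis using cv rv by (auto simp: half_strip_def)
  next
    case False
    \<comment> \<open>With \<open>Im v < 0\<close> the sign of \<open>Im z\<close> forces
      \<open>sin (Re v) = 0\<close>. The cosine is then real, so conjugating \<open>v\<close> keeps
      it and moves \<open>v\<close> into the half strip.\<close>
    have "Im z = sin (Re v) * (- sinh (Im v))" using cv Im_cos_sinh[of v] by simp
    moreover have "- sinh (Im v) > 0" using False by (simp add: not_le)
    moreover have "sin (Re v) \<ge> 0" using rv by (rule sin_ge_zero)
    ultimately have "sin (Re v) = 0" using assms
      by (metis mult_pos_pos not_le order_le_less)
    then have "Im (cos v) = 0" by (simp add: Im_cos_sinh)
    then have "cos (cnj v) = z" using cv by (metis cnj_cos complex_is_Real_iff Reals_cnj_iff)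
    then show ?thesis using rv False by (intro bexI[of _ "cnj v"]) (auto simp: half_strip_def)
  qed
qed

text \<open>\<open>cos\<close> maps the half strip bijectively onto the closed lower half-plane,
  which division by \<open>c > 0\<close> preserves, so no branch has to be chosen. The edge of real
  part \<open>pi\<close> is included because the points of the bottom edge near \<open>pi\<close>
  are sent there: it is the second side of the slit.\<close>

definition strip_map :: "real \<Rightarrow> complex \<Rightarrow> complex" where
  "strip_map c u = inv_into half_strip cos (cos u / of_real c)"

lemma strip_map_props:
  assumes "c > 0" "u \<in> half_strip"
  shows strip_map_in: "strip_map c u \<in> half_strip" and cos_strip_map: "cos (strip_map c u) = cos u / of_real c"
proof -
  have "Im (cos u / of_real c) \<le> 0"
    using cos_half_strip_Im[OF assms(2)] assms(1) by (simp add: divide_nonpos_pos)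
  then have "cos u / of_real c \<in> cos ` half_strip" using cos_half_strip_surj by (metis imageI)
  then show "strip_map c u \<in> half_strip" "cos (strip_map c u) = cos u / of_real c"
    unfolding strip_map_def by (auto intro: inv_into_into f_inv_into_f)
qed

lemma strip_map_eqI:
  assumes "c > 0" "u \<in> half_strip" "v \<in> half_strip" "cos v = cos u / of_real c"
  shows "strip_map c u = v"
  using inj_onD[OF inj_on_cos_half_strip] strip_map_props[OF assms(1,2)] assms(3,4) by metis

lemma inj_on_strip_map: "c > 0 \<Longrightarrow> inj_on (strip_map c) half_strip"
proof (rule inj_onI)
  fix u v assume c: "c > 0" and "u \<in> half_strip" "v \<in> half_strip" "strip_map c u = strip_map c v"
  then have "cos u / of_real c = cos v / of_real c" using cos_strip_map by metis
  then show "u = v" using c inj_on_cos_half_strip \<open>u \<in> _\<close> \<open>v \<in> _\<close> by (auto dest: inj_onD)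
qed

text \<open>The reflection at the midline of the strip corresponds under \<open>cos\<close> to
  \<open>w \<mapsto> - cnj w\<close>, which commutes with division by a real number. It transfers
  facts from one side of the slit to the other and matches the two edges that the cylinder
  glues.\<close>

lemma strip_map_reflect:
  assumes "c > 0" "u \<in> half_strip"
  shows "strip_map c (of_real pi - cnj u) = of_real pi - cnj (strip_map c u)"
proof (rule strip_map_eqI)
  note p = strip_map_props[OF assms]
  show "of_real pi - cnj u \<in> half_strip" "of_real pi - cnj (strip_map c u) \<in> half_strip"
    using assms p by (auto simp: half_strip_def)
  have *: "cos (of_real pi - cnj z) = - cnj (cos z)" for z :: complex
    by (simp add: cos_diff cnj_cos flip: cos_of_real sin_of_real)
  show "cos (of_real pi - cnj (strip_map c u)) = cos (of_real pi - cnj u) / of_real c"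
    unfolding * p by simp
qed (use assms in auto)

text \<open>Controls the height of a point by its cosine: bounded cosines come from bounded heights,
  and \<open>cos\<close> has no zeros off the real axis.\<close>

lemma norm_cos_ge: "sinh \<bar>Im v\<bar> \<le> norm (cos v)" for v :: complex
proof -
  have "(norm (cos v))\<^sup>2 = (cos (Re v))\<^sup>2 * (cosh (Im v))\<^sup>2 + (sin (Re v))\<^sup>2 * (sinh (Im v))\<^sup>2"
    by (simp add: cmod_power2 Re_cos_cosh Im_cos_sinh power_mult_distrib)
  also have "\<dots> = (sinh (Im v))\<^sup>2 + (cos (Re v))\<^sup>2"
    by (simp add: sin_squared_eq cosh_square_eq algebra_simps)
  finally have "(sinh \<bar>Im v\<bar>)\<^sup>2 \<le> (norm (cos v))\<^sup>2" by (simp add: abs_if)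
  then show ?thesis by (rule power2_le_imp_le) simp
qed

text \<open>A continuous injection on a compact set has a continuous inverse. The half strip is not
  compact, so it is cut at height \<open>B\<close>; continuity is local, and every point lies
  strictly below some cut.\<close>

lemma continuous_on_strip_map:
  assumes c: "c > 0"
  shows "continuous_on half_strip (strip_map c)"
proof -
  have ct: "continuous_on (half_strip \<inter> {u. Im u < B}) (strip_map c)" if B: "B > 0" for B
  proof -
    define T where "T = half_strip \<inter> {u. Im u \<le> B}"
    \<comment> \<open>Below height \<open>B\<close> the cosine has norm at most
      \<open>cosh B\<close>, so by \<open>norm_cos_ge\<close> the image has height at most
      \<open>R\<close>.\<close>
    define R where "R = arsinh (cosh B / c)"
    define D where "D = half_strip \<inter> {u. Im u \<le> R}"
    have "D = cbox (Complex 0 0) (Complex pi R)"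
      by (auto simp: D_def half_strip_def in_cbox_complex_iff)
    then have cD: "compact D" by simp
    have m: "strip_map c u \<in> D" if "u \<in> T" for u
    proof -
      have u: "u \<in> half_strip" "Im u \<le> B" "0 \<le> Im u" using that by (auto simp: T_def half_strip_def)
      note p = strip_map_props[OF c u(1)]
      have "sinh (Im (strip_map c u)) \<le> norm (cos u / of_real c)"
        using norm_cos_ge[of "strip_map c u"] p by (auto simp: half_strip_def)
      also have "\<dots> = norm (cos u) / c" using c by (simp add: norm_divide)
      also have "norm (cos u) \<le> cosh B"
      proof -
        have "(norm (cos u))\<^sup>2 = (cos (Re u))\<^sup>2 * (cosh (Im u))\<^sup>2 + (sin (Re u))\<^sup>2 * (sinh (Im u))\<^sup>2"
          by (simp add: cmod_power2 Re_cos_cosh Im_cos_sinh power_mult_distrib)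
        also have "\<dots> = (cosh (Im u))\<^sup>2 - (sin (Re u))\<^sup>2"
          by (simp add: cos_squared_eq cosh_square_eq algebra_simps)
        finally have "(norm (cos u))\<^sup>2 \<le> (cosh (Im u))\<^sup>2" by simp
        then have "norm (cos u) \<le> cosh (Im u)" by (rule power2_le_imp_le) simp
        also have "\<dots> \<le> cosh B" using u by (simp add: cosh_real_nonneg_le_iff)
        finally show ?thesis .
      qed
      finally have "sinh (Im (strip_map c u)) \<le> sinh R"
        using c by (simp add: R_def divide_right_mono)
      then show ?thesis using p by (auto simp: D_def)
    qed
    have inj: "inj_on cos D" using inj_on_cos_half_strip by (rule inj_on_subset) (auto simp: D_def)
    have ci: "continuous_on (cos ` D) (inv_into D cos)"
      by (rule continuous_on_inv[OF _ cD]) (auto intro!: continuous_intros simp: inv_into_f_f[OF inj])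
    have eq: "strip_map c u = inv_into D cos (cos u / of_real c)" "cos u / of_real c \<in> cos ` D" if "u \<in> T" for u
    proof -
      have h: "u \<in> half_strip" using that by (auto simp: T_def)
      show "strip_map c u = inv_into D cos (cos u / of_real c)"
        using inv_into_f_f[OF inj m[OF that]] cos_strip_map[OF c h] by simp
      show "cos u / of_real c \<in> cos ` D"
        using m[OF that] cos_strip_map[OF c h] by (metis imageI)
    qed
    have "continuous_on T (\<lambda>u. inv_into D cos (cos u / of_real c))"
      by (rule continuous_on_compose2[OF ci]) (use c eq in \<open>auto intro!: continuous_intros\<close>)
    then have "continuous_on T (strip_map c)"
      by (rule continuous_on_eq) (simp add: eq)
    then show ?thesis by (rule continuous_on_subset) (auto simp: T_def)
  qed
  show ?thesis
    unfolding continuous_on_eq_continuous_within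
  proof
    fix u assume u: "u \<in> half_strip"
    then have "Im u + 1 > 0" by (auto simp: half_strip_def)
    then have "continuous (at u within half_strip \<inter> {v. Im v < Im u + 1}) (strip_map c)"
      using ct u by (auto simp: continuous_on_eq_continuous_within)
    moreover have "at u within half_strip \<inter> {v. Im v < Im u + 1} = at u within half_strip"
      by (rule at_within_nhd[where S="{v. Im v < Im u + 1}"]) (auto simp: open_halfspace_Im_lt)
    ultimately show "continuous (at u within half_strip) (strip_map c)" by simp
  qed
qed

lemma strip_map_of_real:
  assumes "c > 0" "0 \<le> x" "x \<le> pi" "\<bar>cos x\<bar> \<le> c"
  shows "strip_map c (of_real x) = of_real (arccos (cos x / c))"
proof (rule strip_map_eqI)
  have a: "-1 \<le> cos x / c" "cos x / c \<le> 1" using assms by (auto simp: field_simps)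
  show "of_real (arccos (cos x / c)) \<in> half_strip"
    using a by (auto simp: half_strip_def arccos_lbound arccos_ubound)
  show "cos (of_real (arccos (cos x / c))) = cos (of_real x) / (of_real c :: complex)"
    using a by (simp add: cos_of_real flip: of_real_divide)
qed (use assms in \<open>auto simp: half_strip_def\<close>)

lemma strip_map_eq_of_real:
  assumes "0 < c" "c \<le> 1" "0 \<le> y" "y \<le> pi"
  shows "strip_map c (of_real (arccos (c * cos y))) = of_real y"
proof (rule strip_map_eqI)
  have "\<bar>c * cos y\<bar> \<le> 1 * 1" unfolding abs_mult by (rule mult_mono) (use assms in auto)
  then have a: "-1 \<le> c * cos y" "c * cos y \<le> 1" by auto
  show "of_real (arccos (c * cos y)) \<in> half_strip"
    using a by (auto simp: half_strip_def arccos_lbound arccos_ubound)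
  show "cos (of_real y) = cos (of_real (arccos (c * cos y))) / (of_real c :: complex)"
    using a assms by (simp add: cos_of_real flip: of_real_divide)
qed (use assms in \<open>auto simp: half_strip_def\<close>)

text \<open>A real image would also be the image of a real point, namely
  \<open>arccos (c * cos y)\<close>, and injectivity would make \<open>u\<close> real.\<close>

lemma Im_strip_map_pos:
  assumes "0 < c" "c \<le> 1" "u \<in> half_strip" "0 < Im u"
  shows "0 < Im (strip_map c u)"
proof (rule ccontr)
  note p = strip_map_props[OF assms(1,3)]
  assume "\<not> 0 < Im (strip_map c u)"
  then have i: "Im (strip_map c u) = 0" using p by (auto simp: half_strip_def)
  define y where "y = Re (strip_map c u)"
  have y: "strip_map c u = of_real y" "0 \<le> y" "y \<le> pi"
    using i p(1) by (auto simp: y_def complex_eq_iff half_strip_def)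
  have "strip_map c u = strip_map c (of_real (arccos (c * cos y)))"
    using strip_map_eq_of_real y assms by simp
  moreover have "of_real (arccos (c * cos y)) \<in> half_strip"
  proof -
    have "\<bar>c * cos y\<bar> \<le> 1 * 1" unfolding abs_mult by (rule mult_mono) (use assms in auto)
    then show ?thesis by (auto simp: half_strip_def arccos_lbound arccos_ubound)
  qed
  ultimately have "u = of_real (arccos (c * cos y))"
    using inj_onD[OF inj_on_strip_map[OF assms(1)]] assms(3) by blast
  then show False using assms(4) by simp
qed

text \<open>As \<open>cos (i y) = cosh y\<close>, every real quotient \<open>r / c \<ge> 1\<close>
  is the cosine of a point on the left edge. This covers both the left edge itself and the part of
  the bottom edge that is bent up into the slit.\<close>

lemma strip_map_imaginary:
  assumes "0 < c" "cos u = of_real r" "c \<le> r" "u \<in> half_strip"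
  shows "strip_map c u = \<i> * of_real (arcosh (r / c))"
proof (rule strip_map_eqI)
  have "1 \<le> r / c" using assms by simp
  then show "\<i> * of_real (arcosh (r / c)) \<in> half_strip"
    by (auto simp: half_strip_def)
  have "cos (\<i> * of_real (arcosh (r / c))) = (of_real (cosh (arcosh (r/c))) :: complex)"
    by (simp add: complex_eq_iff Re_cos_cosh Im_cos_sinh)
  then show "cos (\<i> * of_real (arcosh (r / c))) = cos u / of_real c"
    using \<open>1 \<le> r / c\<close> assms by simp
qed (use assms in auto)

lemma strip_map_left_edge:
  assumes "0 < c" "c \<le> 1" "0 \<le> y"
  shows "strip_map c (\<i> * of_real y) = \<i> * of_real (arcosh (cosh y / c))"
proof (rule strip_map_imaginary)
  show "cos (\<i> * of_real y) = (of_real (cosh y) :: complex)"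
    by (simp add: complex_eq_iff Re_cos_cosh Im_cos_sinh)
  show "c \<le> cosh y" using assms cosh_real_ge_1[of y] by linarith
qed (use assms in \<open>auto simp: half_strip_def\<close>)

lemma strip_map_corner:
  assumes "0 < c" "0 \<le> x" "x \<le> pi" "c \<le> cos x"
  shows "strip_map c (of_real x) = \<i> * of_real (arcosh (cos x / c))"
  by (rule strip_map_imaginary) (use assms in \<open>auto simp: half_strip_def cos_of_real\<close>)

text \<open>Schwarz reflection across the left edge. A neighbourhood on the cylinder of a point of
  real part \<open>0\<close> has points on both sides of the seam, and this gives one continuous
  formula for all of them.\<close>

definition ext_strip_map :: "real \<Rightarrow> complex \<Rightarrow> complex" where
  "ext_strip_map c u = (if 0 \<le> Re u then strip_map c u else - cnj (strip_map c (- cnj u)))"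

lemma continuous_on_ext_strip_map:
  assumes c: "0 < c" "c \<le> 1"
  shows "continuous_on {u. \<bar>Re u\<bar> \<le> pi \<and> 0 \<le> Im u} (ext_strip_map c)"
proof -
  have 1: "{u. \<bar>Re u\<bar> \<le> pi \<and> 0 \<le> Im u} = half_strip \<union> (\<lambda>u. - cnj u) -` half_strip"
    by (auto simp: half_strip_def)
  have cl: "closed half_strip"
    unfolding half_strip_def
    by (intro closed_Collect_conj closed_Collect_le continuous_intros)
  have *: "continuous_on A (\<lambda>u. - cnj u)" for A by (intro continuous_intros)
  have "continuous_on (half_strip \<union> (\<lambda>u. - cnj u) -` half_strip)
          (\<lambda>u. if 0 \<le> Re u then strip_map c u else - cnj (strip_map c (- cnj u)))"
  proof (rule continuous_on_cases)
    show "closed half_strip" by (fact cl)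
    show "closed ((\<lambda>u. - cnj u) -` half_strip)"
      by (rule closed_vimage[OF cl *])
    show "continuous_on half_strip (strip_map c)" using continuous_on_strip_map c by blast
    show "continuous_on ((\<lambda>u. - cnj u) -` half_strip) (\<lambda>u. - cnj (strip_map c (- cnj u)))"
      by (intro continuous_on_minus continuous_on_cnj continuous_on_compose2[OF continuous_on_strip_map[OF c(1)]] *) auto
    \<comment> \<open>The two formulas meet on the left edge only; it is fixed by the reflection and
      mapped into the imaginary axis, so they agree there.\<close>
    show "\<forall>u. u \<in> half_strip \<and> \<not> 0 \<le> Re u \<or> u \<in> (\<lambda>u. - cnj u) -` half_strip \<and> 0 \<le> Re u \<longrightarrow>
        strip_map c u = - cnj (strip_map c (- cnj u))"
    proof (intro allI impI)
      fix u assume "u \<in> half_strip \<and> \<not> 0 \<le> Re u \<or> u \<in> (\<lambda>u. - cnj u) -` half_strip \<and> 0 \<le> Re u"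
      then have "Re u = 0" "0 \<le> Im u" by (auto simp: half_strip_def)
      then have u: "u = \<i> * of_real (Im u)" "- cnj u = u" by (auto simp: complex_eq_iff)
      show "strip_map c u = - cnj (strip_map c (- cnj u))"
        unfolding u(2) using strip_map_left_edge[OF c \<open>0 \<le> Im u\<close>] u(1)
        by (metis complex_cnj_mult complex_cnj_i complex_cnj_complex_of_real minus_minus mult_minus_left)
    qed
  qed
  then show ?thesis by (simp add: 1 ext_strip_map_def[abs_def])
qed

section \<open>The slit map on the cylinder\<close>

text \<open>As \<open>slit_delta N lam\<close> is \<open>tanh (lam / 2N)\<close>, this is
  \<open>1 / cosh (lam / 2N)\<close>.\<close>

definition slit_cos :: "nat \<Rightarrow> real \<Rightarrow> real" where
  "slit_cos N lam = sqrt (1 - (slit_delta N lam)\<^sup>2)"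

lemma slit_delta_bounds:
  assumes "N \<ge> 1" "lam > 0"
  shows "0 < slit_delta N lam" "slit_delta N lam < 1"
proof -
  have "exp (lam / real N) > 1" using assms by simp
  then show "0 < slit_delta N lam" "slit_delta N lam < 1"
    by (simp_all add: slit_delta_def field_simps add_pos_pos)
qed

lemma slit_cos_bounds:
  assumes "N \<ge> 1" "lam > 0"
  shows "0 < slit_cos N lam" "slit_cos N lam < 1" "slit_cos N lam \<le> 1"
proof -
  have "0 < (slit_delta N lam)\<^sup>2" "(slit_delta N lam)\<^sup>2 < 1"
    using slit_delta_bounds[OF assms] by (simp_all add: power_less_one_iff)
  then show "0 < slit_cos N lam" "slit_cos N lam < 1" "slit_cos N lam \<le> 1"
    by (simp_all add: slit_cos_def)
qed

text \<open>A single formula on the closed cylinder. The projection only matters for values on the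
  edge of real part \<open>pi\<close>, which it glues to the left edge.\<close>

definition slit_ext :: "nat \<Rightarrow> real \<Rightarrow> complex \<Rightarrow> complex" where
  "slit_ext N lam z =
     cyl_proj N (of_real (2 * real N) * strip_map (slit_cos N lam) (z / of_real (2 * real N)))"

lemma cyl_points_scale:
  assumes "N \<ge> 1" "z \<in> cyl_points N"
  shows "z / of_real (2 * real N) \<in> half_strip" "Re (z / of_real (2 * real N)) < pi"
  using assms by (auto simp: cyl_points_def base_circle_def half_strip_def field_simps
      simp del: of_real_mult)

lemma rmod_2pi_less: "N \<ge> 1 \<Longrightarrow> x rmod (2 * pi * real N) < 2 * pi * real N"
  by (rule rmod_less) simp

lemma rmod_2pi_nonneg: "N \<ge> 1 \<Longrightarrow> 0 \<le> x rmod (2 * pi * real N)"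
  by (rule rmod_nonneg) simp

lemma cyl_proj_cases:
  assumes N: "N \<ge> 1" and v: "v \<in> half_strip"
  shows "Re v < pi \<Longrightarrow> cyl_proj N (of_real (2 * real N) * v) = of_real (2 * real N) * v"
    and "Re v = pi \<Longrightarrow> cyl_proj N (of_real (2 * real N) * v) = \<i> * of_real (2 * real N * Im v)"
proof -
  show "cyl_proj N (of_real (2 * real N) * v) = of_real (2 * real N) * v" if "Re v < pi"
    by (rule cyl_proj_id) (use that v N in \<open>auto simp: cyl_points_def base_circle_def half_strip_def\<close>)
  show "cyl_proj N (of_real (2 * real N) * v) = \<i> * of_real (2 * real N * Im v)" if "Re v = pi"
  proof -
    have "2 * real N * pi = 2 * pi * real N" by simp
    then have "2 * real N * pi rmod (2 * pi * real N) = 0" by (metis rmod_self)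
    then show ?thesis using that by (simp add: cyl_proj_def complex_eq_iff del: of_real_mult)
  qed
qed

lemma cyl_proj_shift: "cyl_proj N (z + of_real (of_int k * (2 * pi * real N))) = cyl_proj N z"
proof -
  have "(Re z + of_int k * (2 * pi * real N)) rmod (2 * pi * real N) = Re z rmod (2 * pi * real N)"
    using rmod_add[of "Re z" "2 * pi * real N" "of_int k * (2 * pi * real N)"] by simp
  then show ?thesis by (simp add: cyl_proj_def)
qed

lemma cyl_proj_eq_shift: "\<exists>k::int. cyl_proj N z = z + of_real (of_int k * (2 * pi * real N))"
  by (rule exI[of _ "- \<lfloor>Re z / \<bar>2 * pi * real N\<bar>\<rfloor>"])
     (simp add: cyl_proj_def complex_eq_iff rmod_def)

section \<open>Identification of the slit map inside the cylinder\<close>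

lemma disc_map_shift:
  assumes "N \<ge> 1"
  shows "disc_map N (z + of_real (of_int k * (2 * pi * real N))) = disc_map N z"
proof -
  have "- \<i> * (z + of_real (of_int k * (2 * pi * real N))) / of_nat N =
      - \<i> * z / of_nat N + (of_int (2 * - k) * of_real pi) * \<i>"
    using assms by (simp add: field_simps)
  then show ?thesis
    unfolding disc_map_def exp_eq by (intro exI[of _ "- k"]) simp
qed

lemma disc_map_cyl_proj: "N \<ge> 1 \<Longrightarrow> disc_map N (cyl_proj N z) = disc_map N z"
  using cyl_proj_eq_shift[of N z] disc_map_shift by metis

lemma inj_on_disc_map:
  assumes "N \<ge> 1"
  shows "inj_on (disc_map N) (cyl_points N)"
proof (rule inj_onI)
  fix z w assume zw: "z \<in> cyl_points N" "w \<in> cyl_points N" "disc_map N z = disc_map N w"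
  then obtain n :: int where "- \<i> * z / of_nat N = - \<i> * w / of_nat N + (of_int (2 * n) * of_real pi) * \<i>"
    unfolding disc_map_def exp_eq by auto
  then have "z = w + of_real (of_int (- n) * (2 * pi * real N))"
    using assms by (simp add: field_simps)  (simp add: complex_eq_iff)
  then have "cyl_proj N z = cyl_proj N w" using cyl_proj_shift by metis
  then show "z = w" using cyl_proj_id zw by metis
qed

lemma norm_disc_map: "norm (disc_map N z) = exp (Im z / real N)"
  by (simp add: disc_map_def Re_divide_of_nat)

text \<open>\<open>disc_map N z\<close> is the square of \<open>exp (- i u)\<close>; cancelling one
  such factor leaves the exponential forms of sine and cosine. At zeros of the cosine both sides are
  \<open>0\<close> by the convention for division.\<close>

lemma mobius_disc_map:
  assumes "N \<ge> 1"
  shows "mobius_map (disc_map N z) = tan (z / of_real (2 * real N))"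
proof -
  define u where "u = z / of_real (2 * real N)"
  have "disc_map N z = exp (- \<i> * u) * exp (- \<i> * u)"
    unfolding disc_map_def exp_add[symmetric] using assms by (simp add: u_def field_simps)
  moreover have "exp (- \<i> * u) * exp (\<i> * u) = 1" by (simp flip: exp_add)
  ultimately have e: "disc_map N z - 1 = exp (- \<i> * u) * (exp (- \<i> * u) - exp (\<i> * u))"
      "disc_map N z + 1 = exp (- \<i> * u) * (exp (- \<i> * u) + exp (\<i> * u))"
    by (simp_all only: right_diff_distrib distrib_left)
  have "mobius_map (disc_map N z) = \<i> * ((exp (- \<i> * u) - exp (\<i> * u)) / (exp (- \<i> * u) + exp (\<i> * u)))"
    unfolding mobius_map_def e by simp
  also have "exp (- \<i> * u) - exp (\<i> * u) = - 2 * \<i> * sin u"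
    by (simp add: sin_exp_eq field_simps)
  also have "exp (- \<i> * u) + exp (\<i> * u) = 2 * cos u"
    by (simp add: cos_exp_eq field_simps)
  finally show ?thesis by (simp add: tan_def u_def)
qed

lemma inj_on_mobius_map: "inj_on mobius_map {w. 1 < norm w}"
proof (rule inj_onI)
  fix z w assume zw: "z \<in> {w. 1 < norm w}" "w \<in> {w. 1 < norm w}" "mobius_map z = mobius_map w"
  then have "z + 1 \<noteq> 0" "w + 1 \<noteq> 0" by (auto simp: add_eq_0_iff2)
  then have "(z - 1) * (w + 1) = (w - 1) * (z + 1)"
    using zw by (simp add: mobius_map_def frac_eq_eq)
  then show "z = w" by (simp add: algebra_simps)
qed

lemma cos_nonzero_upper: "0 < Im v \<Longrightarrow> cos v \<noteq> 0" for v :: complex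
  using norm_cos_ge[of v] by (metis abs_of_pos norm_zero not_le sinh_real_pos_iff)

text \<open>Serves to select the branch of the square root: of the two candidates
  \<open>tan v\<close> and \<open>- tan v\<close> only the first lies above the real axis.\<close>

lemma Im_tan_pos:
  fixes v :: complex
  assumes "0 < Im v" shows "0 < Im (tan v)"
proof -
  have s: "Re (sin v) = sin (Re v) * cosh (Im v)" "Im (sin v) = cos (Re v) * sinh (Im v)"
    by (simp_all add: Re_sin Im_sin cosh_def sinh_def field_simps)
  have "Im (tan v) = Im (sin v * cnj (cos v)) / (norm (cos v))\<^sup>2"
    by (simp add: tan_def complex_div_cnj[of "sin v"] Im_divide_of_real)
  also have "Im (sin v * cnj (cos v)) = sinh (Im v) * cosh (Im v) * ((sin (Re v))\<^sup>2 + (cos (Re v))\<^sup>2)"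
    unfolding complex_cnj times_complex.sel cnj.sel s Re_cos_cosh Im_cos_sinh by algebra
  finally have "Im (tan v) = sinh (Im v) * cosh (Im v) / (norm (cos v))\<^sup>2" by simp
  moreover have "sinh (Im v) * cosh (Im v) > 0" "(norm (cos v))\<^sup>2 > 0"
    using assms cos_nonzero_upper[OF assms] by simp_all
  ultimately show ?thesis by simp
qed

text \<open>With \<open>c\<^sup>2 = 1 - d\<^sup>2\<close> the relation
  \<open>cos v = cos u / c\<close> gives \<open>tan\<^sup>2 v = c\<^sup>2 (1 + tan\<^sup>2 u) - 1 =
  (1 - d\<^sup>2) tan\<^sup>2 u - d\<^sup>2\<close>, the radicand. So both sides have the same
  square, and the imaginary parts decide the sign.\<close>

lemma slit_half_plane_tan:
  assumes N: "N \<ge> 1" "lam > 0" and u: "u \<in> half_strip" "0 < Im u"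
  shows "slit_half_plane (slit_delta N lam) (tan u) = tan (strip_map (slit_cos N lam) u)"
proof -
  define c where "c = slit_cos N lam"
  define d where "d = slit_delta N lam"
  define v where "v = strip_map c u"
  have c: "0 < c" "c \<le> 1" using slit_cos_bounds[OF N] by (auto simp: c_def)
  have c2: "c\<^sup>2 = 1 - d\<^sup>2"
    using slit_delta_bounds[OF N] by (simp add: c_def d_def slit_cos_def power_le_one)
  have v: "v \<in> half_strip" "cos v = cos u / of_real c" "0 < Im v"
    using strip_map_props[OF c(1) u(1)] Im_strip_map_pos[OF c u] by (auto simp: v_def)
  have sec: "(tan z)\<^sup>2 = 1 / (cos z)\<^sup>2 - 1" if "cos z \<noteq> 0" for z :: complex
  proof -
    have "(sin z)\<^sup>2 = 1 - (cos z)\<^sup>2" by (simp add: sin_squared_eq)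
    then show ?thesis using that by (simp add: tan_def power_divide field_simps)
  qed
  define X where "X = (tan u)\<^sup>2 * (1 - (of_real d)\<^sup>2) - (of_real d)\<^sup>2"
  have "(1 - (of_real d)\<^sup>2 :: complex) = of_real (c\<^sup>2)" by (simp add: c2)
  then have cc: "(of_real c)\<^sup>2 = (1 - (of_real d)\<^sup>2 :: complex)" by simp
  have "X = (tan v)\<^sup>2"
    unfolding X_def cc[symmetric] sec[OF cos_nonzero_upper[OF u(2)]] sec[OF cos_nonzero_upper[OF v(3)]]
    using c c2 cc unfolding v(2) by (simp add: power_divide algebra_simps)
  moreover have "(slit_half_plane d (tan u))\<^sup>2 = X"
    by (simp add: slit_half_plane_def X_def power_mult_distrib)
  ultimately have "slit_half_plane d (tan u) = tan v \<or> slit_half_plane d (tan u) = - tan v"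
    by (simp add: power2_eq_iff)
  moreover have "0 \<le> Im (slit_half_plane d (tan u))"
    unfolding slit_half_plane_def Im_i_times by (rule Re_csqrt)
  ultimately show ?thesis using Im_tan_pos[OF v(3)] by (auto simp: v_def c_def d_def)
qed

lemma slit_ext_interior_in:
  assumes "N \<ge> 1" "lam > 0" "z \<in> cyl_interior N"
  shows "slit_ext N lam z \<in> cyl_interior N"
proof -
  have "z \<in> cyl_points N" using assms by (auto simp: cyl_points_def cyl_interior_def)
  then have "z / of_real (2 * real N) \<in> half_strip" using cyl_points_scale assms by blast
  moreover have "0 < Im (z / of_real (2 * real N))"
    using assms by (auto simp: cyl_interior_def simp del: of_real_mult)
  ultimately have "0 < Im (strip_map (slit_cos N lam) (z / of_real (2 * real N)))"
    using Im_strip_map_pos slit_cos_bounds assms by blast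
  then show ?thesis using assms(1)
    by (simp add: slit_ext_def cyl_interior_def cyl_proj_def base_circle_def rmod_2pi_less rmod_2pi_nonneg del: of_real_mult)
qed

text \<open>The inverse maps are never computed: the candidate value is pushed forward through
  \<open>disc_map\<close> and \<open>mobius_map\<close>, and injectivity cancels each
  \<open>inv_into\<close>.\<close>

lemma slit_interior_eq:
  assumes N: "N \<ge> 1" "lam > 0" and z: "z \<in> cyl_interior N"
  shows "slit_interior N lam z = slit_ext N lam z"
proof -
  let ?s = "of_real (2 * real N) :: complex"
  define u where "u = z / ?s"
  define v where "v = strip_map (slit_cos N lam) u"
  have zp: "z \<in> cyl_points N" using z by (auto simp: cyl_points_def cyl_interior_def)
  have u: "u \<in> half_strip" "0 < Im u"
    using cyl_points_scale[OF N(1) zp] z N by (auto simp: u_def cyl_interior_def simp del: of_real_mult)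
  have s: "slit_ext N lam z = cyl_proj N (?s * v)" by (simp add: slit_ext_def u_def v_def)
  have si: "slit_ext N lam z \<in> cyl_interior N" using slit_ext_interior_in N z by blast
  have "mobius_map (disc_map N (slit_ext N lam z)) = tan v"
    unfolding s disc_map_cyl_proj[OF N(1)] mobius_disc_map[OF N(1)] using N by simp
  then have "slit_half_plane (slit_delta N lam) (mobius_map (disc_map N z)) = mobius_map (disc_map N (slit_ext N lam z))"
    using slit_half_plane_tan[OF N u] mobius_disc_map[OF N(1), of z] by (simp add: u_def v_def)
  moreover have "inv_into {w. 1 < norm w} mobius_map (mobius_map (disc_map N (slit_ext N lam z))) = disc_map N (slit_ext N lam z)"
    by (rule inv_into_f_f[OF inj_on_mobius_map]) (use si N in \<open>auto simp: norm_disc_map cyl_interior_def\<close>)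
  moreover have "inv_into (cyl_interior N) (disc_map N) (disc_map N (slit_ext N lam z)) = slit_ext N lam z"
    by (rule inv_into_f_f[OF inj_on_subset[OF inj_on_disc_map[OF N(1)]] si]) (auto simp: cyl_points_def cyl_interior_def)
  ultimately show ?thesis by (simp add: slit_interior_def)
qed

section \<open>Continuity on the cylinder and the extension to the boundary circle\<close>

lemma continuous_map_cyl_proj_compose:
  assumes "N \<ge> 1" "continuous_on S f" "f ` S \<subseteq> half_plane"
  shows "continuous_map (top_of_set S) (cylinder N) (\<lambda>z. cyl_proj N (f z))"
proof -
  have "continuous_map (top_of_set S) (top_of_set half_plane) f"
    using assms by (auto simp: continuous_map_in_subtopology)
  from continuous_map_compose[OF this quotient_imp_continuous_map[OF quotient_map_cyl_proj[OF assms(1)]]]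
  show ?thesis by (simp add: o_def)
qed

text \<open>For negative real part the projection adds one period to \<open>w\<close>, that is
  \<open>pi\<close> to the scaled coordinate. By the reflection lemma the value also changes by
  \<open>pi\<close>, which is a period again and is removed by \<open>cyl_proj\<close>.\<close>

lemma slit_ext_cyl_proj:
  assumes N: "N \<ge> 1" "lam > 0" and w: "\<bar>Re w\<bar> < 2 * pi * real N" "0 \<le> Im w"
  shows "cyl_proj N (of_real (2 * real N) * ext_strip_map (slit_cos N lam) (w / of_real (2 * real N)))
       = slit_ext N lam (cyl_proj N w)"
proof (cases "0 \<le> Re w")
  case True
  then have "w \<in> cyl_points N" using w by (simp add: cyl_points_def base_circle_def)
  moreover have "0 \<le> Re (w / of_real (2 * real N))" using True by (simp del: of_real_mult)
  ultimately show ?thesis by (simp add: cyl_proj_id slit_ext_def ext_strip_map_def del: of_real_mult)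
next
  case False
  let ?s = "of_real (2 * real N) :: complex"
  define u where "u = w / ?s"
  have s0: "?s \<noteq> 0" using N by simp
  have "w + of_real (2 * pi * real N) \<in> cyl_points N"
    using w False by (simp add: cyl_points_def base_circle_def)
  then have cw: "cyl_proj N w = w + of_real (2 * pi * real N)"
    using cyl_proj_shift[of N w 1] cyl_proj_id by simp
  have "(w + of_real (2 * pi * real N)) / ?s = of_real pi - cnj (- cnj u)"
    using N by (simp add: u_def field_simps)
  moreover have "- cnj u \<in> half_strip"
    using w False N by (auto simp: u_def half_strip_def field_simps simp del: of_real_mult)
  ultimately have e1: "strip_map (slit_cos N lam) ((w + of_real (2 * pi * real N)) / ?s) =
      of_real pi - cnj (strip_map (slit_cos N lam) (- cnj u))"
    using strip_map_reflect slit_cos_bounds[OF N] by metis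
  have e2: "ext_strip_map (slit_cos N lam) u = - cnj (strip_map (slit_cos N lam) (- cnj u))"
  proof -
    have "Re u < 0" using False N by (simp add: u_def field_simps del: of_real_mult)
    then show ?thesis by (simp add: ext_strip_map_def)
  qed
  have "?s * strip_map (slit_cos N lam) ((w + of_real (2 * pi * real N)) / ?s) =
      ?s * ext_strip_map (slit_cos N lam) u + of_real (of_int 1 * (2 * pi * real N))"
    unfolding e1 e2 by (simp add: algebra_simps)
  then show ?thesis unfolding slit_ext_def cw u_def[symmetric] using cyl_proj_shift by metis
qed

lemma ext_strip_map_Im:
  assumes "c > 0" "\<bar>Re u\<bar> \<le> pi" "0 \<le> Im u" shows "0 \<le> Im (ext_strip_map c u)"
proof -
  have "u \<in> half_strip" if "0 \<le> Re u" using that assms by (auto simp: half_strip_def)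
  moreover have "- cnj u \<in> half_strip" if "\<not> 0 \<le> Re u" using that assms by (auto simp: half_strip_def)
  ultimately show ?thesis using strip_map_in[OF assms(1)] by (auto simp: ext_strip_map_def half_strip_def)
qed

text \<open>By the quotient map it suffices to lift to the half-plane, where local formulas are
  pasted together.\<close>

lemma continuous_map_slit_ext:
  assumes N: "N \<ge> 1" "lam > 0"
  shows "continuous_map (cylinder N) (cylinder N) (slit_ext N lam)"
proof -
  let ?p = "2 * pi * real N"
  let ?s = "of_real (2 * real N) :: complex"
  \<comment> \<open>The windows are two periods wide and centred at the seams, so each seam is
    interior to a window and the windows cover the half-plane.\<close>
  define T where "T k = {z \<in> half_plane. \<bar>Re z - of_int k * ?p\<bar> < ?p}" for k :: int
  define f where "f k z = cyl_proj N (?s * ext_strip_map (slit_cos N lam) ((z - of_real (of_int k * ?p)) / ?s))" for k :: int and z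
  have eq: "f k z = slit_ext N lam (cyl_proj N z)" if "z \<in> T k" for k z
  proof -
    have "f k z = slit_ext N lam (cyl_proj N (z - of_real (of_int k * ?p)))"
      unfolding f_def by (rule slit_ext_cyl_proj[OF N]) (use that in \<open>auto simp: T_def half_plane_def\<close>)
    also have "cyl_proj N (z - of_real (of_int k * ?p)) = cyl_proj N z"
      using cyl_proj_shift[of N "z - of_real (of_int k * ?p)" k] by simp
    finally show ?thesis .
  qed
  have "continuous_map (top_of_set half_plane) (cylinder N) (\<lambda>z. slit_ext N lam (cyl_proj N z))"
  proof (rule pasting_lemma[where I=UNIV and T=T and f=f])
    fix k :: int
    have "openin (top_of_set half_plane) (half_plane \<inter> {z. \<bar>Re z - of_int k * ?p\<bar> < ?p})"
      by (intro openin_open_Int open_Collect_less continuous_intros)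
    then show "openin (top_of_set half_plane) (T k)" by (simp add: T_def Int_def)
    have im: "\<bar>Re ((z - of_real (of_int k * ?p)) / ?s)\<bar> \<le> pi \<and> 0 \<le> Im ((z - of_real (of_int k * ?p)) / ?s)" if "z \<in> T k" for z
      using that N by (auto simp: T_def half_plane_def field_simps simp del: of_real_mult)
    have "continuous_on (T k) (\<lambda>z. ?s * ext_strip_map (slit_cos N lam) ((z - of_real (of_int k * ?p)) / ?s))"
      by (intro continuous_intros continuous_on_compose2[OF continuous_on_ext_strip_map])
         (use im slit_cos_bounds[OF N] N in auto)
    moreover have "(\<lambda>z. ?s * ext_strip_map (slit_cos N lam) ((z - of_real (of_int k * ?p)) / ?s)) ` T k \<subseteq> half_plane"
      using ext_strip_map_Im[OF slit_cos_bounds(1)[OF N]] im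
      by (auto simp: half_plane_def simp del: of_real_mult)
    ultimately have "continuous_map (top_of_set (T k)) (cylinder N) (f k)"
      unfolding f_def by (rule continuous_map_cyl_proj_compose[OF N(1)])
    moreover have "half_plane \<inter> T k = T k" by (auto simp: T_def)
    ultimately show "continuous_map (subtopology (top_of_set half_plane) (T k)) (cylinder N) (f k)"
      by (simp add: subtopology_subtopology)
  next
    fix i j z assume "z \<in> topspace (top_of_set half_plane) \<inter> T i \<inter> T j"
    then show "f i z = f j z" using eq by simp
  next
    fix z assume z: "z \<in> topspace (top_of_set half_plane)"
    define k where "k = \<lfloor>Re z / ?p\<rfloor>"
    have p: "?p > 0" using N by simp
    have "of_int k \<le> Re z / ?p" "Re z / ?p < of_int k + 1" unfolding k_def by linarith+
    then have "of_int k * ?p \<le> Re z" "Re z < (of_int k + 1) * ?p"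
      using p by (simp_all only: pos_le_divide_eq pos_divide_less_eq)
    then have "z \<in> T k" using z by (auto simp: T_def algebra_simps)
    then show "\<exists>j. j \<in> UNIV \<and> z \<in> T j \<and> slit_ext N lam (cyl_proj N z) = f j z" using eq by auto
  qed
  then show ?thesis
    using continuous_compose_quotient_map[OF quotient_map_cyl_proj[OF N(1)]] by (simp add: o_def)
qed

text \<open>\<open>disc_map N\<close> is a continuous injection of the cylinder into the plane. The
  Hausdorff property makes boundary limits unique and compact images closed.\<close>

lemma Hausdorff_cylinder:
  assumes "N \<ge> 1" shows "Hausdorff_space (cylinder N)"
proof (rule Hausdorff_space_injective_preimage[where f="disc_map N"])
  show "Hausdorff_space (euclidean :: complex topology)" by simp
  have "continuous_map (top_of_set half_plane) euclidean (disc_map N)"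
    unfolding disc_map_def using assms by (auto intro!: continuous_intros)
  then have "continuous_map (top_of_set half_plane) euclidean (disc_map N \<circ> cyl_proj N)"
    using disc_map_cyl_proj[OF assms] by (simp add: o_def)
  then show "continuous_map (cylinder N) euclidean (disc_map N)"
    using continuous_compose_quotient_map[OF quotient_map_cyl_proj[OF assms]] by blast
  show "inj_on (disc_map N) (topspace (cylinder N))"
    using inj_on_disc_map topspace_cylinder assms by simp
qed

text \<open>Uniqueness of a limit needs a nontrivial filter. A point slightly above \<open>z\<close>
  lies in every given neighbourhood and inside the cylinder.\<close>

lemma atin_within_cyl_interior_nontrivial:
  assumes N: "N \<ge> 1" and z: "z \<in> cyl_boundary N"
  shows "atin_within (cylinder N) z (cyl_interior N) \<noteq> bot"
proof
  assume "atin_within (cylinder N) z (cyl_interior N) = bot"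
  then have "eventually (\<lambda>_. False) (atin_within (cylinder N) z (cyl_interior N))" by simp
  moreover have zp: "z \<in> cyl_points N" using z by (auto simp: cyl_boundary_def cyl_points_def)
  ultimately obtain T where T: "openin (cylinder N) T" "z \<in> T" "\<forall>x\<in>T. x \<in> cyl_interior N \<longrightarrow> x = z"
    using N by (auto simp: eventually_atin_within topspace_cylinder)
  then have "openin (top_of_set half_plane) {z \<in> half_plane. cyl_proj N z \<in> T}"
    by (simp add: openin_cylinder cyl_openin_def)
  then obtain V where V: "open V" "{z \<in> half_plane. cyl_proj N z \<in> T} = half_plane \<inter> V"
    by (auto simp: openin_open)
  have "z \<in> half_plane" using zp by (auto simp: half_plane_def cyl_points_def)
  then have "z \<in> V" using V T cyl_proj_id[OF zp] by auto
  then obtain e where e: "e > 0" "ball z e \<subseteq> V" using V(1) open_contains_ball by blast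
  define w where "w = z + \<i> * of_real (e / 2)"
  have "dist z w = e / 2" using e by (simp add: w_def dist_norm norm_mult)
  then have "w \<in> V" using e by auto
  have wi: "w \<in> cyl_interior N" "w \<noteq> z" "w \<in> half_plane" "w \<in> cyl_points N"
    using z e by (auto simp: w_def cyl_interior_def cyl_boundary_def half_plane_def cyl_points_def)
  have "w \<in> {z \<in> half_plane. cyl_proj N z \<in> T}" unfolding V(2) using wi \<open>w \<in> V\<close> by blast
  then have "w \<in> T" using cyl_proj_id[OF wi(4)] by simp
  then show False using T wi by auto
qed

text \<open>At the boundary the limit exists because \<open>slit_ext\<close> is continuous up to the
  boundary and agrees with \<open>slit_interior\<close> inside; being unique, it is the value that
  \<open>THE\<close> selects.\<close>

lemma slit_map_eq:
  assumes N: "N \<ge> 1" "lam > 0" and z: "z \<in> cyl_points N"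
  shows "slit_map N lam z = slit_ext N lam z"
proof (cases "z \<in> cyl_interior N")
  case True then show ?thesis using slit_interior_eq N by (simp add: slit_map_def)
next
  case False
  then have zb: "z \<in> cyl_boundary N" using z by (auto simp: cyl_points_def cyl_interior_def cyl_boundary_def)
  have "limitin (cylinder N) (slit_ext N lam) (slit_ext N lam z) (atin (cylinder N) z)"
    using continuous_map_slit_ext[OF N] z N by (simp add: continuous_map_atin topspace_cylinder)
  then have "limitin (cylinder N) (slit_ext N lam) (slit_ext N lam z) (atin_within (cylinder N) z (cyl_interior N))"
    unfolding limitin_def by (auto elim!: filter_leD[rotated] simp: atin_within_def intro!: inf_mono)
  moreover have "eventually (\<lambda>x. slit_ext N lam x = slit_interior N lam x) (atin_within (cylinder N) z (cyl_interior N))"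
    unfolding atin_within_def using slit_interior_eq[OF N]
    by (auto simp: eventually_inf_principal intro!: always_eventually)
  ultimately have l: "limitin (cylinder N) (slit_interior N lam) (slit_ext N lam z) (atin_within (cylinder N) z (cyl_interior N))"
    by (rule limitin_transform_eventually[rotated])
  have "(THE w. limitin (cylinder N) (slit_interior N lam) w (atin_within (cylinder N) z (cyl_interior N))) = slit_ext N lam z"
  proof (rule the_equality)
    fix w assume "limitin (cylinder N) (slit_interior N lam) w (atin_within (cylinder N) z (cyl_interior N))"
    then show "w = slit_ext N lam z"
      by (rule limitin_Hausdorff_unique[OF _ l atin_within_cyl_interior_nontrivial[OF N(1) zb] Hausdorff_cylinder[OF N(1)]])
  qed (rule l)
  then show ?thesis using False by (simp add: slit_map_def)
qed

section \<open>Boundary image of the slit map and injectivity at interior points\<close>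

definition slit_height :: "nat \<Rightarrow> real \<Rightarrow> real" where
  "slit_height N lam = 2 * real N * arcosh (1 / slit_cos N lam)"

lemma slit_height_pos:
  assumes "N \<ge> 1" "lam > 0" shows "0 < slit_height N lam"
proof -
  have "1 / slit_cos N lam > 1" using slit_cos_bounds[OF assms] by simp
  then have "arcosh 1 < arcosh (1 / slit_cos N lam)" by (intro arcosh_real_strict_mono) auto
  then show ?thesis using assms by (simp add: slit_height_def)
qed

text \<open>\<open>strip_map\<close> is injective, so values can only coincide through the gluing of
  the two vertical edges, and then \<open>u\<close> and \<open>u'\<close> are mirror images. On an
  edge the cosine is real; for \<open>u\<close> above the real axis this forces
  \<open>Re u = 0\<close>, hence \<open>Re u' = pi\<close>, which the fundamental domain
  excludes.\<close>

lemma slit_ext_eq_interior: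
  assumes N: "N \<ge> 1" "lam > 0" and z: "z \<in> cyl_interior N" and z': "z' \<in> cyl_points N"
    and eq: "slit_ext N lam z = slit_ext N lam z'"
  shows "z = z'"
proof -
  let ?s = "of_real (2 * real N) :: complex"
  let ?c = "slit_cos N lam"
  note c = slit_cos_bounds[OF N]
  define u where "u = z / ?s"
  define u' where "u' = z' / ?s"
  have zp: "z \<in> cyl_points N" using z by (auto simp: cyl_points_def cyl_interior_def)
  have u: "u \<in> half_strip" "Re u < pi" and u': "u' \<in> half_strip" "Re u' < pi"
    using cyl_points_scale[OF N(1)] zp z' by (auto simp: u_def u'_def)
  have iu: "0 < Im u" using z N by (auto simp: u_def cyl_interior_def simp del: of_real_mult)
  define v where "v = strip_map ?c u"
  define v' where "v' = strip_map ?c u'"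
  have v: "v \<in> half_strip" "v' \<in> half_strip" using strip_map_in c u u' by (auto simp: v_def v'_def)
  have e: "cyl_proj N (?s * v) = cyl_proj N (?s * v')"
    using eq by (simp add: slit_ext_def u_def u'_def v_def v'_def)
  have N0: "real N > 0" using N by simp
  have refl: False if "v = of_real pi - cnj v'" "Re v = 0 \<or> Re v' = 0"
  proof -
    have "strip_map ?c u = strip_map ?c (of_real pi - cnj u')"
      using that(1) strip_map_reflect[OF c(1) u'(1)] by (simp add: v_def v'_def)
    moreover have "of_real pi - cnj u' \<in> half_strip" using u' by (auto simp: half_strip_def)
    ultimately have uu: "u = of_real pi - cnj u'" using inj_onD[OF inj_on_strip_map[OF c(1)]] u by blast
    have "sin (Re v) = 0" using that by auto
    then have "Im (cos v) = 0" by (simp add: Im_cos_sinh)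
    then have "Im (cos u) = 0" using cos_strip_map[OF c(1) u(1)] c by (simp add: v_def)
    then have "sin (Re u) = 0" using iu by (simp add: Im_cos_sinh)
    then have "Re u = 0" using u sin_gt_zero[of "Re u"] by (force simp: half_strip_def)
    then show False using uu u' by auto
  qed
  have lt: "v = v'" if "Re v < pi" "Re v' < pi"
    using e that cyl_proj_cases[OF N(1)] v N0 by simp
  have eqp: "v = v'" if "Re v = pi" "Re v' = pi"
    using e that cyl_proj_cases(2)[OF N(1)] v N0 by (simp add: complex_eq_iff)
  have "False" if "Re v < pi" "Re v' = pi"
  proof -
    have "?s * v = \<i> * of_real (2 * real N * Im v')" using e that cyl_proj_cases[OF N(1)] v by simp
    then have "2 * real N * Re v = 0" "2 * real N * Im v = 2 * real N * Im v'"
      by (auto simp: complex_eq_iff)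
    then have "v = of_real pi - cnj v'" "Re v = 0" using that N0 by (simp_all add: complex_eq_iff)
    then show False using refl by blast
  qed
  moreover have "False" if "Re v = pi" "Re v' < pi"
  proof -
    have "?s * v' = \<i> * of_real (2 * real N * Im v)"
      using e cyl_proj_cases(2)[OF N(1) v(1) that(1)] cyl_proj_cases(1)[OF N(1) v(2) that(2)] by metis
    then have "2 * real N * Re v' = 0" "2 * real N * Im v = 2 * real N * Im v'"
      by (auto simp: complex_eq_iff)
    then have "v = of_real pi - cnj v'" "Re v' = 0" using that N0 by (simp_all add: complex_eq_iff)
    then show False using refl by blast
  qed
  moreover have "Re v \<le> pi" "Re v' \<le> pi" using v by (auto simp: half_strip_def)
  ultimately have "v = v'" using lt eqp by (metis order_le_less)
  then have "u = u'" using inj_onD[OF inj_on_strip_map[OF c(1)]] u u' by (auto simp: v_def v'_def)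
  then show ?thesis using N by (simp add: u_def u'_def)
qed

lemma slit_ext_boundary_real:
  assumes N: "N \<ge> 1" "lam > 0" and x: "0 \<le> x" "x < 2 * pi * real N" and c: "\<bar>cos (x / (2 * real N))\<bar> \<le> slit_cos N lam"
  shows "slit_ext N lam (of_real x) =
           of_real ((2 * real N * arccos (cos (x / (2 * real N)) / slit_cos N lam)) rmod (2 * pi * real N))"
proof -
  have b: "0 \<le> x / (2 * real N)" "x / (2 * real N) \<le> pi" using x N by (auto simp: field_simps)
  have "strip_map (slit_cos N lam) (of_real (x / (2 * real N))) = of_real (arccos (cos (x / (2 * real N)) / slit_cos N lam))"
    by (rule strip_map_of_real[OF slit_cos_bounds(1)[OF N] b c])
  then show ?thesis
    by (simp add: slit_ext_def cyl_proj_def complex_eq_iff)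
qed

text \<open>\<open>slit_height N lam\<close> is the height of the image of \<open>0\<close>, the tip
  of the slit; since \<open>slit_cos N lam = 1 / cosh (lam / 2N)\<close>, it equals
  \<open>lam\<close>.\<close>

lemma slit_ext_image_boundary:
  assumes N: "N \<ge> 1" "lam > 0"
  shows "slit_ext N lam ` cyl_boundary N = cyl_boundary N \<union> (\<lambda>t. \<i> * of_real t) ` {0..slit_height N lam}"
    (is "?L = ?R")
proof
  let ?s = "of_real (2 * real N) :: complex"
  let ?c = "slit_cos N lam"
  note c = slit_cos_bounds[OF N]
  have N0: "real N > 0" using N by simp
  have H: "\<i> * of_real (2 * real N * arcosh (r / ?c)) \<in> ?R" if "?c \<le> r" "r \<le> 1" for r
  proof -
    have "1 \<le> r / ?c" "r / ?c \<le> 1 / ?c" using that c by (simp_all add: divide_right_mono)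
    then have "0 \<le> arcosh (r / ?c)" "arcosh (r / ?c) \<le> arcosh (1 / ?c)"
      using arcosh_real_strict_mono[of "r / ?c" "1 / ?c"] by (auto simp: order_le_less)
    then show ?thesis using N0 by (intro UnI2 image_eqI[where x="2 * real N * arcosh (r / ?c)"]) (auto simp: slit_height_def)
  qed
  show "?L \<subseteq> ?R"
  proof
    fix w assume "w \<in> ?L"
    then obtain z where z: "z \<in> cyl_boundary N" "w = slit_ext N lam z" by auto
    define x where "x = Re z / (2 * real N)"
    have u: "z / ?s = of_real x" using z N0 by (auto simp: x_def cyl_boundary_def complex_eq_iff simp del: of_real_mult)
    have x: "0 \<le> x" "x \<le> pi" using z N0 by (auto simp: x_def cyl_boundary_def base_circle_def field_simps)
    have w: "w = cyl_proj N (?s * strip_map ?c (of_real x))" using z(2) unfolding slit_ext_def u .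
    \<comment> \<open>The middle of the bottom edge stays on the base, the arc near \<open>0\<close>
      is bent up the left edge and the arc near \<open>pi\<close> up the right edge, which the
      projection glues to the left one.\<close>
    consider "\<bar>cos x\<bar> \<le> ?c" | "?c \<le> cos x" | "?c \<le> cos (pi - x)" by force
    then show "w \<in> ?R"
    proof cases
      case 1
      have "Im w = 0" unfolding w strip_map_of_real[OF c(1) x 1] by (simp add: cyl_proj_def)
      moreover have "Re w \<in> base_circle N"
        unfolding w using N(1) by (simp add: cyl_proj_def base_circle_def rmod_2pi_less rmod_2pi_nonneg)
      ultimately show ?thesis by (simp add: cyl_boundary_def)
    next
      case 2
      have e1: "?s * strip_map ?c (of_real x) = \<i> * of_real (2 * real N * arcosh (cos x / ?c))"
        unfolding strip_map_corner[OF c(1) x 2] by simp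
      have i: "\<i> * of_real (2 * real N * arcosh (cos x / ?c)) \<in> ?R" using H 2 by simp
      have e2: "cyl_proj N (\<i> * of_real (2 * real N * arcosh (cos x / ?c))) = \<i> * of_real (2 * real N * arcosh (cos x / ?c))"
        by (simp add: cyl_proj_def complex_eq_iff)
      show ?thesis unfolding w e1 e2 by (rule i)
    next
      case 3
      have y: "0 \<le> pi - x" "pi - x \<le> pi" using x by auto
      have "of_real (pi - x) \<in> half_strip" using y by (auto simp: half_strip_def)
      from strip_map_reflect[OF c(1) this]
      have m: "strip_map ?c (of_real x) = of_real pi - cnj (\<i> * of_real (arcosh (cos (pi - x) / ?c)))"
        unfolding strip_map_corner[OF c(1) y 3] by simp
      have "cyl_proj N (?s * strip_map ?c (of_real x)) = \<i> * of_real (2 * real N * Im (strip_map ?c (of_real x)))"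
      proof (rule cyl_proj_cases(2)[OF N(1)])
        show "strip_map ?c (of_real x) \<in> half_strip"
          by (rule strip_map_in[OF c(1)]) (use x in \<open>simp add: half_strip_def\<close>)
        show "Re (strip_map ?c (of_real x)) = pi" unfolding m by simp
      qed
      also have "\<dots> = \<i> * of_real (2 * real N * arcosh (cos (pi - x) / ?c))" by (simp add: m)
      finally show ?thesis using H[of "cos (pi - x)"] 3 by (simp add: w)
    qed
  qed
  show "?R \<subseteq> ?L"
  proof
    fix w assume "w \<in> ?R"
    then show "w \<in> ?L"
    proof
      assume w: "w \<in> cyl_boundary N"
      define y where "y = Re w / (2 * real N)"
      have y: "0 \<le> y" "y < pi" using w N0 by (auto simp: y_def cyl_boundary_def base_circle_def field_simps)
      define x where "x = arccos (?c * cos y)"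
      have "\<bar>?c * cos y\<bar> \<le> ?c * 1" unfolding abs_mult using c by (intro mult_mono) auto
      then have q: "-1 < ?c * cos y" "?c * cos y < 1" using c by auto
      have x: "0 \<le> x" "x < pi" using arccos_lt_bounded[OF q] by (auto simp: x_def)
      have s: "strip_map ?c (of_real x) = of_real y" unfolding x_def using strip_map_eq_of_real c y by simp
      have "slit_ext N lam (of_real (2 * real N * x)) = cyl_proj N (?s * of_real y)"
        using s N0 by (simp add: slit_ext_def)
      also have "\<dots> = cyl_proj N w" using w N0 by (intro arg_cong[where f="cyl_proj N"]) (auto simp: y_def cyl_boundary_def complex_eq_iff)
      also have "\<dots> = w" using w by (intro cyl_proj_id) (auto simp: cyl_boundary_def cyl_points_def)
      finally have "w = slit_ext N lam (of_real (2 * real N * x))" by simp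
      moreover have "of_real (2 * real N * x) \<in> cyl_boundary N"
        using x N0 by (simp add: cyl_boundary_def base_circle_def)
      ultimately show ?thesis by blast
    next
      assume "w \<in> (\<lambda>t. \<i> * of_real t) ` {0..slit_height N lam}"
      then obtain t where t: "w = \<i> * of_real t" "0 \<le> t" "t \<le> slit_height N lam" by auto
      define y where "y = t / (2 * real N)"
      have y: "0 \<le> y" "y \<le> arcosh (1 / ?c)" using t N0 by (auto simp: y_def slit_height_def field_simps)
      have "cosh y \<le> cosh (arcosh (1 / ?c))" using y by (simp add: cosh_real_nonneg_le_iff)
      also have "\<dots> = 1 / ?c" using c by (intro cosh_arcosh_real) simp
      finally have r: "?c \<le> ?c * cosh y" "?c * cosh y \<le> 1"
        using c cosh_real_ge_1[of y] by (simp_all add: field_simps)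
      define x where "x = arccos (?c * cosh y)"
      have rr: "-1 \<le> ?c * cosh y" using r c by linarith
      have cx: "cos x = ?c * cosh y" unfolding x_def by (rule cos_arccos[OF rr r(2)])
      have x: "0 \<le> x" "x \<le> pi" using arccos_bounded[OF rr r(2)] by (auto simp: x_def)
      have "x \<noteq> pi"
      proof
        assume "x = pi"
        then have "?c * cosh y = - 1" using cx by simp
        then show False using r c by linarith
      qed
      then have "x < pi" using x by simp
      have "arcosh (cos x / ?c) = y" using cx c y by (simp add: arcosh_cosh_real)
      then have s: "strip_map ?c (of_real x) = \<i> * of_real y"
        using strip_map_corner[OF c(1) x] cx r by simp
      have "slit_ext N lam (of_real (2 * real N * x)) = cyl_proj N (?s * (\<i> * of_real y))"
        using s N0 by (simp add: slit_ext_def)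
      also have "\<dots> = w" using N0 t by (simp add: y_def cyl_proj_def complex_eq_iff)
      finally have "w = slit_ext N lam (of_real (2 * real N * x))" by simp
      moreover have "of_real (2 * real N * x) \<in> cyl_boundary N"
        using x \<open>x < pi\<close> N0 by (simp add: cyl_boundary_def base_circle_def)
      ultimately show ?thesis by blast
    qed
  qed
qed

section \<open>Rotations and slit maps with an arbitrary centre\<close>

definition rot :: "nat \<Rightarrow> real \<Rightarrow> complex \<Rightarrow> complex" where
  "rot N x z = cyl_proj N (z + of_real x)"

lemma cyl_proj_add: "cyl_proj N (cyl_proj N z + w) = cyl_proj N (z + w)"
proof -
  obtain k :: int where "cyl_proj N z = z + of_real (of_int k * (2 * pi * real N))"
    using cyl_proj_eq_shift by blast
  then have "cyl_proj N z + w = z + w + of_real (of_int k * (2 * pi * real N))" by simp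
  then show ?thesis using cyl_proj_shift by metis
qed

lemma rot_rot: "rot N x (rot N y z) = rot N (x + y) z"
  unfolding rot_def cyl_proj_add by (simp add: add_ac)

lemma rot_0: "z \<in> cyl_points N \<Longrightarrow> rot N 0 z = z"
  by (simp add: rot_def cyl_proj_id)

lemma Im_rot [simp]: "Im (rot N x z) = Im z"
  by (simp add: rot_def cyl_proj_def)

lemma cyl_interior_iff: "z \<in> cyl_interior N \<longleftrightarrow> z \<in> cyl_points N \<and> 0 < Im z"
  by (auto simp: cyl_interior_def cyl_points_def)

lemma cyl_boundary_iff: "z \<in> cyl_boundary N \<longleftrightarrow> z \<in> cyl_points N \<and> Im z = 0"
  by (auto simp: cyl_boundary_def cyl_points_def)

lemma rot_in_cyl_points: "N \<ge> 1 \<Longrightarrow> z \<in> cyl_points N \<Longrightarrow> rot N x z \<in> cyl_points N"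
  unfolding rot_def by (rule cyl_proj_in_cyl_points) (auto simp: half_plane_def cyl_points_def)

lemma rot_image_boundary:
  assumes "N \<ge> 1" shows "rot N x ` cyl_boundary N = cyl_boundary N"
proof
  show "rot N x ` cyl_boundary N \<subseteq> cyl_boundary N"
    using assms by (auto simp: cyl_boundary_iff rot_in_cyl_points)
  show "cyl_boundary N \<subseteq> rot N x ` cyl_boundary N"
  proof
    fix z assume "z \<in> cyl_boundary N"
    then have "z = rot N x (rot N (- x) z)" "rot N (- x) z \<in> cyl_boundary N"
      using assms by (auto simp: cyl_boundary_iff rot_in_cyl_points rot_rot rot_0)
    then show "z \<in> rot N x ` cyl_boundary N" by blast
  qed
qed

lemma rot_inj: "z \<in> cyl_points N \<Longrightarrow> w \<in> cyl_points N \<Longrightarrow> rot N x z = rot N x w \<Longrightarrow> z = w"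
  using rot_rot[of N "- x" x] rot_0 by (metis add.left_inverse)

lemma continuous_map_rot:
  assumes "N \<ge> 1" shows "continuous_map (cylinder N) (cylinder N) (rot N x)"
proof -
  have "continuous_map (top_of_set half_plane) (cylinder N) (\<lambda>z. cyl_proj N (z + of_real x))"
    by (rule continuous_map_cyl_proj_compose[OF assms]) (auto intro!: continuous_intros simp: half_plane_def)
  then show ?thesis
    using continuous_compose_quotient_map[OF quotient_map_cyl_proj[OF assms], of "cylinder N" "rot N x"]
    by (simp add: o_def rot_def cyl_proj_add)
qed

lemma slit_ext_in_cyl_points:
  assumes "N \<ge> 1" "lam > 0" "z \<in> cyl_points N" shows "slit_ext N lam z \<in> cyl_points N"
  using continuous_map_slit_ext[OF assms(1,2)] assms topspace_cylinder[OF assms(1)]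
  by (auto simp: continuous_map_def)

lemma slit_map_at_eq:
  assumes "N \<ge> 1" "lam > 0" "z \<in> cyl_points N"
  shows "slit_map_at N lam x z = rot N x (slit_ext N lam (rot N (- x) z))"
proof -
  have "cyl_proj N (z - of_real x) = rot N (- x) z" by (simp add: rot_def)
  then show ?thesis
    using slit_map_eq[OF assms(1,2) rot_in_cyl_points[OF assms(1,3)], of "- x"]
    by (simp add: slit_map_at_def rot_def add.commute)
qed

lemma continuous_map_slit_map_at:
  assumes N: "N \<ge> 1" "lam > 0"
  shows "continuous_map (cylinder N) (cylinder N) (slit_map_at N lam x)"
proof (rule continuous_map_eq)
  show "continuous_map (cylinder N) (cylinder N) (rot N x \<circ> (slit_ext N lam \<circ> rot N (- x)))"
    by (intro continuous_map_compose[where X'="cylinder N"] continuous_map_rot continuous_map_slit_ext N)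
qed (use slit_map_at_eq N topspace_cylinder in auto)

lemma slit_map_at_interior:
  assumes N: "N \<ge> 1" "lam > 0" and z: "z \<in> cyl_interior N"
  shows "slit_map_at N lam x z \<in> cyl_interior N"
proof -
  have "rot N (- x) z \<in> cyl_interior N" using z N by (auto simp: cyl_interior_iff rot_in_cyl_points)
  then have "slit_ext N lam (rot N (- x) z) \<in> cyl_interior N" using slit_ext_interior_in N by blast
  then show ?thesis using z N by (auto simp: cyl_interior_iff rot_in_cyl_points slit_map_at_eq)
qed

lemma slit_map_at_in_cyl_points:
  assumes N: "N \<ge> 1" "lam > 0" and z: "z \<in> cyl_points N"
  shows "slit_map_at N lam x z \<in> cyl_points N"
  using assms by (simp add: slit_map_at_eq rot_in_cyl_points slit_ext_in_cyl_points)

lemma slit_map_at_eq_interior: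
  assumes N: "N \<ge> 1" "lam > 0" and z: "z \<in> cyl_interior N" "z' \<in> cyl_points N"
    and eq: "slit_map_at N lam x z = slit_map_at N lam x z'"
  shows "z = z'"
proof -
  have zp: "z \<in> cyl_points N" using z by (simp add: cyl_interior_iff)
  have i: "rot N (- x) z \<in> cyl_interior N" using z N by (auto simp: cyl_interior_iff rot_in_cyl_points)
  have "rot N x (slit_ext N lam (rot N (- x) z)) = rot N x (slit_ext N lam (rot N (- x) z'))"
    using eq slit_map_at_eq[OF N zp] slit_map_at_eq[OF N z(2)] by simp
  then have "slit_ext N lam (rot N (- x) z) = slit_ext N lam (rot N (- x) z')"
    by (rule rot_inj[rotated 2]) (intro slit_ext_in_cyl_points rot_in_cyl_points N zp z(2))+
  then have "rot N (- x) z = rot N (- x) z'"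
    using slit_ext_eq_interior[OF N i] rot_in_cyl_points N z by blast
  then show ?thesis using rot_inj zp z by blast
qed

definition slit_segment :: "nat \<Rightarrow> real \<Rightarrow> real \<Rightarrow> complex set" where
  "slit_segment N lam x = (\<lambda>t. cyl_proj N (Complex x t)) ` {0..slit_height N lam}"

lemma slit_map_at_image_boundary:
  assumes N: "N \<ge> 1" "lam > 0"
  shows "slit_map_at N lam x ` cyl_boundary N = cyl_boundary N \<union> slit_segment N lam x"
proof -
  have "slit_map_at N lam x ` cyl_boundary N = rot N x ` slit_ext N lam ` rot N (- x) ` cyl_boundary N"
    unfolding image_image using slit_map_at_eq[OF N] by (intro image_cong) (auto simp: cyl_boundary_iff)
  also have "\<dots> = cyl_boundary N \<union> rot N x ` (\<lambda>t. \<i> * of_real t) ` {0..slit_height N lam}"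
    by (simp only: rot_image_boundary[OF N(1)] slit_ext_image_boundary[OF N] image_Un)
  also have "rot N x ` (\<lambda>t. \<i> * of_real t) ` {0..slit_height N lam} = slit_segment N lam x"
    unfolding slit_segment_def image_image rot_def
    by (intro image_cong refl arg_cong[where f="cyl_proj N"]) (simp add: complex_eq_iff)
  finally show ?thesis .
qed

section \<open>Aggregate maps of finite lists of landing points\<close>

definition agg :: "nat \<Rightarrow> real \<Rightarrow> real list \<Rightarrow> complex \<Rightarrow> complex" where
  "agg N lam xs = foldr (\<lambda>x h. slit_map_at N lam x \<circ> h) xs id"

lemma aggregate_map_eq: "aggregate_map N lam A t = agg N lam (map snd (arrivals_upto A t))"
  by (simp add: aggregate_map_def agg_def foldr_map o_def)

lemma foldr_comp_snoc: "foldr (\<lambda>x h. f x \<circ> h) (xs @ [y]) id = foldr (\<lambda>x h. f x \<circ> h) xs id \<circ> f y"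
  by (induction xs) (auto simp: o_assoc)

text \<open>A later particle is composed innermost. This is why inductions on the list of landing
  points run from the right.\<close>

lemma agg_snoc: "agg N lam (xs @ [x]) = agg N lam xs \<circ> slit_map_at N lam x"
  unfolding agg_def by (rule foldr_comp_snoc)

lemma agg_Nil [simp]: "agg N lam [] = id"
  by (simp add: agg_def)

lemma continuous_map_agg:
  assumes N: "N \<ge> 1" "lam > 0"
  shows "continuous_map (cylinder N) (cylinder N) (agg N lam xs)"
proof (induction xs rule: rev_induct)
  case (snoc x xs)
  show ?case
    unfolding agg_snoc by (rule continuous_map_compose[OF continuous_map_slit_map_at[OF N] snoc])
qed (simp add: id_def)

lemma agg_interior:
  assumes N: "N \<ge> 1" "lam > 0"
  shows "z \<in> cyl_interior N \<Longrightarrow> agg N lam xs z \<in> cyl_interior N"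
  by (induction xs arbitrary: z rule: rev_induct) (auto simp: agg_snoc slit_map_at_interior[OF N])

lemma agg_eq_interior:
  assumes N: "N \<ge> 1" "lam > 0"
  shows "z \<in> cyl_interior N \<Longrightarrow> z' \<in> cyl_points N \<Longrightarrow> agg N lam xs z = agg N lam xs z' \<Longrightarrow> z = z'"
proof (induction xs arbitrary: z z' rule: rev_induct)
  case (snoc x xs)
  then show ?case
    by (metis (no_types, lifting) N agg_snoc comp_apply slit_map_at_interior slit_map_at_in_cyl_points slit_map_at_eq_interior)
qed simp

lemma agg_boundary_snoc:
  assumes N: "N \<ge> 1" "lam > 0"
  shows "agg N lam (xs @ [x]) ` cyl_boundary N =
         agg N lam xs ` cyl_boundary N \<union> agg N lam xs ` slit_segment N lam x"
  by (simp only: agg_snoc image_comp[symmetric] slit_map_at_image_boundary[OF N] image_Un)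

section \<open>Births of trees\<close>

text \<open>Finiteness matters because \<open>card\<close> of an infinite set is \<open>0\<close>,
  and births are measured by a strict increase of \<open>card\<close>. Each component is the
  component of a chosen point of some member of \<open>F\<close>.\<close>

lemma finite_connected_components_of_Union:
  assumes "finite F" "\<And>C. C \<in> F \<Longrightarrow> connectedin X C" "\<Union>F = topspace X"
  shows "finite (connected_components_of X)"
proof -
  have "connected_components_of X \<subseteq> (\<lambda>C. connected_component_of_set X (SOME z. z \<in> C)) ` F"
  proof
    fix D assume "D \<in> connected_components_of X"
    then obtain z where z: "z \<in> topspace X" "D = connected_component_of_set X z"
      by (auto simp: connected_components_of_def)
    then obtain C where C: "C \<in> F" "z \<in> C" using assms by blast
    then have "(SOME z. z \<in> C) \<in> C" by (auto intro: someI)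
    then have "connected_component_of X (SOME z. z \<in> C) z"
      using C assms(2) unfolding connected_component_of_def by blast
    then have "connected_component_of_set X (SOME z. z \<in> C) = D"
      using z connected_component_of_equiv by metis
    then show "D \<in> (\<lambda>C. connected_component_of_set X (SOME z. z \<in> C)) ` F" using C by blast
  qed
  then show ?thesis using assms(1) finite_surj by blast
qed

text \<open>Two complementary closed sets are also open, so no connected set crosses from one to the
  other and components may be computed in each part separately.\<close>

lemma connected_components_of_disjoint_Un:
  assumes X: "closedin X A" "closedin X B" and AB: "A \<inter> B = {}" "A \<union> B = topspace X"
    and B: "connectedin X B" "B \<noteq> {}"
  shows "connected_components_of X = insert B (connected_components_of (subtopology X A))"
    and "B \<notin> connected_components_of (subtopology X A)"
proof -
  have op: "openin X A" "openin X B"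
    using X AB by (metis Un_Diff_cancel2 Diff_triv Un_Diff Diff_cancel sup_bot_left sup_bot_right Int_commute openin_diff openin_topspace)+
  have A: "A \<subseteq> topspace X" using AB by auto
  have cB: "connected_component_of_set X z = B" if "z \<in> B" for z
  proof
    show "B \<subseteq> connected_component_of_set X z" using connected_component_of_maximal[OF B(1) that] .
    have "z \<in> connected_component_of_set X z" using that AB by (auto simp: connected_component_of_refl)
    then show "connected_component_of_set X z \<subseteq> B"
      using connectedin_clopen_cases[OF connectedin_connected_component_of X(2) op(2), of z] that
      by (auto simp: disjnt_def)
  qed
  have cA: "connected_component_of_set X z = connected_component_of_set (subtopology X A) z" if "z \<in> A" for z
  proof
    have "z \<in> connected_component_of_set X z" using that AB by (auto simp: connected_component_of_refl)
    then have "connected_component_of_set X z \<subseteq> A"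
      using connectedin_clopen_cases[OF connectedin_connected_component_of X(1) op(1), of z] that
      by (auto simp: disjnt_def)
    then have "connectedin (subtopology X A) (connected_component_of_set X z)"
      by (simp add: connectedin_subtopology connectedin_connected_component_of)
    then show "connected_component_of_set X z \<subseteq> connected_component_of_set (subtopology X A) z"
      using connected_component_of_maximal \<open>z \<in> connected_component_of_set X z\<close> by metis
    have "connectedin X (connected_component_of_set (subtopology X A) z)"
      using connectedin_connected_component_of connectedin_subtopology by metis
    moreover have "z \<in> connected_component_of_set (subtopology X A) z"
      using that A by (auto simp: connected_component_of_refl)
    ultimately show "connected_component_of_set (subtopology X A) z \<subseteq> connected_component_of_set X z"
      by (rule connected_component_of_maximal)
  qed
  have "topspace (subtopology X A) = A" using A by auto
  then have cs: "connected_components_of (subtopology X A) = connected_component_of_set X ` A"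
    unfolding connected_components_of_def using cA by (intro image_cong) auto
  have "connected_components_of X = connected_component_of_set X ` A \<union> connected_component_of_set X ` B"
    unfolding connected_components_of_def by (simp flip: AB(2) add: image_Un)
  also have "connected_component_of_set X ` B = {B}" using cB B(2) by auto
  finally show "connected_components_of X = insert B (connected_components_of (subtopology X A))"
    by (simp add: cs)
  show "B \<notin> connected_components_of (subtopology X A)"
  proof
    assume "B \<in> connected_components_of (subtopology X A)"
    then have "B \<subseteq> topspace (subtopology X A)" by (rule connected_components_of_subset)
    then show False using AB B A by auto
  qed
qed

definition tree_set :: "nat \<Rightarrow> real \<Rightarrow> real list \<Rightarrow> complex set" where
  "tree_set N lam xs = agg N lam xs ` cyl_boundary N - cyl_boundary N"

lemma num_trees_eq:
  "num_trees N lam A t =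
     card (connected_components_of (subtopology (cylinder N) (tree_set N lam (map snd (arrivals_upto A t)))))"
  by (simp add: num_trees_def trees_def tree_set_def aggregate_map_eq)

lemma cyl_boundary_subset: "cyl_boundary N \<subseteq> cyl_points N"
  by (auto simp: cyl_boundary_iff)

lemma compactin_cyl_boundary:
  assumes N: "N \<ge> 1" shows "compactin (cylinder N) (cyl_boundary N)"
proof -
  have "compactin (top_of_set half_plane) (of_real ` {0..2 * pi * real N})"
    by (auto simp: compactin_subtopology half_plane_def compactin_euclidean_iff intro!: compact_continuous_image continuous_intros)
  then have "compactin (cylinder N) (cyl_proj N ` of_real ` {0..2 * pi * real N})"
    using image_compactin quotient_imp_continuous_map quotient_map_cyl_proj N by blast
  moreover have "cyl_proj N ` of_real ` {0..2 * pi * real N} = cyl_boundary N"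
  proof
    show "cyl_proj N ` of_real ` {0..2 * pi * real N} \<subseteq> cyl_boundary N"
      using N by (auto simp: cyl_proj_def cyl_boundary_def base_circle_def rmod_2pi_less rmod_2pi_nonneg)
    show "cyl_boundary N \<subseteq> cyl_proj N ` of_real ` {0..2 * pi * real N}"
    proof
      fix z assume z: "z \<in> cyl_boundary N"
      then have "z = cyl_proj N (of_real (Re z))"
        using cyl_proj_id[of z N] by (auto simp: cyl_boundary_iff complex_is_Real_iff complex_eq_iff)
      then show "z \<in> cyl_proj N ` of_real ` {0..2 * pi * real N}"
        using z by (auto simp: cyl_boundary_def base_circle_def image_image intro!: image_eqI[where x="Re z"])
    qed
  qed
  ultimately show ?thesis by simp
qed

lemma continuous_map_vertical:
  assumes N: "N \<ge> 1" shows "continuous_map (top_of_set {0..}) (cylinder N) (\<lambda>t. cyl_proj N (Complex x t))"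
proof -
  have e: "Complex x t = of_real x + \<i> * of_real t" for t by (simp add: complex_eq_iff)
  have "continuous_map (top_of_set {0..}) (top_of_set half_plane) (\<lambda>t. Complex x t)"
    unfolding e by (auto simp: continuous_map_in_subtopology half_plane_def intro!: continuous_intros)
  from continuous_map_compose[OF this quotient_imp_continuous_map[OF quotient_map_cyl_proj[OF N]]]
  show ?thesis by (simp add: o_def)
qed

lemma
  assumes N: "N \<ge> 1" "lam > 0"
  shows compactin_slit_segment: "compactin (cylinder N) (slit_segment N lam x)"
    and connectedin_slit_segment: "connectedin (cylinder N) (slit_segment N lam x)"
    and connectedin_open_slit_segment: "connectedin (cylinder N) ((\<lambda>t. cyl_proj N (Complex x t)) ` {0<..slit_height N lam})"
  unfolding slit_segment_def
  by (auto intro!: image_compactin[OF _ continuous_map_vertical[OF N(1)]]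
        connectedin_continuous_map_image[OF continuous_map_vertical[OF N(1)]]
      simp: compactin_subtopology compactin_euclidean_iff connectedin_subtopology connectedin_iff_connected)

lemma slit_segment_eq:
  assumes N: "N \<ge> 1" "lam > 0"
  shows "slit_segment N lam x =
      insert (cyl_proj N (of_real x)) ((\<lambda>t. cyl_proj N (Complex x t)) ` {0<..slit_height N lam})"
proof -
  have "{0..slit_height N lam} = insert 0 {0<..slit_height N lam}" using slit_height_pos[OF N] by auto
  then show ?thesis by (simp add: slit_segment_def Complex_eq_0 complex_of_real_def)
qed

lemma open_slit_segment_interior:
  assumes N: "N \<ge> 1" shows "(\<lambda>t. cyl_proj N (Complex x t)) ` {0<..h} \<subseteq> cyl_interior N"
  using N by (auto simp: cyl_interior_def cyl_proj_def base_circle_def rmod_2pi_less rmod_2pi_nonneg)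

lemma cyl_interior_boundary_disjoint: "cyl_interior N \<inter> cyl_boundary N = {}"
  by (auto simp: cyl_interior_iff cyl_boundary_iff)

text \<open>Interior points stay inside, so only the foot of the new slit can be sent to the base
  circle. Removing the base circle thus removes at most an endpoint of the segment, and what remains
  is the image of an interval.\<close>

lemma tree_set_snoc:
  assumes N: "N \<ge> 1" "lam > 0"
  shows "\<exists>J. tree_set N lam (xs @ [x]) = tree_set N lam xs \<union> J \<and> connectedin (cylinder N) J \<and> J \<noteq> {} \<and>
     (agg N lam xs (cyl_proj N (of_real x)) \<in> cyl_boundary N \<longrightarrow>
        J = agg N lam xs ` (\<lambda>t. cyl_proj N (Complex x t)) ` {0<..slit_height N lam})"
proof -
  define R where "R = (\<lambda>t. cyl_proj N (Complex x t)) ` {0<..slit_height N lam}"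
  define J where "J = agg N lam xs ` slit_segment N lam x - cyl_boundary N"
  have Ri: "agg N lam xs ` R \<subseteq> cyl_interior N"
    using open_slit_segment_interior[OF N(1)] agg_interior[OF N] by (fastforce simp: R_def)
  have Rne: "R \<noteq> {}" using slit_height_pos[OF N] by (auto simp: R_def)
  have seg: "slit_segment N lam x = insert (cyl_proj N (of_real x)) R"
    unfolding R_def by (rule slit_segment_eq[OF N])
  have RJ: "agg N lam xs ` R \<subseteq> J" using Ri cyl_interior_boundary_disjoint by (auto simp: J_def seg)
  have J1: "J = agg N lam xs ` R" if "agg N lam xs (cyl_proj N (of_real x)) \<in> cyl_boundary N"
    using that RJ by (auto simp: J_def seg)
  have J2: "J = agg N lam xs ` slit_segment N lam x" if "agg N lam xs (cyl_proj N (of_real x)) \<notin> cyl_boundary N"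
    using that RJ by (auto simp: J_def seg)
  have "connectedin (cylinder N) J"
  proof (cases "agg N lam xs (cyl_proj N (of_real x)) \<in> cyl_boundary N")
    case True
    show ?thesis unfolding J1[OF True] R_def
      by (rule connectedin_continuous_map_image[OF continuous_map_agg[OF N] connectedin_open_slit_segment[OF N]])
  next
    case False
    show ?thesis unfolding J2[OF False]
      by (rule connectedin_continuous_map_image[OF continuous_map_agg[OF N] connectedin_slit_segment[OF N]])
  qed
  moreover have "tree_set N lam (xs @ [x]) = tree_set N lam xs \<union> J"
    by (auto simp: tree_set_def agg_boundary_snoc[OF N] J_def)
  moreover have "J \<noteq> {}" using RJ Rne by auto
  ultimately show ?thesis using J1 unfolding R_def by blast
qed

lemma finite_tree_components:
  assumes N: "N \<ge> 1" "lam > 0"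
  shows "finite (connected_components_of (subtopology (cylinder N) (tree_set N lam xs)))"
proof -
  have "\<exists>F. finite F \<and> (\<forall>C\<in>F. connectedin (cylinder N) C) \<and> \<Union>F = tree_set N lam xs"
  proof (induction xs rule: rev_induct)
    case Nil
    then show ?case by (intro exI[of _ "{}"]) (simp add: tree_set_def)
  next
    case (snoc x xs)
    then obtain F where F: "finite F" "\<forall>C\<in>F. connectedin (cylinder N) C" "\<Union>F = tree_set N lam xs" by blast
    obtain J where "tree_set N lam (xs @ [x]) = tree_set N lam xs \<union> J" "connectedin (cylinder N) J"
      using tree_set_snoc[OF N] by blast
    then show ?case using F by (intro exI[of _ "insert J F"]) auto
  qed
  then obtain F where F: "finite F" "\<And>C. C \<in> F \<Longrightarrow> connectedin (cylinder N) C" "\<Union>F = tree_set N lam xs" by blast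
  have "\<Union>F \<subseteq> topspace (cylinder N)" using F(2) connectedin_subset_topspace by blast
  then show ?thesis
    using F by (intro finite_connected_components_of_Union[of F]) (auto simp: connectedin_subtopology)
qed

text \<open>No interior point shares its image with another point, so the new piece \<open>J\<close>
  is disjoint from the old boundary image. The old trees and \<open>J\<close> are the traces of
  compact, hence closed, sets on their union, and \<open>J\<close> becomes a component of its
  own.\<close>

lemma tree_birth:
  assumes N: "N \<ge> 1" "lam > 0" and x: "agg N lam xs (cyl_proj N (of_real x)) \<in> cyl_boundary N"
  shows "card (connected_components_of (subtopology (cylinder N) (tree_set N lam xs))) <
         card (connected_components_of (subtopology (cylinder N) (tree_set N lam (xs @ [x]))))"
proof -
  define R where "R = (\<lambda>t. cyl_proj N (Complex x t)) ` {0<..slit_height N lam}"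
  define K where "K = tree_set N lam xs"
  define J where "J = agg N lam xs ` R"
  have J: "tree_set N lam (xs @ [x]) = K \<union> J" "connectedin (cylinder N) J" "J \<noteq> {}"
    using tree_set_snoc[OF N, of xs x] x by (auto simp: K_def J_def R_def)
  have Ri: "R \<subseteq> cyl_interior N" unfolding R_def by (rule open_slit_segment_interior[OF N(1)])
  have Ji: "J \<subseteq> cyl_interior N" using Ri agg_interior[OF N] by (auto simp: J_def)
  have disj: "J \<inter> agg N lam xs ` cyl_boundary N = {}"
  proof (rule ccontr)
    assume "J \<inter> agg N lam xs ` cyl_boundary N \<noteq> {}"
    then obtain z w where zw: "z \<in> R" "w \<in> cyl_boundary N" "agg N lam xs z = agg N lam xs w"
      by (auto simp: J_def)
    then have "z = w" using agg_eq_interior[OF N] Ri cyl_boundary_subset by blast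
    then show False using zw Ri cyl_interior_boundary_disjoint by blast
  qed
  let ?Y = "subtopology (cylinder N) (K \<union> J)"
  have H: "Hausdorff_space (cylinder N)" by (rule Hausdorff_cylinder[OF N(1)])
  have c1: "closedin (cylinder N) (agg N lam xs ` cyl_boundary N)"
    by (rule compactin_imp_closedin[OF H image_compactin[OF compactin_cyl_boundary[OF N(1)] continuous_map_agg[OF N]]])
  have c2: "closedin (cylinder N) (agg N lam xs ` slit_segment N lam x)"
    by (rule compactin_imp_closedin[OF H image_compactin[OF compactin_slit_segment[OF N] continuous_map_agg[OF N]]])
  have "K = (agg N lam xs ` cyl_boundary N) \<inter> (K \<union> J)" using disj by (auto simp: K_def tree_set_def)
  then have K: "closedin ?Y K" using c1 closedin_subtopology by metis
  \<comment> \<open>The closed slit adds to \<open>J\<close> only the image of its foot, which lies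
    on the base circle and hence outside the union.\<close>
  have "J = (agg N lam xs ` slit_segment N lam x) \<inter> (K \<union> J)"
  proof -
    have "agg N lam xs ` slit_segment N lam x = insert (agg N lam xs (cyl_proj N (of_real x))) J"
      by (simp add: slit_segment_eq[OF N] J_def R_def)
    then show ?thesis using x disj by (auto simp: K_def tree_set_def)
  qed
  then have Jc: "closedin ?Y J" using c2 closedin_subtopology by metis
  have "K \<union> J \<subseteq> topspace (cylinder N)"
    using closedin_subset[OF c1] connectedin_subset_topspace[OF J(2)] by (auto simp: K_def tree_set_def)
  then have top: "K \<union> J = topspace ?Y" by auto
  have d: "K \<inter> J = {}" using disj by (auto simp: K_def tree_set_def)
  have "connectedin ?Y J" using J by (simp add: connectedin_subtopology)
  note cc = connected_components_of_disjoint_Un[OF K Jc d top this J(3)]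
  have "subtopology ?Y K = subtopology (cylinder N) K" by (simp add: subtopology_subtopology Int_absorb1 Un_Int_distrib2)
  then show ?thesis
    using cc finite_tree_components[OF N, of xs] unfolding J(1) by (simp add: K_def)
qed

section \<open>Lengths on the circle\<close>

lemma sets_base_circle [measurable]: "base_circle N \<in> sets borel"
  by (simp add: base_circle_def)

lemma rmod_borel_measurable [measurable]: "(\<lambda>x. x rmod p) \<in> borel_measurable borel"
  unfolding rmod_def by measurable

text \<open>Outside \<open>{-1..1}\<close> the defining property of \<open>arccos\<close> has no
  solution, so its value there is one fixed constant.\<close>

lemma arccos_borel_measurable [measurable]: "arccos \<in> borel_measurable borel"
proof -
  have [measurable]: "(\<lambda>x. indicator {-1..1} x *\<^sub>R arccos x) \<in> borel_measurable borel"
    by (rule borel_measurable_continuous_on_indicator) (auto intro: continuous_on_arccos')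
  have out: "arccos x = (THE _. False)" if "x \<notin> {-1..1}" for x
  proof -
    have "\<not> (0 \<le> y \<and> y \<le> pi \<and> cos y = x)" for y using that by (metis atLeastAtMost_iff cos_ge_minus_one cos_le_one)
    then have "(\<lambda>y. 0 \<le> y \<and> y \<le> pi \<and> cos y = x) = (\<lambda>_. False)" by auto
    then show ?thesis by (simp only: arccos_def)
  qed
  have "arccos = (\<lambda>x. if x \<in> {-1..1} then indicator {-1..1} x *\<^sub>R arccos x else (THE _. False))"
    by (rule ext) (use out in auto)
  moreover have "(\<lambda>x. if x \<in> {-1..1} then indicator {-1..1} x *\<^sub>R arccos x else (THE _. False)) \<in> borel_measurable borel"
    by measurable
  ultimately show ?thesis by simp
qed

lemma nn_integral_circle_translation:
  fixes f :: "real \<Rightarrow> ennreal"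
  assumes N: "N \<ge> 1" and [measurable]: "f \<in> borel_measurable borel"
  shows "(\<integral>\<^sup>+s\<in>base_circle N. f ((x + s) rmod (2 * pi * real N)) \<partial>lborel) = (\<integral>\<^sup>+s\<in>base_circle N. f s \<partial>lborel)"
proof -
  let ?p = "2 * pi * real N"
  define r where "r = x rmod ?p"
  have p: "?p > 0" using N by simp
  have r: "0 \<le> r" "r < ?p" using rmod_2pi_less rmod_2pi_nonneg N by (auto simp: r_def)
  have xr: "(x + s) rmod ?p = (r + s) rmod ?p" for s
    using rmod_add[of "x rmod ?p" ?p s] rmod_add[of x ?p s] by (simp add: r_def)
  \<comment> \<open>The sum \<open>r + s\<close> wraps around at most once; the two cases become
    translates that together cover the circle. The factors \<open>1 *\<close> match the affine
    substitution rule.\<close>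
  have e: "f ((x + s) rmod ?p) * indicator (base_circle N) s =
      f (r + 1 * s) * indicator {r..<?p} (r + 1 * s) + f ((r - ?p) + 1 * s) * indicator {0..<r} ((r - ?p) + 1 * s)" for s
  proof (cases "s \<in> base_circle N")
    case False
    then show ?thesis using r by (auto simp: base_circle_def indicator_def)
  next
    case True
    show ?thesis
    proof (cases "r + s < ?p")
      case lt: True
      then have "(r + s) rmod ?p = r + s" using True r by (intro rmod_unique[where n=0]) (auto simp: base_circle_def)
      then show ?thesis using True lt r by (auto simp: xr base_circle_def indicator_def)
    next
      case ge: False
      then have "(r + s) rmod ?p = r + s - ?p" using True r by (intro rmod_unique[where n=1]) (auto simp: base_circle_def)
      then have "f ((x + s) rmod ?p) = f (r - ?p + s)" unfolding xr by (metis add_diff_eq add.commute)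
      then show ?thesis using True ge r by (auto simp: base_circle_def indicator_def)
    qed
  qed
  have "(\<integral>\<^sup>+s\<in>base_circle N. f ((x + s) rmod ?p) \<partial>lborel) =
     (\<integral>\<^sup>+s. f (r + 1 * s) * indicator {r..<?p} (r + 1 * s) \<partial>lborel) + (\<integral>\<^sup>+s. f ((r - ?p) + 1 * s) * indicator {0..<r} ((r - ?p) + 1 * s) \<partial>lborel)"
    unfolding e by (rule nn_integral_add) measurable
  also have "\<dots> = (\<integral>\<^sup>+s. f s * indicator {r..<?p} s \<partial>lborel) + (\<integral>\<^sup>+s. f s * indicator {0..<r} s \<partial>lborel)"
    using nn_integral_real_affine[of "\<lambda>s. f s * indicator {r..<?p} s" 1 r]
      nn_integral_real_affine[of "\<lambda>s. f s * indicator {0..<r} s" 1 "r - ?p"] by simp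
  also have "\<dots> = (\<integral>\<^sup>+s. f s * indicator {r..<?p} s + f s * indicator {0..<r} s \<partial>lborel)"
    by (rule nn_integral_add[symmetric]) measurable
  also have "\<dots> = (\<integral>\<^sup>+s\<in>base_circle N. f s \<partial>lborel)"
    using r by (intro nn_integral_cong) (auto simp: base_circle_def indicator_def)
  finally show ?thesis .
qed

text \<open>On the bottom edge of the strip two intervals of length \<open>arccos c\<close> are bent
  into the slit, one at each end; the scale is \<open>2 N\<close>, and on the circle they join to
  one arc around the landing point.\<close>

definition slit_arc :: "nat \<Rightarrow> real \<Rightarrow> real" where
  "slit_arc N lam = 4 * real N * arccos (slit_cos N lam)"

definition surviving :: "nat \<Rightarrow> real \<Rightarrow> real set" where
  "surviving N lam = {slit_arc N lam / 2..2 * pi * real N - slit_arc N lam / 2}"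

definition slit_real :: "nat \<Rightarrow> real \<Rightarrow> real \<Rightarrow> real" where
  "slit_real N lam v = 2 * real N * arccos (cos (v / (2 * real N)) / slit_cos N lam)"

lemma slit_real_borel_measurable [measurable]: "slit_real N lam \<in> borel_measurable borel"
  unfolding slit_real_def by measurable

lemma surviving_borel [measurable]: "surviving N lam \<in> sets borel"
  by (simp add: surviving_def)

lemma slit_arc_bounds:
  assumes N: "N \<ge> 1" "lam > 0"
  shows "0 < slit_arc N lam" "slit_arc N lam < 2 * pi * real N"
proof -
  note c = slit_cos_bounds[OF N]
  have "arccos 1 < arccos (slit_cos N lam)" "arccos (slit_cos N lam) < arccos 0"
    using c by (auto simp: arccos_less_arccos simp del: arccos_0 arccos_1)
  then show "0 < slit_arc N lam" "slit_arc N lam < 2 * pi * real N"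
    using N by (auto simp: slit_arc_def)
qed

lemma surviving_iff:
  assumes N: "N \<ge> 1" "lam > 0" and v: "v \<in> base_circle N"
  shows "v \<in> surviving N lam \<longleftrightarrow> \<bar>cos (v / (2 * real N))\<bar> \<le> slit_cos N lam"
proof -
  let ?c = "slit_cos N lam"
  note c = slit_cos_bounds[OF N]
  have N0: "0 < real N" using N by simp
  define u where "u = v / (2 * real N)"
  have u: "0 \<le> u" "u \<le> pi" using v N0 by (auto simp: u_def base_circle_def field_simps)
  have ac: "0 \<le> arccos ?c" "arccos ?c \<le> pi" "cos (arccos ?c) = ?c"
    using c by (auto intro: arccos_lbound arccos_ubound cos_arccos)
  have "cos u \<le> ?c \<longleftrightarrow> arccos ?c \<le> u" using cos_mono_le_eq[OF u ac(1,2)] ac(3) by simp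
  moreover have "- ?c \<le> cos u \<longleftrightarrow> u \<le> pi - arccos ?c"
    using cos_mono_le_eq[of "pi - arccos ?c" u] u ac by simp
  ultimately have "\<bar>cos u\<bar> \<le> ?c \<longleftrightarrow> arccos ?c \<le> u \<and> u \<le> pi - arccos ?c" by auto
  then show ?thesis using N0 by (simp add: surviving_def u_def slit_arc_def field_simps)
qed

lemma surviving_subset:
  assumes N: "N \<ge> 1" "lam > 0" shows "surviving N lam \<subseteq> base_circle N"
  using slit_arc_bounds[OF N] by (auto simp: surviving_def base_circle_def)

lemma emeasure_surviving:
  assumes N: "N \<ge> 1" "lam > 0"
  shows "emeasure lborel (surviving N lam) = ennreal (2 * pi * real N - slit_arc N lam)"
  using slit_arc_bounds[OF N] by (simp add: surviving_def)

text \<open>Here \<open>d\<close> is the derivative of the inverse \<open>s \<mapsto> 2 N arccos (c cos (s / 2N))\<close> of \<open>slit_real\<close>.\<close>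

lemma nn_integral_slit_real:
  assumes N: "N \<ge> 1" "lam > 0"
  obtains d :: "real \<Rightarrow> real" where "d \<in> borel_measurable borel" "\<And>s. 0 \<le> d s" "\<And>s. d s \<le> 1"
    "\<And>f :: real \<Rightarrow> real. f \<in> borel_measurable borel \<Longrightarrow>
       (\<integral>\<^sup>+v\<in>surviving N lam. ennreal (f (slit_real N lam v)) \<partial>lborel) = (\<integral>\<^sup>+s\<in>base_circle N. ennreal (f s * d s) \<partial>lborel)"
proof -
  let ?c = "slit_cos N lam"
  let ?p = "2 * pi * real N"
  note c = slit_cos_bounds[OF N]
  have N0: "0 < real N" using N by simp
  define g where "g s = 2 * real N * arccos (?c * cos (s / (2 * real N)))" for s
  define d where "d s = \<bar>?c * sin (s / (2 * real N)) / sqrt (1 - (?c * cos (s / (2 * real N)))\<^sup>2)\<bar>" for s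
  have b: "\<bar>?c * cos u\<bar> < 1" for u
  proof -
    have "\<bar>?c * cos u\<bar> \<le> ?c * 1" unfolding abs_mult using c by (intro mult_mono) auto
    then show ?thesis using c by simp
  qed
  have q: "(?c * cos u)\<^sup>2 < 1" for u
    using b[of u] by (simp add: abs_square_less_1)
  \<comment> \<open>The slit map stretches what survives over the whole circle, so its inverse
    contracts; here this is
    \<open>(c sin u)\<^sup>2 + (c cos u)\<^sup>2 = c\<^sup>2 \<le> 1\<close>.\<close>
  have d1: "d s \<le> 1" for s
  proof -
    have "(?c * sin u)\<^sup>2 \<le> 1 - (?c * cos u)\<^sup>2" for u
    proof -
      have "(?c * sin u)\<^sup>2 + (?c * cos u)\<^sup>2 = ?c\<^sup>2" by (simp add: power_mult_distrib flip: distrib_left)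
      also have "\<dots> \<le> 1" using c by (simp add: power_le_one)
      finally show ?thesis by simp
    qed
    then have "\<bar>?c * sin u\<bar> \<le> sqrt (1 - (?c * cos u)\<^sup>2)" for u
      by (metis real_le_rsqrt power2_abs)
    then show ?thesis using q[of "s / (2 * real N)"] by (simp add: d_def abs_divide divide_le_eq)
  qed
  have deriv: "(g has_real_derivative d s) (at s)" if "s \<in> {0..?p}" for s
  proof -
    have "0 \<le> s / (2 * real N)" "s / (2 * real N) \<le> pi" using that N0 by (auto simp: field_simps)
    then have "0 \<le> sin (s / (2 * real N))" by (rule sin_ge_zero)
    then have ds: "d s = ?c * sin (s / (2 * real N)) / sqrt (1 - (?c * cos (s / (2 * real N)))\<^sup>2)"
      using c q[of "s / (2 * real N)"] by (simp add: d_def abs_mult)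
    have "(arccos has_real_derivative inverse (- sqrt (1 - (?c * cos (s / (2 * real N)))\<^sup>2))) (at (?c * cos (s / (2 * real N))))"
      using b[of "s / (2 * real N)"] by (intro DERIV_arccos) auto
    moreover have "((\<lambda>s. ?c * cos (s / (2 * real N))) has_real_derivative - ?c * sin (s / (2 * real N)) / (2 * real N)) (at s)"
      using N0 by (auto intro!: derivative_eq_intros)
    ultimately have "((\<lambda>s. arccos (?c * cos (s / (2 * real N)))) has_real_derivative
       inverse (- sqrt (1 - (?c * cos (s / (2 * real N)))\<^sup>2)) * (- ?c * sin (s / (2 * real N)) / (2 * real N))) (at s)"
      by (rule DERIV_chain2[where f=arccos and g="\<lambda>s. ?c * cos (s / (2 * real N))"])
    from DERIV_cmult[OF this, of "2 * real N"]
    have "(g has_real_derivative 2 * real N * (inverse (- sqrt (1 - (?c * cos (s / (2 * real N)))\<^sup>2)) * (- ?c * sin (s / (2 * real N)) / (2 * real N)))) (at s)"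
      unfolding g_def[abs_def] .
    moreover have "2 * n * (inverse (- R) * (- k * S / (2 * n))) = k * S / R" if "n > 0" for n R S k :: real
      using that by (cases "R = 0") (simp_all add: field_simps)
    ultimately show ?thesis unfolding ds using N0 by metis
  qed
  have contd: "continuous_on {0..?p} d"
  proof -
    have nz: "sqrt (1 - (?c * cos u)\<^sup>2) \<noteq> 0" for u using q[of u] by simp
    show ?thesis unfolding d_def by (intro continuous_intros ballI nz) (use N0 in simp_all)
  qed
  have g0: "g 0 = slit_arc N lam / 2" by (simp add: g_def slit_arc_def)
  have gp: "g ?p = ?p - slit_arc N lam / 2"
    using N0 c by (simp add: g_def slit_arc_def arccos_minus algebra_simps)
  have inv: "slit_real N lam (g s) = s" if "s \<in> {0..?p}" for s
  proof -
    have s: "0 \<le> s / (2 * real N)" "s / (2 * real N) \<le> pi" using that N0 by (auto simp: field_simps)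
    have "cos (g s / (2 * real N)) = ?c * cos (s / (2 * real N))"
      using N0 b[of "s / (2 * real N)"] by (simp add: g_def cos_arccos abs_less_iff)
    then show ?thesis using c N0 arccos_cos[OF s] by (simp add: slit_real_def)
  qed
  have dnn: "0 \<le> d s" for s by (simp add: d_def)
  have meas: "d \<in> borel_measurable borel" unfolding d_def by measurable
  show ?thesis
  proof
    show "d \<in> borel_measurable borel" by fact
    show "0 \<le> d s" for s by (rule dnn)
    show "d s \<le> 1" for s by (rule d1)
    fix f :: "real \<Rightarrow> real" assume f[measurable]: "f \<in> borel_measurable borel"
    have "(\<integral>\<^sup>+v\<in>surviving N lam. ennreal (f (slit_real N lam v)) \<partial>lborel) =
      (\<integral>\<^sup>+v. ennreal (f (slit_real N lam v) * indicator {g 0..g ?p} v) \<partial>lborel)"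
      by (intro nn_integral_cong) (auto simp: surviving_def g0 gp indicator_def)
    also have "\<dots> = (\<integral>\<^sup>+s. ennreal (f (slit_real N lam (g s)) * d s * indicator {0..?p} s) \<partial>lborel)"
      by (rule nn_integral_substitution) (auto simp: deriv contd dnn set_borel_measurable_def)
    also have "\<dots> = (\<integral>\<^sup>+s. ennreal (f s * d s * indicator {0..?p} s) \<partial>lborel)"
      by (intro nn_integral_cong) (simp add: inv indicator_def)
    also have "\<dots> = (\<integral>\<^sup>+s\<in>base_circle N. ennreal (f s * d s) \<partial>lborel)"
    proof (rule nn_integral_cong_AE)
      have "AE s in lborel. s \<noteq> ?p" by (rule AE_lborel_singleton)
      then show "AE s in lborel. ennreal (f s * d s * indicator {0..?p} s) = ennreal (f s * d s) * indicator (base_circle N) s"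
        by eventually_elim (auto simp: base_circle_def indicator_def)
    qed
    finally show "(\<integral>\<^sup>+v\<in>surviving N lam. ennreal (f (slit_real N lam v)) \<partial>lborel) = (\<integral>\<^sup>+s\<in>base_circle N. ennreal (f s * d s) \<partial>lborel)" .
  qed
qed

text \<open>The part of the preimage of \<open>A\<close> under the slit map at \<open>x\<close> that
  is given by surviving points of the base circle, with \<open>y - x\<close> the position relative
  to the slit. Preimages appear because a new particle acts innermost.\<close>

definition pull :: "nat \<Rightarrow> real \<Rightarrow> real \<Rightarrow> real set \<Rightarrow> real set" where
  "pull N lam x A = {y \<in> base_circle N. (y - x) rmod (2 * pi * real N) \<in> surviving N lam \<and>
     (x + slit_real N lam ((y - x) rmod (2 * pi * real N))) rmod (2 * pi * real N) \<in> A}"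

lemma pull_borel [measurable]:
  assumes [measurable]: "A \<in> sets borel" shows "pull N lam x A \<in> sets borel"
  unfolding pull_def by measurable

lemma emeasure_pull:
  assumes N: "N \<ge> 1" "lam > 0" and [measurable]: "A \<in> sets borel"
  shows "emeasure lborel (pull N lam x A) =
     (\<integral>\<^sup>+v\<in>surviving N lam. ennreal (indicator A ((x + slit_real N lam v) rmod (2 * pi * real N))) \<partial>lborel)"
proof -
  let ?p = "2 * pi * real N"
  define f where "f y = (indicator {y. (y - x) rmod ?p \<in> surviving N lam \<and> (x + slit_real N lam ((y - x) rmod ?p)) rmod ?p \<in> A} y :: ennreal)" for y
  have [measurable]: "f \<in> borel_measurable borel" unfolding f_def by measurable
  have "emeasure lborel (pull N lam x A) = (\<integral>\<^sup>+y. indicator (pull N lam x A) y \<partial>lborel)" by simp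
  also have "\<dots> = (\<integral>\<^sup>+y\<in>base_circle N. f y \<partial>lborel)"
    by (intro nn_integral_cong) (auto simp: pull_def f_def indicator_def)
  also have "\<dots> = (\<integral>\<^sup>+v\<in>base_circle N. f ((x + v) rmod ?p) \<partial>lborel)"
    by (rule nn_integral_circle_translation[OF N(1), symmetric]) measurable
  also have "\<dots> = (\<integral>\<^sup>+v\<in>surviving N lam. ennreal (indicator A ((x + slit_real N lam v) rmod ?p)) \<partial>lborel)"
  proof (rule nn_integral_cong)
    fix v
    show "f ((x + v) rmod ?p) * indicator (base_circle N) v =
        ennreal (indicator A ((x + slit_real N lam v) rmod ?p)) * indicator (surviving N lam) v"
    proof (cases "v \<in> base_circle N")
      case True
      have "((x + v) rmod ?p - x) rmod ?p = (x + v - x) rmod ?p"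
        using rmod_diff[of "(x + v) rmod ?p" ?p x] rmod_diff[of "x + v" ?p x] by simp
      also have "\<dots> = v" using True by (simp add: base_circle_def)
      finally show ?thesis using True by (auto simp: f_def indicator_def)
    next
      case False
      then show ?thesis using surviving_subset[OF N] by (auto simp: indicator_def)
    qed
  qed
  finally show ?thesis .
qed

lemma emeasure_circle_translation:
  assumes N: "N \<ge> 1" and A[measurable]: "A \<in> sets borel" "A \<subseteq> base_circle N"
  shows "(\<integral>\<^sup>+s\<in>base_circle N. ennreal (indicator A ((x + s) rmod (2 * pi * real N))) \<partial>lborel) = emeasure lborel A"
proof -
  have "(\<integral>\<^sup>+s\<in>base_circle N. ennreal (indicator A ((x + s) rmod (2 * pi * real N))) \<partial>lborel) =
    (\<integral>\<^sup>+s\<in>base_circle N. ennreal (indicator A s) \<partial>lborel)"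
    by (rule nn_integral_circle_translation[OF N]) measurable
  also have "\<dots> = (\<integral>\<^sup>+s. indicator A s \<partial>lborel)"
    using A(2) by (intro nn_integral_cong) (auto simp: indicator_def)
  finally show ?thesis by simp
qed

lemma emeasure_pull_le:
  assumes N: "N \<ge> 1" "lam > 0" and A[measurable]: "A \<in> sets borel" "A \<subseteq> base_circle N"
  shows "emeasure lborel (pull N lam x A) \<le> emeasure lborel A"
proof -
  let ?p = "2 * pi * real N"
  obtain d :: "real \<Rightarrow> real" where d: "d \<in> borel_measurable borel" "\<And>s. 0 \<le> d s" "\<And>s. d s \<le> 1"
    "\<And>f :: real \<Rightarrow> real. f \<in> borel_measurable borel \<Longrightarrow>
       (\<integral>\<^sup>+v\<in>surviving N lam. ennreal (f (slit_real N lam v)) \<partial>lborel) = (\<integral>\<^sup>+s\<in>base_circle N. ennreal (f s * d s) \<partial>lborel)"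
    using nn_integral_slit_real[OF N] by blast
  have "emeasure lborel (pull N lam x A) = (\<integral>\<^sup>+s\<in>base_circle N. ennreal (indicator A ((x + s) rmod ?p) * d s) \<partial>lborel)"
    unfolding emeasure_pull[OF N A(1)] by (rule d(4)[where f="\<lambda>s. indicator A ((x + s) rmod ?p)"]) measurable
  also have "\<dots> \<le> (\<integral>\<^sup>+s\<in>base_circle N. ennreal (indicator A ((x + s) rmod ?p)) \<partial>lborel)"
    using d(3) by (intro nn_integral_mono) (auto simp: indicator_def)
  also have "\<dots> = emeasure lborel A" by (rule emeasure_circle_translation[OF N(1) A])
  finally show ?thesis .
qed

text \<open>The preimages of \<open>A\<close> and of its complement partition the translated
  surviving arc. Together with contraction for the complement this limits how much of
  \<open>A\<close> one particle can remove.\<close>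

lemma emeasure_pull_Compl:
  assumes N: "N \<ge> 1" "lam > 0" and A[measurable]: "A \<in> sets borel" "A \<subseteq> base_circle N"
  shows "emeasure lborel (pull N lam x A) + emeasure lborel (pull N lam x (base_circle N - A)) =
    ennreal (2 * pi * real N - slit_arc N lam)"
proof -
  let ?p = "2 * pi * real N"
  have i: "ennreal (indicator A ((x + s) rmod ?p)) + ennreal (indicator (base_circle N - A) ((x + s) rmod ?p)) = 1" for s
    using rmod_2pi_less[OF N(1), of "x + s"] rmod_2pi_nonneg[OF N(1), of "x + s"] by (simp add: indicator_def base_circle_def)
  have "emeasure lborel (pull N lam x A) + emeasure lborel (pull N lam x (base_circle N - A)) =
    (\<integral>\<^sup>+v. ennreal (indicator A ((x + slit_real N lam v) rmod ?p)) * indicator (surviving N lam) v +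
        ennreal (indicator (base_circle N - A) ((x + slit_real N lam v) rmod ?p)) * indicator (surviving N lam) v \<partial>lborel)"
    by (simp add: emeasure_pull[OF N] nn_integral_add)
  also have "\<dots> = (\<integral>\<^sup>+v. indicator (surviving N lam) v \<partial>lborel)"
    by (simp add: i flip: distrib_right)
  also have "\<dots> = ennreal (?p - slit_arc N lam)" by (simp add: emeasure_surviving[OF N])
  finally show ?thesis .
qed

text \<open>By Fubini the relative position \<open>v\<close> may be fixed first; then
  \<open>x + slit_real N lam v\<close> runs uniformly over the circle with \<open>x\<close>. So on
  average one landing removes the fraction \<open>a / (2 \<pi> N)\<close> of \<open>A\<close>, where
  \<open>a = slit_arc N lam\<close>.\<close>

lemma nn_integral_emeasure_pull:
  assumes N: "N \<ge> 1" "lam > 0" and A[measurable]: "A \<in> sets borel" "A \<subseteq> base_circle N"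
  shows "(\<integral>\<^sup>+x\<in>base_circle N. emeasure lborel (pull N lam x A) \<partial>lborel) =
    emeasure lborel A * ennreal (2 * pi * real N - slit_arc N lam)"
proof -
  let ?p = "2 * pi * real N"
  have "(\<integral>\<^sup>+x\<in>base_circle N. emeasure lborel (pull N lam x A) \<partial>lborel) =
    (\<integral>\<^sup>+x. (\<integral>\<^sup>+v. ennreal (indicator A ((x + slit_real N lam v) rmod ?p)) * indicator (surviving N lam) v * indicator (base_circle N) x \<partial>lborel) \<partial>lborel)"
    by (simp add: emeasure_pull[OF N A(1)] nn_integral_multc)
  also have "\<dots> = (\<integral>\<^sup>+v. (\<integral>\<^sup>+x. ennreal (indicator A ((x + slit_real N lam v) rmod ?p)) * indicator (surviving N lam) v * indicator (base_circle N) x \<partial>lborel) \<partial>lborel)"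
    by (rule lborel_pair.Fubini') measurable
  also have "\<dots> = (\<integral>\<^sup>+v. emeasure lborel A * indicator (surviving N lam) v \<partial>lborel)"
  proof (rule nn_integral_cong)
    fix v
    have "(\<integral>\<^sup>+x. ennreal (indicator A ((x + slit_real N lam v) rmod ?p)) * indicator (surviving N lam) v * indicator (base_circle N) x \<partial>lborel)
      = (\<integral>\<^sup>+x. (ennreal (indicator A ((slit_real N lam v + x) rmod ?p)) * indicator (base_circle N) x) * indicator (surviving N lam) v \<partial>lborel)"
      by (intro nn_integral_cong) (simp add: add.commute mult_ac)
    also have "\<dots> = emeasure lborel A * indicator (surviving N lam) v"
      by (simp add: nn_integral_multc emeasure_circle_translation[OF N(1) A])
    finally show "(\<integral>\<^sup>+x. ennreal (indicator A ((x + slit_real N lam v) rmod ?p)) * indicator (surviving N lam) v * indicator (base_circle N) x \<partial>lborel)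
      = emeasure lborel A * indicator (surviving N lam) v" .
  qed
  also have "\<dots> = emeasure lborel A * ennreal (?p - slit_arc N lam)"
    by (simp add: nn_integral_cmult emeasure_surviving[OF N])
  finally show ?thesis .
qed

section \<open>Independent landing points\<close>

text \<open>The points that the aggregate map of the first \<open>k\<close> landings sends to the base circle (see \<open>agg_base_set\<close>);
  entries of \<open>w\<close> outside the circle stand for slots without a landing.\<close>

primrec base_set :: "nat \<Rightarrow> real \<Rightarrow> (nat \<Rightarrow> real) \<Rightarrow> nat \<Rightarrow> real set" where
  "base_set N lam w 0 = base_circle N"
| "base_set N lam w (Suc k) =
     (if w k \<in> base_circle N then pull N lam (w k) (base_set N lam w k) else base_set N lam w k)"

lemma base_set_subset: "base_set N lam w k \<subseteq> base_circle N"
  by (induction k) (auto simp: pull_def)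

lemma base_set_borel [measurable]: "base_set N lam w k \<in> sets borel"
  by (induction k) auto

lemma base_set_cong: "(\<And>i. i < k \<Longrightarrow> w i = w' i) \<Longrightarrow> base_set N lam w k = base_set N lam w' k"
  by (induction k) auto

definition base_length :: "nat \<Rightarrow> real \<Rightarrow> (nat \<Rightarrow> real) \<Rightarrow> nat \<Rightarrow> real" where
  "base_length N lam w k = measure lborel (base_set N lam w k)"

lemma emeasure_circle_subset:
  assumes "A \<in> sets borel" "A \<subseteq> base_circle N"
  shows "emeasure lborel A = ennreal (measure lborel A)"
proof -
  have "emeasure lborel A \<le> emeasure lborel (base_circle N)" using assms by (intro emeasure_mono) auto
  also have "\<dots> < \<infinity>" by (simp add: base_circle_def)
  finally show ?thesis by (intro emeasure_eq_ennreal_measure) auto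
qed

lemma pull_subset: "pull N lam x A \<subseteq> base_circle N"
  by (auto simp: pull_def)

text \<open>The second bound is the first one for the complement, read through the identity that the
  two preimages have total length \<open>2 \<pi> N - a\<close>.\<close>

lemma measure_pull_bounds:
  assumes N: "N \<ge> 1" "lam > 0" and A: "A \<in> sets borel" "A \<subseteq> base_circle N"
  shows "measure lborel (pull N lam x A) \<le> measure lborel A"
    and "measure lborel A \<le> measure lborel (pull N lam x A) + slit_arc N lam"
proof -
  let ?p = "2 * pi * real N"
  have C: "base_circle N - A \<in> sets borel" "base_circle N - A \<subseteq> base_circle N" using A by auto
  note em = emeasure_circle_subset[OF pull_borel[OF A(1)] pull_subset] emeasure_circle_subset[OF A]
    emeasure_circle_subset[OF C] emeasure_circle_subset[OF pull_borel[OF C(1)] pull_subset]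
  show "measure lborel (pull N lam x A) \<le> measure lborel A"
    using emeasure_pull_le[OF N A, of x] by (simp add: em)
  have 1: "measure lborel (pull N lam x (base_circle N - A)) \<le> measure lborel (base_circle N - A)"
    using emeasure_pull_le[OF N C, of x] by (simp add: em)
  have "measure lborel (pull N lam x A) + measure lborel (pull N lam x (base_circle N - A)) = ?p - slit_arc N lam"
    using emeasure_pull_Compl[OF N A, of x] slit_arc_bounds[OF N]
    by (simp add: em flip: ennreal_plus)
  moreover have "measure lborel (base_circle N - A) = ?p - measure lborel A"
    using measure_Diff[of lborel "base_circle N" A] A by (simp add: base_circle_def)
  ultimately show "measure lborel A \<le> measure lborel (pull N lam x A) + slit_arc N lam" using 1 by linarith
qed

lemma base_length_antimono:
  assumes N: "N \<ge> 1" "lam > 0" shows "base_length N lam w (Suc k) \<le> base_length N lam w k"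
  using measure_pull_bounds(1)[OF N base_set_borel base_set_subset] by (simp add: base_length_def)

text \<open>Measurability jointly in the landings and the test point \<open>y\<close>, since
  \<open>base_length\<close> is an integral over \<open>y\<close> of a set that varies with the
  landings. The recursion step composes with the measurable map that moves \<open>y\<close> by the
  last landing.\<close>

lemma pred_base_set:
  "k \<le> n \<Longrightarrow> Measurable.pred (PiM {..<n} (\<lambda>_. borel) \<Otimes>\<^sub>M borel) (\<lambda>(w, y). y \<in> base_set N lam w k)"
proof (induction k)
  case 0
  then show ?case by (simp add: split_beta)
next
  case (Suc k)
  let ?p = "2 * pi * real N"
  have "k \<in> {..<n}" using Suc.prems by simp
  from measurable_compose[OF measurable_fst measurable_component_singleton[OF this]]
  have [measurable]: "(\<lambda>q. fst q k) \<in> borel_measurable (PiM {..<n} (\<lambda>_. borel :: real measure) \<Otimes>\<^sub>M borel)" .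
  have ih: "Measurable.pred (PiM {..<n} (\<lambda>_. borel) \<Otimes>\<^sub>M borel) (\<lambda>q. snd q \<in> base_set N lam (fst q) k)"
    using Suc by (simp add: split_beta)
  let ?l = "\<lambda>q. (fst q k + slit_real N lam ((snd q - fst q k) rmod ?p)) rmod ?p"
  have "(\<lambda>q. (fst q, ?l q)) \<in> PiM {..<n} (\<lambda>_. borel) \<Otimes>\<^sub>M borel \<rightarrow>\<^sub>M PiM {..<n} (\<lambda>_. borel :: real measure) \<Otimes>\<^sub>M borel"
    by measurable
  from measurable_compose[OF this ih]
  have [measurable]: "Measurable.pred (PiM {..<n} (\<lambda>_. borel) \<Otimes>\<^sub>M borel) (\<lambda>q. ?l q \<in> base_set N lam (fst q) k)"
    by simp
  note ih[measurable]
  have "(\<lambda>(w, y). y \<in> base_set N lam w (Suc k)) =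
     (\<lambda>q. if fst q k \<in> base_circle N then snd q \<in> base_circle N \<and> (snd q - fst q k) rmod ?p \<in> surviving N lam \<and>
        ?l q \<in> base_set N lam (fst q) k else snd q \<in> base_set N lam (fst q) k)"
    by (auto simp: pull_def fun_eq_iff)
  moreover have "Measurable.pred (PiM {..<n} (\<lambda>_. borel) \<Otimes>\<^sub>M borel) \<dots>" by measurable
  ultimately show ?case by simp
qed

lemma base_length_measurable:
  assumes "k \<le> n"
  shows "(\<lambda>w. base_length N lam w k) \<in> borel_measurable (PiM {..<n} (\<lambda>_. borel))"
proof -
  have "(\<lambda>w. \<integral>\<^sup>+y. indicator {q. case q of (w, y) \<Rightarrow> y \<in> base_set N lam w k} (w, y) \<partial>lborel) \<in> borel_measurable (PiM {..<n} (\<lambda>_. borel))"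
    using pred_base_set[OF assms, of N lam] by measurable
  moreover have "(\<integral>\<^sup>+y. indicator {q. case q of (w, y) \<Rightarrow> y \<in> base_set N lam w k} (w, y) \<partial>lborel) = emeasure lborel (base_set N lam w k)" for w
    by (simp flip: nn_integral_indicator add: indicator_def)
  ultimately show ?thesis unfolding base_length_def measure_def by simp
qed

lemma pred_birth:
  assumes "k < n"
  shows "Measurable.pred (PiM {..<n} (\<lambda>_. borel)) (\<lambda>w. w k \<in> base_set N lam w k)"
proof -
  have "(\<lambda>w. (w, w k)) \<in> PiM {..<n} (\<lambda>_. borel :: real measure) \<rightarrow>\<^sub>M PiM {..<n} (\<lambda>_. borel) \<Otimes>\<^sub>M borel"
    using assms by (intro measurable_Pair measurable_ident_sets refl measurable_component_singleton) auto
  from measurable_compose[OF this pred_base_set[of k n N lam]] show ?thesis using assms by simp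
qed

text \<open>With \<open>s = l + c0\<close> this is
  \<open>1 / (s - X) \<le> 1 / s + (1 + e) X / s\<^sup>2\<close>, the tangent line with slope
  inflated by \<open>1 + e\<close>. It amounts to \<open>X (1 + e) \<le> s e\<close>, which follows
  from \<open>c0 \<le> s\<close>. The terms are arranged as sums of nonnegative quantities so that
  they can be integrated in \<open>ennreal\<close>.\<close>

lemma inverse_one_step:
  fixes e l X c0 :: real
  assumes "0 < e" "0 \<le> X" "X \<le> l" "0 < c0" "X * (1 + e) \<le> c0 * e"
  shows "1 / (l - X + c0) + (1 + e) / (l + c0)\<^sup>2 * (l - X) \<le> 1 / (l + c0) + (1 + e) / (l + c0)\<^sup>2 * l"
proof -
  define s where "s = l + c0"
  have s: "s > 0" "s - X > 0" "c0 \<le> s" using assms by (auto simp: s_def)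
  have "X * (1 + e) \<le> s * e" using assms(1,5) s(3) by (meson mult_right_mono order_trans less_imp_le)
  then have "0 \<le> X * (s * e - X * (1 + e))" using assms by simp
  then have "s * s \<le> (s - X) * (s + (1 + e) * X)" by (simp add: algebra_simps)
  then have "1 / (s - X) \<le> (s + (1 + e) * X) / (s * s)"
    using s by (simp add: divide_simps mult_ac)
  also have "\<dots> = 1 / s + (1 + e) / s\<^sup>2 * X" using s by (simp add: power2_eq_square field_simps)
  finally have "1 / (s - X) + (1 + e) / s\<^sup>2 * (l - X) \<le> 1 / s + (1 + e) / s\<^sup>2 * l"
    by (simp only: right_diff_distrib)
  moreover have "l - X + c0 = s - X" by (simp add: s_def)
  ultimately show ?thesis by (simp only: s_def)
qed

text \<open>The law of the landing point in a time slot: a rate \<open>\<kappa>\<close> times Lebesgue measure on the circle, and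
  some mass outside the circle for the slots without a unique arrival.\<close>

locale slot_law = prob_space \<nu> for \<nu> :: "real measure" +
  fixes N :: nat and lam \<kappa> :: real
  assumes N: "N \<ge> 1" "lam > 0" and sets_nu [measurable_cong]: "sets \<nu> = sets borel" and kappa: "0 \<le> \<kappa>"
    and nu_circle: "\<And>B. B \<in> sets borel \<Longrightarrow> B \<subseteq> base_circle N \<Longrightarrow> emeasure \<nu> B = ennreal \<kappa> * emeasure lborel B"
begin

lemma nn_integral_nu:
  assumes [measurable]: "f \<in> borel_measurable borel"
  shows "(\<integral>\<^sup>+x\<in>base_circle N. f x \<partial>\<nu>) = ennreal \<kappa> * (\<integral>\<^sup>+x\<in>base_circle N. f x \<partial>lborel)"
proof -
  have "density \<nu> (indicator (base_circle N)) = density lborel (\<lambda>x. ennreal \<kappa> * indicator (base_circle N) x)"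
  proof (rule measure_eqI)
    fix A assume "A \<in> sets (density \<nu> (indicator (base_circle N)))"
    then have A[measurable]: "A \<in> sets borel" by (simp add: sets_nu)
    have "emeasure (density \<nu> (indicator (base_circle N))) A = (\<integral>\<^sup>+x. indicator (base_circle N \<inter> A) x \<partial>\<nu>)"
      by (simp add: emeasure_density sets_nu indicator_inter_arith)
    also have "\<dots> = ennreal \<kappa> * emeasure lborel (base_circle N \<inter> A)"
      using nu_circle[of "base_circle N \<inter> A"] by (simp add: sets_nu)
    also have "\<dots> = emeasure (density lborel (\<lambda>x. ennreal \<kappa> * indicator (base_circle N) x)) A"
      by (simp add: emeasure_density mult.assoc nn_integral_cmult flip: indicator_inter_arith)
    finally show "emeasure (density \<nu> (indicator (base_circle N))) A = emeasure (density lborel (\<lambda>x. ennreal \<kappa> * indicator (base_circle N) x)) A" .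
  qed (simp add: sets_nu)
  then have "(\<integral>\<^sup>+x. f x \<partial>density \<nu> (indicator (base_circle N))) = (\<integral>\<^sup>+x. f x \<partial>density lborel (\<lambda>x. ennreal \<kappa> * indicator (base_circle N) x))" by simp
  then show ?thesis
    by (simp add: nn_integral_density nn_integral_cmult mult_ac)
qed

lemma nu_base_circle: "emeasure \<nu> (base_circle N) = ennreal (\<kappa> * (2 * pi * real N))"
  using nu_circle[of "base_circle N"] kappa by (simp add: base_circle_def ennreal_mult)

text \<open>The pointwise bound is integrated over the landing point. The expected loss of length is
  \<open>\<kappa> a l\<close>, and \<open>b * l \<le> (1 + e) / (l + c0)\<close> turns the additive
  error into a factor.\<close>

lemma one_step:
  assumes A[measurable]: "A \<in> sets borel" "A \<subseteq> base_circle N" and e: "0 < e" "0 < c0" "slit_arc N lam * (1 + e) \<le> c0 * e"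
  shows "(\<integral>\<^sup>+x. ennreal (1 / (measure lborel (if x \<in> base_circle N then pull N lam x A else A) + c0)) \<partial>\<nu>)
     \<le> ennreal (1 / (measure lborel A + c0) * (1 + (1 + e) * \<kappa> * slit_arc N lam))"
proof -
  let ?p = "2 * pi * real N"
  define a where "a = slit_arc N lam"
  define l where "l = measure lborel A"
  define m where "m x = measure lborel (pull N lam x A)" for x
  define b where "b = (1 + e) / (l + c0)\<^sup>2"
  have a: "0 < a" "a < ?p" using slit_arc_bounds[OF N] by (auto simp: a_def)
  have l: "0 \<le> l" by (simp add: l_def)
  have b: "0 \<le> b" using e by (simp add: b_def)
  have m: "0 \<le> m x" "m x \<le> l" "l \<le> m x + a" for x
    using measure_pull_bounds[OF N A] by (auto simp: m_def l_def a_def)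
  have mm[measurable]: "m \<in> borel_measurable borel"
  proof -
    have "(\<lambda>x. \<integral>\<^sup>+y. indicator (pull N lam x A) y \<partial>lborel) \<in> borel_measurable borel"
      unfolding pull_def by measurable
    then show ?thesis unfolding m_def measure_def by simp
  qed
  let ?W = "\<lambda>x. ennreal (1 / (measure lborel (if x \<in> base_circle N then pull N lam x A else A) + c0))"
  have meas[measurable]: "?W \<in> borel_measurable borel"
  proof -
    have "?W = (\<lambda>x. ennreal (1 / ((if x \<in> base_circle N then m x else l) + c0)))" by (auto simp: m_def l_def fun_eq_iff)
    then show ?thesis by simp
  qed
  have pt: "?W x + ennreal (b * m x) * indicator (base_circle N) x \<le> ennreal (1 / (l + c0)) + ennreal (b * l) * indicator (base_circle N) x" for x
  proof (cases "x \<in> base_circle N")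
    case True
    have "(l - m x) * (1 + e) \<le> a * (1 + e)" using m[of x] e by (intro mult_right_mono) auto
    then have q: "(l - m x) * (1 + e) \<le> c0 * e" using e(3) unfolding a_def by linarith
    have "1 / (l - (l - m x) + c0) + b * (l - (l - m x)) \<le> 1 / (l + c0) + b * l"
      unfolding b_def by (rule inverse_one_step) (use q m[of x] e in auto)
    then have "ennreal (1 / (m x + c0) + b * m x) \<le> ennreal (1 / (l + c0) + b * l)" by (intro ennreal_leI) simp
    then show ?thesis using True m[of x] e b l by (simp add: m_def)
  qed (simp add: l_def)
  have "(\<integral>\<^sup>+x. ?W x \<partial>\<nu>) + (\<integral>\<^sup>+x\<in>base_circle N. ennreal (b * m x) \<partial>\<nu>) =
    (\<integral>\<^sup>+x. ?W x + ennreal (b * m x) * indicator (base_circle N) x \<partial>\<nu>)"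
    by (rule nn_integral_add[symmetric]) measurable
  also have "\<dots> \<le> (\<integral>\<^sup>+x. ennreal (1 / (l + c0)) + ennreal (b * l) * indicator (base_circle N) x \<partial>\<nu>)"
    by (rule nn_integral_mono) (rule pt)
  also have "\<dots> = ennreal (1 / (l + c0)) + ennreal (b * l) * ennreal (\<kappa> * ?p)"
    by (subst nn_integral_add) (auto simp: nn_integral_cmult emeasure_space_1 nu_base_circle sets_nu)
  also have "\<dots> = ennreal (1 / (l + c0) + b * l * (\<kappa> * ?p))"
    using b l kappa e by (simp add: ennreal_mult ennreal_plus)
  also have "(\<integral>\<^sup>+x\<in>base_circle N. ennreal (b * m x) \<partial>\<nu>) = ennreal (b * \<kappa> * l * (?p - a))"
  proof -
    have em: "emeasure lborel (pull N lam x A) = ennreal (m x)" for x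
      unfolding m_def by (rule emeasure_circle_subset[OF pull_borel[OF A(1)] pull_subset])
    have "(\<integral>\<^sup>+x\<in>base_circle N. ennreal (b * m x) \<partial>\<nu>) = ennreal \<kappa> * (\<integral>\<^sup>+x\<in>base_circle N. ennreal (b * m x) \<partial>lborel)"
      by (rule nn_integral_nu) measurable
    also have "(\<integral>\<^sup>+x\<in>base_circle N. ennreal (b * m x) \<partial>lborel) = ennreal b * (\<integral>\<^sup>+x\<in>base_circle N. ennreal (m x) \<partial>lborel)"
      using b m by (subst nn_integral_cmult[symmetric]) (auto simp: ennreal_mult mult.assoc)
    also have "(\<integral>\<^sup>+x\<in>base_circle N. ennreal (m x) \<partial>lborel) = ennreal (l * (?p - a))"
      using nn_integral_emeasure_pull[OF N A] l a
      by (simp add: em emeasure_circle_subset[OF A] ennreal_mult flip: l_def a_def)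
    finally show ?thesis using b kappa l a by (simp add: ennreal_mult[symmetric] mult_ac)
  qed
  finally have fin: "(\<integral>\<^sup>+x. ?W x \<partial>\<nu>) + ennreal (b * \<kappa> * l * (?p - a)) \<le> ennreal (1 / (l + c0) + b * l * (\<kappa> * ?p))" .
  have "(\<integral>\<^sup>+x. ?W x \<partial>\<nu>) \<le> ennreal (1 / (l + c0) + b * l * \<kappa> * a)"
  \<comment> \<open>The common term is cancelled in the reals; the value \<open>top\<close> is
    incompatible with \<open>fin\<close>.\<close>
  proof (cases "\<integral>\<^sup>+x. ?W x \<partial>\<nu>")
    case (real r)
    have "0 \<le> b * \<kappa> * l * (?p - a)" using b kappa l a by simp
    then have "ennreal (r + b * \<kappa> * l * (?p - a)) \<le> ennreal (1 / (l + c0) + b * l * (\<kappa> * ?p))"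
      using fin real by simp
    then have "r + b * \<kappa> * l * (?p - a) \<le> 1 / (l + c0) + b * l * (\<kappa> * ?p)"
      using b kappa l e by (subst (asm) ennreal_le_iff) auto
    then show ?thesis unfolding real by (intro ennreal_leI) (simp add: algebra_simps)
  next
    case top
    then show ?thesis using fin by (simp add: top_unique)
  qed
  also have "\<dots> \<le> ennreal (1 / (l + c0) * (1 + (1 + e) * \<kappa> * a))"
  proof (rule ennreal_leI)
    have "b * l \<le> (1 + e) / (l + c0)"
      using e l by (simp add: b_def power2_eq_square divide_simps)
    then have "b * l * (\<kappa> * a) \<le> (1 + e) / (l + c0) * (\<kappa> * a)" using kappa a by (intro mult_right_mono) auto
    then show "1 / (l + c0) + b * l * \<kappa> * a \<le> 1 / (l + c0) * (1 + (1 + e) * \<kappa> * a)"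
      by (simp add: algebra_simps add_divide_distrib)
  qed
  finally show ?thesis by (simp add: l_def a_def)
qed

sublocale product_sigma_finite "\<lambda>_ :: nat. \<nu>"
  by unfold_locales

abbreviation "slots n \<equiv> PiM {..<n :: nat} (\<lambda>_. \<nu>)"

lemma sets_slots [measurable_cong]: "sets (slots n) = sets (PiM {..<n} (\<lambda>_. borel))"
  by (intro sets_PiM_cong refl sets_nu)

lemma prob_space_slots: "prob_space (slots n)"
  by (intro prob_space_PiM) unfold_locales

lemma nn_integral_slots_Suc:
  assumes "f \<in> borel_measurable (slots (Suc n))"
  shows "(\<integral>\<^sup>+w. f w \<partial>slots (Suc n)) = (\<integral>\<^sup>+w. (\<integral>\<^sup>+y. f (w(n := y)) \<partial>\<nu>) \<partial>slots n)"
proof -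
  have i: "{..<Suc n} = insert n {..<n}" by auto
  show ?thesis using assms unfolding i by (intro product_nn_integral_insert) auto
qed

lemma base_length_slots [measurable]: "k \<le> n \<Longrightarrow> (\<lambda>w. base_length N lam w k) \<in> borel_measurable (slots n)"
  using base_length_measurable[of k n N lam] by measurable

lemma pred_birth_slots [measurable]: "k < n \<Longrightarrow> Measurable.pred (slots n) (\<lambda>w. w k \<in> base_set N lam w k)"
  using pred_birth[of k n N lam] by measurable

lemma base_set_upd: "base_set N lam (w(n := y)) n = base_set N lam w n"
  by (rule base_set_cong) auto

lemma base_length_upd:
  "base_length N lam (w(n := y)) (Suc n) =
     measure lborel (if y \<in> base_circle N then pull N lam y (base_set N lam w n) else base_set N lam w n)"
  by (simp add: base_length_def base_set_upd)

text \<open>A discrete Gronwall argument: the last landing is integrated out with the earlier ones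
  frozen, which costs a factor \<open>1 + (1 + e) \<kappa> a\<close>, at most its exponential. The
  initial length is the whole circle.\<close>

lemma expected_inverse_length:
  assumes e: "0 < e" "0 < c0" "slit_arc N lam * (1 + e) \<le> c0 * e"
  shows "(\<integral>\<^sup>+w. ennreal (1 / (base_length N lam w n + c0)) \<partial>slots n)
     \<le> ennreal (1 / (2 * pi * real N + c0) * exp ((1 + e) * \<kappa> * slit_arc N lam * n))"
proof (induction n)
  case 0
  interpret P: prob_space "slots 0" by (rule prob_space_slots)
  have "emeasure (PiM ({} :: nat set) (\<lambda>_. \<nu>)) (space (PiM {} (\<lambda>_. \<nu>))) = 1" using P.emeasure_space_1 by simp
  then show ?case by (simp add: base_length_def base_circle_def)
next
  case (Suc n)
  let ?g = "(1 + e) * \<kappa> * slit_arc N lam"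
  have g: "0 \<le> ?g" using e kappa slit_arc_bounds[OF N] by simp
  have "(\<integral>\<^sup>+w. ennreal (1 / (base_length N lam w (Suc n) + c0)) \<partial>slots (Suc n)) =
    (\<integral>\<^sup>+w. (\<integral>\<^sup>+y. ennreal (1 / (base_length N lam (w(n := y)) (Suc n) + c0)) \<partial>\<nu>) \<partial>slots n)"
    by (rule nn_integral_slots_Suc) measurable
  also have "\<dots> \<le> (\<integral>\<^sup>+w. ennreal (1 / (base_length N lam w n + c0)) * ennreal (1 + ?g) \<partial>slots n)"
  proof (rule nn_integral_mono)
    fix w
    have "(\<integral>\<^sup>+y. ennreal (1 / (base_length N lam (w(n := y)) (Suc n) + c0)) \<partial>\<nu>) \<le> ennreal (1 / (base_length N lam w n + c0) * (1 + ?g))"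
      using one_step[OF base_set_borel base_set_subset e, of lam w n] unfolding base_length_upd by (simp add: base_length_def)
    also have "ennreal (1 / (base_length N lam w n + c0) * (1 + ?g)) = ennreal (1 / (base_length N lam w n + c0)) * ennreal (1 + ?g)"
      using g e by (intro ennreal_mult) (auto simp: base_length_def)
    finally show "(\<integral>\<^sup>+y. ennreal (1 / (base_length N lam (w(n := y)) (Suc n) + c0)) \<partial>\<nu>) \<le> ennreal (1 / (base_length N lam w n + c0)) * ennreal (1 + ?g)" .
  qed
  also have "\<dots> = (\<integral>\<^sup>+w. ennreal (1 / (base_length N lam w n + c0)) \<partial>slots n) * ennreal (1 + ?g)"
    by (rule nn_integral_multc) measurable
  also have "\<dots> \<le> ennreal (1 / (2 * pi * real N + c0) * exp (?g * n)) * ennreal (exp ?g)"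
    by (intro mult_mono Suc ennreal_leI exp_ge_add_one_self) auto
  also have "\<dots> = ennreal (1 / (2 * pi * real N + c0) * exp (?g * Suc n))"
    using e by (simp add: ennreal_mult[symmetric] exp_add algebra_simps)
  finally show ?case .
qed

text \<open>Lengths only decrease, so a final length of at least \<open>K\<close> means that the
  base set had length at least \<open>K\<close> at every slot before. Each slot then misses it with
  probability at most \<open>1 - \<kappa> K \<le> exp (- \<kappa> K)\<close>. Imposing the condition
  at the last index only makes the induction close.\<close>

lemma no_birth_long_base:
  assumes K: "0 \<le> K" and j: "n1 \<le> j"
  shows "emeasure (slots j) {w \<in> space (slots j). (\<forall>i\<in>{n1..<j}. w i \<notin> base_set N lam w i) \<and> K \<le> base_length N lam w j}
     \<le> ennreal (exp (- \<kappa> * K * (j - n1)))"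
  using j
proof (induction j rule: dec_induct)
  case base
  interpret P: prob_space "slots n1" by (rule prob_space_slots)
  show ?case by (simp add: P.emeasure_le_1)
next
  case (step n)
  define G where "G j = {w \<in> space (slots j). (\<forall>i\<in>{n1..<j}. w i \<notin> base_set N lam w i) \<and> K \<le> base_length N lam w j}" for j
  have [measurable]: "G j \<in> sets (slots j)" for j unfolding G_def by measurable
  have "emeasure (slots (Suc n)) (G (Suc n)) = (\<integral>\<^sup>+w. (\<integral>\<^sup>+y. indicator (G (Suc n)) (w(n := y)) \<partial>\<nu>) \<partial>slots n)"
    by (simp flip: nn_integral_indicator add: nn_integral_slots_Suc)
  also have "\<dots> \<le> (\<integral>\<^sup>+w. indicator (G n) w * ennreal (exp (- \<kappa> * K)) \<partial>slots n)"
  proof (rule nn_integral_mono)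
    fix w assume w: "w \<in> space (slots n)"
    let ?B = "base_set N lam w n"
    have in1: "indicator (G (Suc n)) (w(n := y)) \<le> (indicator (G n) w * indicator (UNIV - ?B) y :: ennreal)" for y
    proof (cases "w(n := y) \<in> G (Suc n)")
      case True
      have nb: "(w(n := y)) i \<notin> base_set N lam (w(n := y)) i" if "i \<in> {n1..n}" for i
        using True that by (auto simp: G_def)
      have "w i \<notin> base_set N lam w i" if "i \<in> {n1..<n}" for i
      proof -
        have "base_set N lam (w(n := y)) i = base_set N lam w i" by (rule base_set_cong) (use that in auto)
        then show ?thesis using nb[of i] that by auto
      qed
      moreover have "y \<notin> ?B" using nb[of n] step by (auto simp: base_set_upd)
      moreover have "K \<le> base_length N lam w n"
        using True base_length_antimono[OF N, of "w(n := y)" n] by (auto simp: G_def base_length_def base_set_upd simp del: base_set.simps)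
      ultimately have "w \<in> G n" "y \<notin> ?B" using w by (auto simp: G_def)
      then show ?thesis using True by simp
    qed simp
    have "(\<integral>\<^sup>+y. indicator (G (Suc n)) (w(n := y)) \<partial>\<nu>) \<le> (\<integral>\<^sup>+y. indicator (G n) w * indicator (UNIV - ?B) y \<partial>\<nu>)"
      by (intro nn_integral_mono in1)
    also have "\<dots> = indicator (G n) w * emeasure \<nu> (space \<nu> - ?B)"
    proof -
      have "space \<nu> = UNIV" using sets_eq_imp_space_eq[OF sets_nu] by simp
      then show ?thesis by (simp add: nn_integral_cmult sets_nu)
    qed
    also have "\<dots> \<le> indicator (G n) w * ennreal (exp (- \<kappa> * K))"
    proof (cases "w \<in> G n")
      case True
      have B: "emeasure \<nu> ?B = ennreal (\<kappa> * base_length N lam w n)"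
        using nu_circle[OF base_set_borel base_set_subset] emeasure_circle_subset[OF base_set_borel base_set_subset] kappa
        by (simp add: base_length_def ennreal_mult)
      have "0 \<le> \<kappa> * base_length N lam w n" using kappa by (simp add: base_length_def)
      then have mB: "measure \<nu> ?B = \<kappa> * base_length N lam w n" using B by (simp add: measure_def)
      have "emeasure \<nu> (space \<nu> - ?B) = ennreal (1 - \<kappa> * base_length N lam w n)"
        using prob_compl[of ?B] by (simp add: sets_nu emeasure_eq_measure mB)
      also have "\<dots> \<le> ennreal (exp (- \<kappa> * K))"
      proof (rule ennreal_leI)
        have "\<kappa> * K \<le> \<kappa> * base_length N lam w n" using True kappa by (intro mult_left_mono) (auto simp: G_def)
        then show "1 - \<kappa> * base_length N lam w n \<le> exp (- \<kappa> * K)"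
          using exp_ge_add_one_self[of "- \<kappa> * K"] by simp
      qed
      finally show ?thesis using True by simp
    qed simp
    finally show "(\<integral>\<^sup>+y. indicator (G (Suc n)) (w(n := y)) \<partial>\<nu>) \<le> indicator (G n) w * ennreal (exp (- \<kappa> * K))" .
  qed
  also have "\<dots> = emeasure (slots n) (G n) * ennreal (exp (- \<kappa> * K))" by (simp add: nn_integral_multc)
  also have "\<dots> \<le> ennreal (exp (- \<kappa> * K * (n - n1))) * ennreal (exp (- \<kappa> * K))"
    using step.IH by (intro mult_right_mono) (auto simp: G_def)
  also have "\<dots> = ennreal (exp (- \<kappa> * K * (Suc n - n1)))"
    using step.hyps by (simp add: ennreal_mult[symmetric] exp_add[symmetric] Suc_diff_le algebra_simps)
  finally show ?case by (simp add: G_def)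
qed

text \<open>Either the final length is below \<open>K\<close>, which makes
  \<open>1 / (L + c0)\<close> exceed \<open>1 / (K + c0)\<close> and falls to Markov's inequality,
  or it is at least \<open>K\<close> and every slot of the window was missed.\<close>

lemma no_birth_bound:
  assumes K: "0 \<le> K" and n: "n1 \<le> n2" and e: "0 < e" "0 < c0" "slit_arc N lam * (1 + e) \<le> c0 * e"
  shows "emeasure (slots n2) {w \<in> space (slots n2). \<forall>i\<in>{n1..<n2}. w i \<notin> base_set N lam w i}
     \<le> ennreal ((K + c0) / (2 * pi * real N + c0) * exp ((1 + e) * \<kappa> * slit_arc N lam * n2) + exp (- \<kappa> * K * (n2 - n1)))"
proof -
  let ?A = "{w \<in> space (slots n2). 1 \<le> ennreal (K + c0) * ennreal (1 / (base_length N lam w n2 + c0))}"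
  let ?B = "{w \<in> space (slots n2). (\<forall>i\<in>{n1..<n2}. w i \<notin> base_set N lam w i) \<and> K \<le> base_length N lam w n2}"
  have [measurable]: "?A \<in> sets (slots n2)" "?B \<in> sets (slots n2)" by measurable
  have "{w \<in> space (slots n2). \<forall>i\<in>{n1..<n2}. w i \<notin> base_set N lam w i} \<subseteq> ?A \<union> ?B"
  proof
    fix w assume w: "w \<in> {w \<in> space (slots n2). \<forall>i\<in>{n1..<n2}. w i \<notin> base_set N lam w i}"
    show "w \<in> ?A \<union> ?B"
    proof (cases "K \<le> base_length N lam w n2")
      case False
      have l: "0 \<le> base_length N lam w n2" by (simp add: base_length_def)
      have "1 \<le> (K + c0) * (1 / (base_length N lam w n2 + c0))" using False e l by (simp add: divide_simps)
      then have "1 \<le> ennreal ((K + c0) * (1 / (base_length N lam w n2 + c0)))" by simp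
      then have "1 \<le> ennreal (K + c0) * ennreal (1 / (base_length N lam w n2 + c0))"
        using K e l by (subst ennreal_mult[symmetric]) auto
      then show ?thesis using w by blast
    qed (use w in simp)
  qed
  then have "emeasure (slots n2) {w \<in> space (slots n2). \<forall>i\<in>{n1..<n2}. w i \<notin> base_set N lam w i} \<le> emeasure (slots n2) ?A + emeasure (slots n2) ?B"
    by (intro order_trans[OF emeasure_mono emeasure_subadditive]) auto
  also have "\<dots> \<le> ennreal (K + c0) * ennreal (1 / (2 * pi * real N + c0) * exp ((1 + e) * \<kappa> * slit_arc N lam * n2)) + ennreal (exp (- \<kappa> * K * (n2 - n1)))"
  proof (rule add_mono)
    have "emeasure (slots n2) ({w \<in> space (slots n2). 1 \<le> ennreal (K + c0) * ennreal (1 / (base_length N lam w n2 + c0))}) \<le>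
      ennreal (K + c0) * (\<integral>\<^sup>+w\<in>space (slots n2). ennreal (1 / (base_length N lam w n2 + c0)) \<partial>slots n2)"
      using nn_integral_Markov_inequality[of "\<lambda>w. ennreal (1 / (base_length N lam w n2 + c0))" "space (slots n2)" "slots n2" "ennreal (K + c0)"]
      by simp
    also have "(\<integral>\<^sup>+w\<in>space (slots n2). ennreal (1 / (base_length N lam w n2 + c0)) \<partial>slots n2) = (\<integral>\<^sup>+w. ennreal (1 / (base_length N lam w n2 + c0)) \<partial>slots n2)"
      by (intro nn_integral_cong) simp
    also have "ennreal (K + c0) * \<dots> \<le> ennreal (K + c0) * ennreal (1 / (2 * pi * real N + c0) * exp ((1 + e) * \<kappa> * slit_arc N lam * n2))"
      by (intro mult_left_mono expected_inverse_length e) simp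
    finally show "emeasure (slots n2) ?A \<le> \<dots>" .
    show "emeasure (slots n2) ?B \<le> ennreal (exp (- \<kappa> * K * (n2 - n1)))" by (rule no_birth_long_base[OF K n])
  qed
  also have "\<dots> = ennreal ((K + c0) / (2 * pi * real N + c0) * exp ((1 + e) * \<kappa> * slit_arc N lam * n2) + exp (- \<kappa> * K * (n2 - n1)))"
    using K e by (simp add: ennreal_mult[symmetric] flip: ennreal_plus)
  finally show ?thesis .
qed

end

section \<open>Arrivals in time slots\<close>

lemma (in linorder) sorted_key_list_of_set_strict:
  assumes "sorted_wrt (<) (map f l)"
  shows "sorted_key_list_of_set f (set l) = l"
proof -
  have s: "sorted (map f l)" "distinct (map f l)" using assms by (simp_all add: strict_sorted_iff)
  then have "inj_on f (set l)" "distinct l" by (simp_all add: distinct_map)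
  then interpret folding_insort_key "(\<le>)" "(<)" "set l" f by unfold_locales
  show ?thesis by (rule idem_if_sorted_distinct) (use s \<open>distinct l\<close> in auto)
qed

definition time_slot :: "real \<Rightarrow> nat \<Rightarrow> real set" where
  "time_slot h i = {real i * h..<real (Suc i) * h}"

definition slot_points :: "nat \<Rightarrow> real \<Rightarrow> (real \<times> real) set \<Rightarrow> nat \<Rightarrow> (real \<times> real) set" where
  "slot_points N h A i = A \<inter> time_slot h i \<times> base_circle N"

text \<open>The codes \<open>- 1\<close> for an empty slot and \<open>- 2\<close> for a slot with several arrivals lie outside the circle.\<close>

definition slot_value :: "nat \<Rightarrow> real \<Rightarrow> (real \<times> real) set \<Rightarrow> nat \<Rightarrow> real" where
  "slot_value N h A i =
     (if slot_points N h A i = {} then - 1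
      else if is_singleton (slot_points N h A i) then snd (the_elem (slot_points N h A i)) else - 2)"

lemma not_in_base_circle [simp]: "- 1 \<notin> base_circle N" "- 2 \<notin> base_circle N"
  by (auto simp: base_circle_def)

lemma slot_points_circle: "q \<in> slot_points N h A i \<Longrightarrow> snd q \<in> base_circle N"
  by (auto simp: slot_points_def)

lemma slot_value_cases:
  assumes "slot_value N h A i \<noteq> - 2"
  obtains "slot_points N h A i = {}" "slot_value N h A i \<notin> base_circle N"
  | q where "slot_points N h A i = {q}" "slot_value N h A i = snd q" "snd q \<in> base_circle N"
proof (cases "slot_points N h A i = {}")
  case True
  then show ?thesis using that(1) by (simp add: slot_value_def)
next
  case False
  then have "is_singleton (slot_points N h A i)" using assms by (auto simp: slot_value_def split: if_splits)
  then obtain q where q: "slot_points N h A i = {q}" by (auto simp: is_singleton_def)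
  then show ?thesis using that(2)[OF q] slot_points_circle[of q N h A i] by (simp add: slot_value_def is_singleton_def)
qed

definition landings :: "nat \<Rightarrow> (nat \<Rightarrow> real) \<Rightarrow> nat \<Rightarrow> real list" where
  "landings N w k = map w (filter (\<lambda>i. w i \<in> base_circle N) [0..<k])"

lemma landings_0 [simp]: "landings N w 0 = []"
  by (simp add: landings_def)

lemma landings_Suc: "landings N w (Suc k) = landings N w k @ (if w k \<in> base_circle N then [w k] else [])"
  by (simp add: landings_def)

lemma slit_map_at_of_real:
  assumes N: "N \<ge> 1" "lam > 0" and y: "y \<in> base_circle N" "(y - x) rmod (2 * pi * real N) \<in> surviving N lam"
  shows "slit_map_at N lam x (of_real y) =
    of_real ((x + slit_real N lam ((y - x) rmod (2 * pi * real N))) rmod (2 * pi * real N))"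
proof -
  let ?p = "2 * pi * real N"
  define v where "v = (y - x) rmod ?p"
  have v: "v \<in> base_circle N" using rmod_2pi_less[OF N(1)] rmod_2pi_nonneg[OF N(1)] by (simp add: v_def base_circle_def)
  have c: "\<bar>cos (v / (2 * real N))\<bar> \<le> slit_cos N lam" using surviving_iff[OF N v] y by (simp add: v_def)
  have "of_real y \<in> cyl_points N" using y by (simp add: cyl_points_def base_circle_def)
  then have "slit_map_at N lam x (of_real y) = rot N x (slit_ext N lam (rot N (- x) (of_real y)))"
    by (rule slit_map_at_eq[OF N])
  also have "rot N (- x) (of_real y) = of_real v" by (simp add: rot_def cyl_proj_def v_def complex_eq_iff)
  also have "slit_ext N lam (of_real v) = of_real (slit_real N lam v rmod ?p)"
    unfolding slit_real_def by (rule slit_ext_boundary_real[OF N _ _ c]) (use v in \<open>auto simp: base_circle_def\<close>)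
  also have "rot N x (of_real (slit_real N lam v rmod ?p)) = of_real ((slit_real N lam v rmod ?p + x) rmod ?p)"
    by (simp add: rot_def cyl_proj_def complex_eq_iff)
  also have "(slit_real N lam v rmod ?p + x) rmod ?p = (x + slit_real N lam v) rmod ?p"
    using rmod_add[of "slit_real N lam v rmod ?p" ?p x] rmod_add[of "slit_real N lam v" ?p x] by (simp add: add.commute)
  finally show ?thesis by (simp add: v_def)
qed

text \<open>Links the recursion for \<open>base_set\<close> to the conformal maps: the last landing
  is composed innermost, and \<open>pull\<close> takes the preimage under exactly that map.\<close>

lemma agg_base_set:
  assumes N: "N \<ge> 1" "lam > 0"
  shows "y \<in> base_set N lam w k \<Longrightarrow> agg N lam (landings N w k) (of_real y) \<in> cyl_boundary N"
proof (induction k arbitrary: y)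
  case 0
  then show ?case by (simp add: cyl_boundary_def)
next
  case (Suc k)
  show ?case
  proof (cases "w k \<in> base_circle N")
    case False
    then show ?thesis using Suc by (simp add: landings_Suc)
  next
    case True
    then have y: "y \<in> base_circle N" "(y - w k) rmod (2 * pi * real N) \<in> surviving N lam"
      "(w k + slit_real N lam ((y - w k) rmod (2 * pi * real N))) rmod (2 * pi * real N) \<in> base_set N lam w k"
      using Suc.prems by (auto simp: pull_def)
    show ?thesis using Suc.IH[OF y(3)] True slit_map_at_of_real[OF N y(1,2)]
      by (simp add: landings_Suc agg_snoc)
  qed
qed

lemma slot_points_union:
  assumes h: "h > 0" and A: "A \<subseteq> {0..} \<times> base_circle N"
  shows "{q \<in> A. fst q < real (Suc k) * h} = {q \<in> A. fst q < real k * h} \<union> slot_points N h A k"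
proof -
  have "real k * h \<le> real (Suc k) * h" using h by (simp add: mult_right_mono)
  then show ?thesis using A by (force simp: slot_points_def time_slot_def)
qed

text \<open>Slots follow each other in time, so with at most one arrival per slot the order of slots
  is the chronological order and empty slots simply drop out.\<close>

lemma arrivals_before_slot:
  assumes h: "h > 0" and A: "A \<subseteq> {0..} \<times> base_circle N" and good: "\<And>i. i < k \<Longrightarrow> slot_value N h A i \<noteq> - 2"
  shows "\<exists>l. set l = {q \<in> A. fst q < real k * h} \<and> sorted_wrt (<) (map fst l) \<and>
    map snd l = landings N (slot_value N h A) k"
  using good
proof (induction k)
  case 0
  have "{q \<in> A. fst q < real 0 * h} = {}" using A by fastforce
  then show ?case by (intro exI[of _ "[]"]) simp
next
  case (Suc k)
  then obtain l where l: "set l = {q \<in> A. fst q < real k * h}" "sorted_wrt (<) (map fst l)"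
    "map snd l = landings N (slot_value N h A) k" by force
  have "slot_value N h A k \<noteq> - 2" using Suc.prems by simp
  then show ?case
  proof (cases rule: slot_value_cases)
    case 1
    then show ?thesis using l slot_points_union[OF h A, of k] by (intro exI[of _ l]) (simp add: landings_Suc)
  next
    case (2 q)
    have "q \<in> slot_points N h A k" using 2(1) by simp
    then have "real k * h \<le> fst q" by (auto simp: slot_points_def time_slot_def)
    then have "\<forall>x\<in>set l. fst x < fst q" using l(1) by auto
    then show ?thesis using l 2 slot_points_union[OF h A, of k]
      by (intro exI[of _ "l @ [q]"]) (auto simp: landings_Suc sorted_wrt_append)
  qed
qed

text \<open>Only finitely many arrivals precede the one in slot \<open>k\<close>, so just before it
  the aggregate is built from all earlier landings, and \<open>tree_birth\<close> applies at its
  arrival time.\<close>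

lemma tree_birth_in_slot:
  assumes N: "N \<ge> 1" "lam > 0" and h: "h > 0" and A: "A \<subseteq> {0..} \<times> base_circle N"
    and good: "\<And>i. i \<le> k \<Longrightarrow> slot_value N h A i \<noteq> - 2" and k: "k \<ge> 1"
    and birth: "slot_value N h A k \<in> base_set N lam (slot_value N h A) k"
  shows "ennreal (real k * h) \<le> tree_completion_time N lam A"
proof -
  let ?w = "slot_value N h A"
  obtain l where l: "set l = {q \<in> A. fst q < real k * h}" "sorted_wrt (<) (map fst l)"
    "map snd l = landings N ?w k" using arrivals_before_slot[OF h A, of k] good by force
  have wc: "?w k \<in> base_circle N" using birth base_set_subset by blast
  have "?w k \<noteq> - 2" using good by simp
  then obtain q where q: "slot_points N h A k = {q}" "?w k = snd q" "snd q \<in> base_circle N"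
    using wc by (cases rule: slot_value_cases) auto
  have "q \<in> slot_points N h A k" using q(1) by simp
  then have qA: "q \<in> A" "real k * h \<le> fst q" "fst q < real (Suc k) * h"
    by (auto simp: slot_points_def time_slot_def)
  have lt: "\<forall>x\<in>set l. fst x < fst q" using l(1) qA by auto
  have un: "{x \<in> A. fst x < real (Suc k) * h} = insert q (set l)"
    using slot_points_union[OF h A, of k] q(1) l(1) by auto
  have set1: "{x \<in> A. fst x \<le> fst q} = set (l @ [q])"
  proof -
    have "{x \<in> A. fst x \<le> fst q} \<subseteq> {x \<in> A. fst x < real (Suc k) * h}" using qA by auto
    then show ?thesis using un lt qA l(1) by fastforce
  qed
  have a1: "arrivals_upto A (fst q) = l @ [q]"
    unfolding arrivals_upto_def set1 by (rule sorted_key_list_of_set_strict) (use l lt in \<open>auto simp: sorted_wrt_append\<close>)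
  have ev: "\<forall>\<^sub>F s in at_left (fst q). num_trees N lam A s < num_trees N lam A (fst q)"
  proof -
    have "\<forall>\<^sub>F s in at_left (fst q). \<forall>x\<in>set l. fst x < s"
      using lt by (intro eventually_ball_finite) (auto intro: eventually_at_left_field[THEN iffD2])
    moreover have "\<forall>\<^sub>F s in at_left (fst q). s < fst q" by (simp add: eventually_at_filter)
    ultimately show ?thesis
    proof eventually_elim
      case (elim s)
      have "{x \<in> A. fst x \<le> s} = set l"
      proof
        show "{x \<in> A. fst x \<le> s} \<subseteq> set l"
        proof
          fix x assume x: "x \<in> {x \<in> A. fst x \<le> s}"
          then have "x \<in> insert q (set l)" using un elim qA by auto
          then show "x \<in> set l" using x elim by auto
        qed
        show "set l \<subseteq> {x \<in> A. fst x \<le> s}" using l(1) elim by force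
      qed
      then have a0: "arrivals_upto A s = l"
        unfolding arrivals_upto_def using sorted_key_list_of_set_strict[OF l(2)] by simp
      have "cyl_proj N (of_real (?w k)) = of_real (?w k)"
        using wc by (intro cyl_proj_id) (simp add: cyl_points_def)
      then have "agg N lam (landings N ?w k) (cyl_proj N (of_real (snd q))) \<in> cyl_boundary N"
        using agg_base_set[OF N birth] q(2) by simp
      from tree_birth[OF N this] show ?case
        by (simp add: num_trees_eq a0 a1 l(3))
    qed
  qed
  \<comment> \<open>Birth times are positive by definition; \<open>k \<ge> 1\<close> rules out an
    arrival at time \<open>0\<close>.\<close>
  have "0 < real k * h" using k h by simp
  then have "fst q \<in> tree_birth_times N lam A" using ev qA by (simp add: tree_birth_times_def)
  then have "ennreal (fst q) \<le> tree_completion_time N lam A"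
    unfolding tree_completion_time_def by (rule SUP_upper)
  moreover have "ennreal (real k * h) \<le> ennreal (fst q)" using qA by (intro ennreal_leI)
  ultimately show ?thesis by (rule order_trans[rotated])
qed

lemma emeasure_count_space_eq_one_iff: "emeasure (count_space UNIV) X = 1 \<longleftrightarrow> is_singleton X"
proof (cases "finite X")
  case True
  then have "emeasure (count_space UNIV) X = of_nat (card X)" by simp
  also have "\<dots> = 1 \<longleftrightarrow> card X = 1" using of_nat_eq_iff[of "card X" 1, where 'a=ennreal] by simp
  finally show ?thesis by (simp add: is_singleton_altdef)
next
  case False
  then show ?thesis by (auto simp: is_singleton_def)
qed

lemma emeasure_count_space_eq_zero_iff: "emeasure (count_space UNIV) X = 0 \<longleftrightarrow> X = {}"
  using emeasure_count_space_eq_0[of UNIV X] by auto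

section \<open>Law and independence of the slot values of a Poisson process\<close>

locale arrivals_process =
  fixes M :: "'w measure" and N :: nat and P :: "'w \<Rightarrow> (real \<times> real) set" and lam h :: real
  assumes N: "N \<ge> 1" "lam > 0" and ppp: "poisson_point_process M (arrival_intensity N) P" and h: "0 < h"
begin

sublocale prob_space M
  using ppp by (simp add: poisson_point_process_def)

abbreviation "perimeter \<equiv> 2 * pi * real N"

definition cnt :: "nat \<Rightarrow> real set \<Rightarrow> 'w \<Rightarrow> ennreal" where
  "cnt i B w = emeasure (count_space UNIV) (P w \<inter> (time_slot h i \<times> B))"

lemma slot_box:
  assumes "B \<in> sets borel" "B \<subseteq> base_circle N"
  shows "time_slot h i \<times> B \<in> sets (arrival_intensity N)"
    and "emeasure (arrival_intensity N) (time_slot h i \<times> B) = ennreal (h * measure lborel B)"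
proof -
  have t: "time_slot h i \<in> sets borel" by (simp add: time_slot_def)
  have sub: "time_slot h i \<times> B \<subseteq> {0..} \<times> base_circle N"
  proof -
    have "0 \<le> real i * h" using h by simp
    then show ?thesis using assms(2) by (auto simp: time_slot_def)
  qed
  have pr: "X \<times> Y \<in> sets (lborel :: (real \<times> real) measure)" if "X \<in> sets borel" "Y \<in> sets borel" for X Y :: "real set"
    using that by (simp flip: lborel_prod)
  have O: "({0..} \<times> base_circle N) \<inter> space lborel \<in> sets (lborel :: (real \<times> real) measure)"
    using pr[of "{0..}" "base_circle N"] by simp
  show "time_slot h i \<times> B \<in> sets (arrival_intensity N)"
    unfolding arrival_intensity_def sets_restrict_space_iff[OF O] using sub pr[OF t assms(1)] by simp
  have "emeasure (arrival_intensity N) (time_slot h i \<times> B) = emeasure lborel (time_slot h i \<times> B)"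
    unfolding arrival_intensity_def by (rule emeasure_restrict_space[OF O sub])
  also have "\<dots> = emeasure lborel (time_slot h i) * emeasure lborel B"
    using t assms(1) by (simp add: lborel.emeasure_pair_measure_Times flip: lborel_prod)
  also have "emeasure lborel (time_slot h i) = ennreal h"
    using h by (simp add: time_slot_def algebra_simps)
  finally show "emeasure (arrival_intensity N) (time_slot h i \<times> B) = ennreal (h * measure lborel B)"
    using h by (simp add: emeasure_circle_subset[OF assms] ennreal_mult)
qed

lemma cnt_measurable:
  assumes "B \<in> sets borel" "B \<subseteq> base_circle N"
  shows "cnt i B \<in> borel_measurable M"
  using ppp slot_box(1)[OF assms] by (auto simp: poisson_point_process_def cnt_def[abs_def])

lemma cnt_prob:
  assumes "B \<in> sets borel" "B \<subseteq> base_circle N"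
  shows "prob {w \<in> space M. cnt i B w = of_nat k} = (h * measure lborel B) ^ k / fact k * exp (- (h * measure lborel B))"
proof -
  have "measure (arrival_intensity N) (time_slot h i \<times> B) = h * measure lborel B"
    using slot_box(2)[OF assms] h by (simp add: measure_def)
  moreover have "emeasure (arrival_intensity N) (time_slot h i \<times> B) < \<infinity>"
    using slot_box(2)[OF assms] by simp
  moreover have "\<forall>A\<in>sets (arrival_intensity N). emeasure (arrival_intensity N) A < \<infinity> \<longrightarrow>
      (\<forall>k::nat. prob {w \<in> space M. emeasure (count_space UNIV) (P w \<inter> A) = of_nat k} =
         measure (arrival_intensity N) A ^ k / fact k * exp (- measure (arrival_intensity N) A))"
    using ppp unfolding poisson_point_process_def by blast
  ultimately show ?thesis
    using slot_box(1)[OF assms, of i] by (simp add: cnt_def)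
qed

definition slot_coord :: "nat \<Rightarrow> 'w \<Rightarrow> real" where
  "slot_coord i w = slot_value N h (P w) i"

text \<open>Here \<open>c\<close> and \<open>d\<close> are the numbers of arrivals in a slot with
  position in \<open>B\<close> and outside \<open>B\<close>. The process is accessible through
  counts only, so measurability and independence of positions are read off these two
  numbers.\<close>

definition slot_event :: "real set \<Rightarrow> ennreal \<Rightarrow> ennreal \<Rightarrow> bool" where
  "slot_event B c d \<longleftrightarrow> (c = 1 \<and> d = 0) \<or> (- 1 \<in> B \<and> c = 0 \<and> d = 0) \<or> (- 2 \<in> B \<and> c + d \<noteq> 0 \<and> c + d \<noteq> 1)"

lemma slot_coord_in_iff:
  "slot_coord i w \<in> B \<longleftrightarrow> slot_event B (cnt i (base_circle N \<inter> B) w) (cnt i (base_circle N - B) w)"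
proof -
  define X where "X = slot_points N h (P w) i"
  define X1 where "X1 = P w \<inter> (time_slot h i \<times> (base_circle N \<inter> B))"
  define X2 where "X2 = P w \<inter> (time_slot h i \<times> (base_circle N - B))"
  have X: "X = X1 \<union> X2" "X1 \<inter> X2 = {}" by (auto simp: X_def X1_def X2_def slot_points_def)
  have "emeasure (count_space UNIV) X1 + emeasure (count_space UNIV) X2 = emeasure (count_space UNIV) X"
    unfolding X(1) by (rule plus_emeasure) (use X in auto)
  then have tot: "cnt i (base_circle N \<inter> B) w + cnt i (base_circle N - B) w = emeasure (count_space UNIV) X"
    by (simp add: cnt_def X1_def X2_def)
  have c1: "cnt i (base_circle N \<inter> B) w = emeasure (count_space UNIV) X1"
    and c2: "cnt i (base_circle N - B) w = emeasure (count_space UNIV) X2"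
    by (simp_all add: cnt_def X1_def X2_def)
  consider "X = {}" | q where "X = {q}" | "X \<noteq> {}" "\<not> is_singleton X" by (auto simp: is_singleton_def)
  then show ?thesis
  proof cases
    case 1
    then have "X1 = {}" "X2 = {}" using X by auto
    then show ?thesis using 1 by (simp add: slot_event_def c1 c2 slot_coord_def slot_value_def X_def)
  next
    case (2 q)
    then have v: "slot_coord i w = snd q" by (simp add: slot_coord_def slot_value_def X_def is_singleton_def)
    have s: "emeasure (count_space UNIV) X = 1" using 2 by (simp add: emeasure_count_space_eq_one_iff is_singleton_def)
    have qX: "q \<in> X" using 2 by simp
    show ?thesis
    proof (cases "snd q \<in> B")
      case True
      then have "q \<notin> X2" by (auto simp: X2_def)
      then have "X2 = {}" "X1 = {q}" using X 2 by auto
      then show ?thesis using True v tot s by (simp add: slot_event_def c1 c2)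
    next
      case False
      then have "q \<notin> X1" by (auto simp: X1_def)
      then have "X1 = {}" "X2 = {q}" using X 2 by auto
      then show ?thesis using False v tot s by (simp add: slot_event_def c1 c2)
    qed
  next
    case 3
    have "slot_coord i w = - 2" using 3 by (simp add: slot_coord_def slot_value_def X_def)
    moreover have n: "emeasure (count_space UNIV) X \<noteq> 0" "emeasure (count_space UNIV) X \<noteq> 1"
      using 3 by (simp_all add: emeasure_count_space_eq_one_iff emeasure_count_space_eq_zero_iff)
    moreover have "\<not> (cnt i (base_circle N \<inter> B) w = 1 \<and> cnt i (base_circle N - B) w = 0)"
      "\<not> (cnt i (base_circle N \<inter> B) w = 0 \<and> cnt i (base_circle N - B) w = 0)"
      using tot n by auto
    ultimately show ?thesis by (auto simp: slot_event_def tot)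
  qed
qed

lemma slot_event_measurable:
  assumes [measurable]: "f \<in> borel_measurable K" "g \<in> borel_measurable K"
  shows "Measurable.pred K (\<lambda>x. slot_event B (f x) (g x))"
  unfolding slot_event_def by measurable

lemma slot_coord_measurable [measurable]: "slot_coord i \<in> borel_measurable M"
proof (rule measurableI)
  fix B :: "real set" assume B: "B \<in> sets borel"
  have "Measurable.pred M (\<lambda>w. slot_event B (cnt i (base_circle N \<inter> B) w) (cnt i (base_circle N - B) w))"
    by (intro slot_event_measurable cnt_measurable) (use B in auto)
  then show "slot_coord i -` B \<inter> space M \<in> sets M"
    unfolding pred_def slot_coord_in_iff[symmetric] by (simp add: vimage_def Int_def conj_commute)
qed simp

text \<open>Interleaves the two parts of every slot into one sequence: index \<open>2 i\<close> for
  positions in \<open>B i\<close>, index \<open>2 i + 1\<close> for the rest. The corresponding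
  boxes are disjoint, so all counts are jointly independent.\<close>

definition half_slot :: "(nat \<Rightarrow> real set) \<Rightarrow> nat \<Rightarrow> real set" where
  "half_slot B m = (if even m then base_circle N \<inter> B (m div 2) else base_circle N - B (m div 2))"

lemma indep_half_slots:
  assumes B: "\<And>i. B i \<in> sets borel"
  shows "indep_vars (\<lambda>_. borel) (\<lambda>m. cnt (m div 2) (half_slot B m)) {..<n}"
proof -
  define A where "A m = time_slot h (m div 2) \<times> half_slot B m" for m
  have hs: "half_slot B m \<in> sets borel" "half_slot B m \<subseteq> base_circle N" for m
    using B by (auto simp: half_slot_def)
  have sets: "A ` {..<n} \<subseteq> sets (arrival_intensity N)" using slot_box(1)[OF hs] by (auto simp: A_def)
  have dj: "time_slot h i \<inter> time_slot h j = {}" if "i < j" for i j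
  proof -
    have "real (Suc i) * h \<le> real j * h" using that h by (intro mult_right_mono) auto
    then show ?thesis by (auto simp: time_slot_def)
  qed
  have "disjoint_family_on A {..<n}"
    unfolding disjoint_family_on_def
  proof (intro ballI impI)
    fix a b :: nat assume "a \<noteq> b"
    show "A a \<inter> A b = {}"
    proof (cases "a div 2 = b div 2")
      case True
      then have "even a \<noteq> even b" using \<open>a \<noteq> b\<close> by (metis even_two_times_div_two odd_two_times_div_two_succ)
      then show ?thesis using True by (auto simp: A_def half_slot_def)
    next
      case False
      then have "time_slot h (a div 2) \<inter> time_slot h (b div 2) = {}" using dj by (metis Int_commute linorder_neqE_nat)
      then show ?thesis by (auto simp: A_def)
    qed
  qed
  then have "indep_vars (\<lambda>_. borel) (\<lambda>i w. emeasure (count_space UNIV) (P w \<inter> A i)) {..<n}"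
    using ppp sets by (simp add: poisson_point_process_def)
  then show ?thesis by (simp add: A_def cnt_def[abs_def])
qed

text \<open>The counts depend on the sets \<open>B j\<close>, so factorization is shown for one
  family of sets at a time. Grouping the indices \<open>2 j\<close> and \<open>2 j + 1\<close> keeps
  the blocks independent, and each block decides whether coordinate \<open>j\<close> lies in
  \<open>B j\<close>.\<close>

lemma slot_coords_prob_INT:
  assumes B: "\<And>i. B i \<in> sets borel" and J: "J \<noteq> {}" "finite J" "J \<subseteq> {..<n}"
  shows "prob (\<Inter>j\<in>J. slot_coord j -` B j \<inter> space M) = (\<Prod>j\<in>J. prob (slot_coord j -` B j \<inter> space M))"
proof -
  define K where "K j = {2 * j, Suc (2 * j)}" for j :: nat
  have Kn: "K j \<subseteq> {..<2 * n}" if "j \<in> {..<n}" for j using that by (auto simp: K_def)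
  have dK: "disjoint_family_on K {..<n}"
  proof -
    have "x div 2 = j" if "x \<in> K j" for x j using that by (auto simp: K_def)
    then show ?thesis unfolding disjoint_family_on_def by blast
  qed
  have iv: "indep_vars (\<lambda>j. PiM (K j) (\<lambda>_. borel)) (\<lambda>j w. restrict (\<lambda>m. cnt (m div 2) (half_slot B m) w) (K j)) {..<n}"
    by (rule indep_vars_restrict[OF indep_half_slots[OF B] Kn dK])
  define Y where "Y j x = slot_event (B j) (x (2 * j)) (x (Suc (2 * j)))" for j and x :: "nat \<Rightarrow> ennreal"
  have Ym: "Y j \<in> PiM (K j) (\<lambda>_. borel) \<rightarrow>\<^sub>M count_space UNIV" for j
    unfolding Y_def by (intro slot_event_measurable measurable_component_singleton) (auto simp: K_def)
  have iY: "indep_vars (\<lambda>_. count_space UNIV) (\<lambda>j w. Y j (restrict (\<lambda>m. cnt (m div 2) (half_slot B m) w) (K j))) {..<n}"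
    by (rule indep_vars_compose2[OF iv Ym])
  have Y: "Y j (restrict (\<lambda>m. cnt (m div 2) (half_slot B m) w) (K j)) \<longleftrightarrow> slot_coord j w \<in> B j" for j w
    by (simp add: Y_def K_def half_slot_def slot_coord_in_iff)
  have "(\<lambda>w. Y j (restrict (\<lambda>m. cnt (m div 2) (half_slot B m) w) (K j))) -` {True} \<inter> space M = slot_coord j -` B j \<inter> space M" for j
    unfolding Y by auto
  then show ?thesis using indep_varsD[OF iY J, of "\<lambda>_. {True}"] by simp
qed

lemma indep_slot_coords: "indep_vars (\<lambda>_. borel) slot_coord {..<n}"
  unfolding indep_vars_def2
proof (intro conjI ballI indep_setsI)
  fix A J assume J: "J \<noteq> {}" "J \<subseteq> {..<n}" "finite J"
    and A: "\<forall>j\<in>J. A j \<in> {slot_coord j -` A \<inter> space M |A. A \<in> sets borel}"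
  then have "\<forall>j\<in>J. \<exists>B. B \<in> sets borel \<and> A j = slot_coord j -` B \<inter> space M" by blast
  then obtain B where B: "\<forall>j\<in>J. B j \<in> sets borel \<and> A j = slot_coord j -` B j \<inter> space M" by metis
  \<comment> \<open>Outside \<open>J\<close> the chosen sets are unconstrained; the empty set makes
    the whole family Borel.\<close>
  define B' where "B' j = (if j \<in> J then B j else {})" for j
  have "prob (\<Inter>j\<in>J. slot_coord j -` B' j \<inter> space M) = (\<Prod>j\<in>J. prob (slot_coord j -` B' j \<inter> space M))"
    by (rule slot_coords_prob_INT[OF _ J(1,3,2)]) (use B in \<open>auto simp: B'_def\<close>)
  moreover have "A j = slot_coord j -` B' j \<inter> space M" if "j \<in> J" for j using that B by (simp add: B'_def)
  ultimately show "prob (\<Inter>j\<in>J. A j) = (\<Prod>j\<in>J. prob (A j))" by simp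
qed auto

text \<open>The event asks for one arrival in \<open>B\<close> and none in the rest of the slot. The
  two exponential factors multiply to a constant, so the landing point has a constant density
  \<open>h * exp (- (h * perimeter))\<close> on the circle.\<close>

lemma prob_slot_coord_circle:
  assumes B: "B \<in> sets borel" "B \<subseteq> base_circle N"
  shows "prob (slot_coord i -` B \<inter> space M) = h * exp (- (h * perimeter)) * measure lborel B"
proof -
  let ?B = "\<lambda>_ :: nat. B"
  have C: "base_circle N - B \<in> sets borel" "base_circle N - B \<subseteq> base_circle N" using B by auto
  have BB: "base_circle N \<inter> B = B" using B by auto
  have iv: "indep_vars (\<lambda>_. borel) (\<lambda>m. cnt (m div 2) (half_slot ?B m)) {..<2 * i + 2}"
    by (rule indep_half_slots) (rule B)
  define D :: "nat \<Rightarrow> ennreal set" where "D m = (if even m then {1} else {0})" for m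
  have "prob (\<Inter>m\<in>{2 * i, Suc (2 * i)}. cnt (m div 2) (half_slot ?B m) -` D m \<inter> space M) =
      (\<Prod>m\<in>{2 * i, Suc (2 * i)}. prob (cnt (m div 2) (half_slot ?B m) -` D m \<inter> space M))"
    by (rule indep_varsD[OF iv]) (auto simp: D_def)
  moreover have "(\<Inter>m\<in>{2 * i, Suc (2 * i)}. cnt (m div 2) (half_slot ?B m) -` D m \<inter> space M) = slot_coord i -` B \<inter> space M"
  proof -
    have "- 1 \<notin> B" "- 2 \<notin> B" using B(2) not_in_base_circle by blast+
    then have "slot_coord i w \<in> B \<longleftrightarrow> cnt i B w = 1 \<and> cnt i (base_circle N - B) w = 0" for w
      unfolding slot_coord_in_iff BB by (auto simp: slot_event_def)
    then show ?thesis by (auto simp: D_def half_slot_def BB)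
  qed
  moreover have "cnt i B -` {1} \<inter> space M = {w \<in> space M. cnt i B w = of_nat 1}"
    "cnt i (base_circle N - B) -` {0} \<inter> space M = {w \<in> space M. cnt i (base_circle N - B) w = of_nat 0}" by auto
  ultimately have "prob (slot_coord i -` B \<inter> space M) =
     prob {w \<in> space M. cnt i B w = of_nat 1} * prob {w \<in> space M. cnt i (base_circle N - B) w = of_nat 0}"
    by (simp add: D_def half_slot_def BB)
  also have "\<dots> = h * measure lborel B * exp (- (h * measure lborel B)) * exp (- (h * measure lborel (base_circle N - B)))"
    unfolding cnt_prob[OF B] cnt_prob[OF C] by simp
  also have "measure lborel (base_circle N - B) = perimeter - measure lborel B"
    using measure_Diff[of lborel "base_circle N" B] B by (simp add: base_circle_def)
  also have "h * measure lborel B * exp (- (h * measure lborel B)) * exp (- (h * (perimeter - measure lborel B))) =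
    h * measure lborel B * exp (- (h * perimeter))"
    by (simp add: mult.assoc right_diff_distrib flip: exp_add)
  finally show ?thesis by simp
qed

lemma measure_base_circle: "measure lborel (base_circle N) = perimeter"
  by (simp add: base_circle_def)

lemma prob_slot_coord_empty: "prob (slot_coord i -` {- 1} \<inter> space M) = exp (- (h * perimeter))"
proof -
  have "slot_coord i w = - 1 \<longleftrightarrow> cnt i (base_circle N) w = of_nat 0" for w
  proof -
    have "cnt i {} w = 0" by (simp add: cnt_def)
    then show ?thesis using slot_coord_in_iff[of i w "{- 1}"] not_in_base_circle[of N]
      by (auto simp: slot_event_def Diff_insert0 Int_insert_right)
  qed
  then have "slot_coord i -` {- 1} \<inter> space M = {w \<in> space M. cnt i (base_circle N) w = of_nat 0}" by auto
  then show ?thesis using cnt_prob[of "base_circle N" i 0] by (simp add: measure_base_circle)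
qed

lemma prob_slot_coord_multiple:
  "prob (slot_coord i -` {- 2} \<inter> space M) = 1 - exp (- (h * perimeter)) - h * exp (- (h * perimeter)) * perimeter"
proof -
  have eq: "slot_coord i -` {- 2} \<inter> space M =
     space M - ((slot_coord i -` {- 1} \<inter> space M) \<union> (slot_coord i -` base_circle N \<inter> space M))"
  proof -
    have "slot_coord i w = - 1 \<or> slot_coord i w \<in> base_circle N" if "slot_coord i w \<noteq> - 2" for w
      using that unfolding slot_coord_def by (cases rule: slot_value_cases) (auto simp: slot_value_def)
    moreover have "(-2 :: real) \<noteq> -1" by simp
    ultimately show ?thesis using not_in_base_circle[of N] by (auto)
  qed
  have "prob ((slot_coord i -` {- 1} \<inter> space M) \<union> (slot_coord i -` base_circle N \<inter> space M)) =
     prob (slot_coord i -` {- 1} \<inter> space M) + prob (slot_coord i -` base_circle N \<inter> space M)"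
    by (rule finite_measure_Union) auto
  then show ?thesis
    unfolding eq by (subst prob_compl) (auto simp: prob_slot_coord_empty prob_slot_coord_circle[of "base_circle N"] measure_base_circle)
qed

text \<open>The right-hand side is free of \<open>i\<close>, so all slot coordinates have the same
  law.\<close>

lemma prob_slot_coord:
  assumes B: "B \<in> sets borel"
  shows "prob (slot_coord i -` B \<inter> space M) =
     h * exp (- (h * perimeter)) * measure lborel (B \<inter> base_circle N) + indicator B (- 1) * exp (- (h * perimeter)) +
     indicator B (- 2) * (1 - exp (- (h * perimeter)) - h * exp (- (h * perimeter)) * perimeter)"
proof -
  have cases: "slot_coord i w = - 1 \<or> slot_coord i w = - 2 \<or> slot_coord i w \<in> base_circle N" for w
  proof (cases "slot_coord i w = - 2")
    case False
    then show ?thesis unfolding slot_coord_def by (cases rule: slot_value_cases) (auto simp: slot_value_def)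
  qed simp
  define B1 where "B1 = B \<inter> {- 1}"
  define B2 where "B2 = B \<inter> {- 2}"
  have eq: "slot_coord i -` B \<inter> space M = ((slot_coord i -` (B \<inter> base_circle N) \<inter> space M) \<union> (slot_coord i -` B1 \<inter> space M)) \<union> (slot_coord i -` B2 \<inter> space M)"
    using cases unfolding B1_def B2_def by auto
  have s: "slot_coord i -` X \<inter> space M \<in> events" if "X \<in> sets borel" for X
    using that by (rule measurable_sets[OF slot_coord_measurable])
  have b: "B1 \<in> sets borel" "B2 \<in> sets borel" "B \<inter> base_circle N \<in> sets borel" using B by (auto simp: B1_def B2_def)
  have "prob (slot_coord i -` B \<inter> space M) = prob (slot_coord i -` (B \<inter> base_circle N) \<inter> space M) + prob (slot_coord i -` B1 \<inter> space M) + prob (slot_coord i -` B2 \<inter> space M)"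
  proof -
    have d: "slot_coord i -` (B \<inter> base_circle N) \<inter> space M \<inter> (slot_coord i -` B1 \<inter> space M) = {}"
      "(slot_coord i -` (B \<inter> base_circle N) \<inter> space M \<union> slot_coord i -` B1 \<inter> space M) \<inter> (slot_coord i -` B2 \<inter> space M) = {}"
      using not_in_base_circle[of N] by (auto simp: B1_def B2_def)
    show ?thesis
      unfolding eq finite_measure_Union[OF sets.Un[OF s[OF b(3)] s[OF b(1)]] s[OF b(2)] d(2)]
        finite_measure_Union[OF s[OF b(3)] s[OF b(1)] d(1)] by simp
  qed
  moreover have "prob (slot_coord i -` B1 \<inter> space M) = indicator B (- 1) * exp (- (h * perimeter))"
    using prob_slot_coord_empty by (cases "- 1 \<in> B") (auto simp: B1_def)
  moreover have "prob (slot_coord i -` B2 \<inter> space M) = indicator B (- 2) * (1 - exp (- (h * perimeter)) - h * exp (- (h * perimeter)) * perimeter)"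
    using prob_slot_coord_multiple by (cases "- 2 \<in> B") (auto simp: B2_def)
  ultimately show ?thesis using prob_slot_coord_circle[OF b(3), of i] by simp
qed

definition landing_law :: "real measure" where
  "landing_law = distr M borel (slot_coord 0)"

lemma distr_slot_coord: "distr M borel (slot_coord i) = landing_law"
  unfolding landing_law_def
  by (rule measure_eqI) (auto simp: emeasure_distr emeasure_eq_measure prob_slot_coord)

sublocale law: slot_law landing_law N lam "h * exp (- (h * perimeter))"
proof -
  interpret D: prob_space landing_law unfolding landing_law_def by (rule prob_space_distr) simp
  show "slot_law landing_law N lam (h * exp (- (h * perimeter)))"
  proof
    show "N \<ge> 1" "lam > 0" by (rule N)+
    show "sets landing_law = sets borel" by (simp add: landing_law_def)
    show "0 \<le> h * exp (- (h * perimeter))" using h by simp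
    fix B assume B: "B \<in> sets borel" "B \<subseteq> base_circle N"
    have "emeasure landing_law B = ennreal (prob (slot_coord 0 -` B \<inter> space M))"
      using B by (simp add: landing_law_def emeasure_distr emeasure_eq_measure)
    then show "emeasure landing_law B = ennreal (h * exp (- (h * perimeter))) * emeasure lborel B"
      using h by (simp add: prob_slot_coord_circle[OF B] emeasure_circle_subset[OF B] ennreal_mult)
  qed
qed

lemma distr_slot_coords:
  assumes "n > 0"
  shows "distr M (PiM {..<n} (\<lambda>_. borel)) (\<lambda>w. \<lambda>i\<in>{..<n}. slot_coord i w) = law.slots n"
  using indep_vars_iff_distr_eq_PiM[where I="{..<n}" and M'="\<lambda>_. borel" and X=slot_coord] indep_slot_coords[of n] assms
  by (auto simp: distr_slot_coord)

section \<open>From births in slots to the expected completion time\<close>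

definition no_birth :: "nat \<Rightarrow> nat \<Rightarrow> 'w set" where
  "no_birth n1 n2 = {w \<in> space M. \<forall>i\<in>{n1..<n2}. slot_coord i w \<notin> base_set N lam (\<lambda>i. slot_coord i w) i}"

definition crowded :: "nat \<Rightarrow> 'w set" where
  "crowded n = (\<Union>i<n. slot_coord i -` {- 2} \<inter> space M)"

lemma no_birth_vimage:
  assumes "n2 > 0"
  shows "no_birth n1 n2 \<in> events"
    and "emeasure M (no_birth n1 n2) = emeasure (law.slots n2) {w \<in> space (law.slots n2). \<forall>i\<in>{n1..<n2}. w i \<notin> base_set N lam w i}"
proof -
  let ?S = "{w \<in> space (law.slots n2). \<forall>i\<in>{n1..<n2}. w i \<notin> base_set N lam w i}"
  let ?Z = "\<lambda>w. \<lambda>i\<in>{..<n2}. slot_coord i w"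
  have S: "?S \<in> sets (law.slots n2)" by measurable
  have Sb: "?S \<in> sets (PiM {..<n2} (\<lambda>_. borel))" using S law.sets_slots by simp
  have Z: "?Z \<in> M \<rightarrow>\<^sub>M PiM {..<n2} (\<lambda>_. borel)" by measurable
  have "space (law.slots n2) = space (PiM {..<n2} (\<lambda>_. borel))" by (rule sets_eq_imp_space_eq[OF law.sets_slots])
  then have "?Z w \<in> space (law.slots n2)" if "w \<in> space M" for w using measurable_space[OF Z that] by simp
  moreover have "base_set N lam (?Z w) i = base_set N lam (\<lambda>i. slot_coord i w) i" if "i < n2" for i w
    by (rule base_set_cong) (use that in auto)
  ultimately have eq: "no_birth n1 n2 = ?Z -` ?S \<inter> space M" by (auto simp: no_birth_def)
  show "no_birth n1 n2 \<in> events" unfolding eq by (rule measurable_sets[OF Z Sb])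
  show "emeasure M (no_birth n1 n2) = emeasure (law.slots n2) ?S"
    unfolding eq distr_slot_coords[OF assms, symmetric] by (subst emeasure_distr[OF Z]) (use Sb in \<open>auto simp: distr_slot_coords[OF assms]\<close>)
qed

lemma prob_crowded: "crowded n \<in> events" "prob (crowded n) \<le> real n * (h * perimeter)\<^sup>2"
proof -
  have s: "slot_coord i -` {- 2} \<inter> space M \<in> events" for i by (rule measurable_sets[OF slot_coord_measurable]) simp
  show "crowded n \<in> events" unfolding crowded_def using s by auto
  have "prob (crowded n) \<le> (\<Sum>i<n. prob (slot_coord i -` {- 2} \<inter> space M))"
    unfolding crowded_def by (rule finite_measure_subadditive_finite) (use s in auto)
  also have "\<dots> \<le> (\<Sum>i<n. (h * perimeter)\<^sup>2)"
  proof (rule sum_mono)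
    fix i
    define x where "x = h * perimeter"
    have x: "0 \<le> x" using h by (simp add: x_def)
    \<comment> \<open>From \<open>1 - x \<le> exp (- x)\<close>: the probability of at least two
      points for a Poisson mean \<open>x\<close> is at most \<open>x\<^sup>2\<close>.\<close>
    have "(1 - x) * (1 + x) \<le> exp (- x) * (1 + x)" using exp_ge_add_one_self[of "- x"] x by (intro mult_right_mono) auto
    then have "1 - exp (- x) - exp (- x) * x \<le> x\<^sup>2" by (simp add: algebra_simps power2_eq_square)
    then show "prob (slot_coord i -` {- 2} \<inter> space M) \<le> (h * perimeter)\<^sup>2"
      unfolding prob_slot_coord_multiple by (simp add: x_def mult_ac)
  qed
  finally show "prob (crowded n) \<le> real n * (h * perimeter)\<^sup>2" by simp
qed

text \<open>On the event that no slot is crowded and some slot from \<open>n1\<close> on has a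
  birth, the completion time is at least \<open>n1 * h\<close>. This minorant is a multiple of an
  indicator, so only the good event has to be measurable.\<close>

lemma expected_completion_time:
  assumes n: "1 \<le> n1" "n1 \<le> n2" and K: "0 \<le> K" and e: "0 < e" "0 < c0" "slit_arc N lam * (1 + e) \<le> c0 * e"
  shows "ennreal (real n1 * h * (1 - (real n2 * (h * perimeter)\<^sup>2 +
      (K + c0) / (perimeter + c0) * exp ((1 + e) * (h * exp (- (h * perimeter))) * slit_arc N lam * n2) +
      exp (- (h * exp (- (h * perimeter))) * K * (n2 - n1)))))
    \<le> (\<integral>\<^sup>+w. tree_completion_time N lam (P w) \<partial>M)"
proof -
  let ?b = "(K + c0) / (perimeter + c0) * exp ((1 + e) * (h * exp (- (h * perimeter))) * slit_arc N lam * n2) +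
      exp (- (h * exp (- (h * perimeter))) * K * (n2 - n1))"
  have n2: "n2 > 0" using n by simp
  define G where "G = space M - (crowded n2 \<union> no_birth n1 n2)"
  have ev: "crowded n2 \<union> no_birth n1 n2 \<in> events" using prob_crowded no_birth_vimage[OF n2] by blast
  have G: "G \<in> events" using ev by (auto simp: G_def)
  have "0 \<le> ?b" using K e by simp
  then have "prob (no_birth n1 n2) \<le> ?b"
    using law.no_birth_bound[OF K n(2) e] unfolding no_birth_vimage(2)[OF n2, symmetric] by (simp add: emeasure_eq_measure)
  then have "prob (crowded n2 \<union> no_birth n1 n2) \<le> real n2 * (h * perimeter)\<^sup>2 + ?b"
    using prob_crowded[of n2] no_birth_vimage(1)[OF n2] by (intro order_trans[OF measure_Un_le]) auto
  then have pG: "1 - (real n2 * (h * perimeter)\<^sup>2 + ?b) \<le> prob G" using prob_compl[OF ev] by (simp add: G_def)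
  have low: "ennreal (real n1 * h) * indicator G w \<le> tree_completion_time N lam (P w)" if w: "w \<in> space M" for w
  proof (cases "w \<in> G")
    case True
    then obtain i where i: "n1 \<le> i" "i < n2" "slot_coord i w \<in> base_set N lam (\<lambda>i. slot_coord i w) i"
      by (auto simp: G_def no_birth_def)
    have good: "slot_value N h (P w) j \<noteq> - 2" if "j < n2" for j
      using True that by (auto simp: G_def crowded_def slot_coord_def)
    have sp: "P w \<subseteq> {0..} \<times> base_circle N"
      using ppp w by (auto simp: poisson_point_process_def arrival_intensity_def space_restrict_space)
    have "(\<lambda>i. slot_coord i w) = slot_value N h (P w)" by (simp add: slot_coord_def fun_eq_iff)
    then have "ennreal (real i * h) \<le> tree_completion_time N lam (P w)"
      using i n by (intro tree_birth_in_slot[OF N h sp good]) (auto simp: slot_coord_def)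
    moreover have "ennreal (real n1 * h) \<le> ennreal (real i * h)" using i h by (intro ennreal_leI mult_right_mono) auto
    ultimately show ?thesis using True by simp
  qed simp
  have "ennreal (real n1 * h * (1 - (real n2 * (h * perimeter)\<^sup>2 + ?b))) \<le> ennreal (real n1 * h * prob G)"
    using pG h by (intro ennreal_leI mult_left_mono) auto
  also have "\<dots> = ennreal (real n1 * h) * emeasure M G" using h by (simp add: emeasure_eq_measure ennreal_mult)
  also have "\<dots> = (\<integral>\<^sup>+w. ennreal (real n1 * h) * indicator G w \<partial>M)" using G by (simp add: nn_integral_cmult)
  also have "\<dots> \<le> (\<integral>\<^sup>+w. tree_completion_time N lam (P w) \<partial>M)" by (rule nn_integral_mono) (rule low)
  finally show ?thesis by (simp add: add.assoc)
qed

end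

section \<open>Asymptotics\<close>

text \<open>\<open>arccos c\<close> is the arctangent of the right-hand side, and
  \<open>arctan y \<le> y\<close> for \<open>y \<ge> 0\<close>.\<close>

lemma arccos_le_tan:
  assumes "0 < c" "c \<le> 1"
  shows "arccos c \<le> sqrt (1 - c\<^sup>2) / c"
proof -
  have "arctan (sqrt (1 - c\<^sup>2) / c) = arccos c"
  proof (rule arctan_unique)
    show "- (pi / 2) < arccos c" using arccos_lbound[of c] assms pi_gt_zero by linarith
    have "arccos c < arccos 0" using assms by (subst arccos_less_arccos) auto
    then show "arccos c < pi / 2" by simp
    show "tan (arccos c) = sqrt (1 - c\<^sup>2) / c"
      using assms by (simp add: tan_def sin_arccos cos_arccos)
  qed
  moreover have "arctan y \<le> y" if "0 \<le> y" for y :: real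
  proof -
    have "\<bar>arctan y\<bar> \<le> \<bar>y\<bar>" by (rule abs_arctan_le)
    then show ?thesis using that by simp
  qed
  ultimately show ?thesis using assms by (metis divide_nonneg_pos power_le_one real_sqrt_ge_zero diff_ge_0_iff_ge less_imp_le)
qed

text \<open>With \<open>x = lam / 2N\<close> the angle \<open>arccos c\<close> has cosine
  \<open>1 / cosh x\<close>, hence tangent \<open>sinh x\<close>. An upper bound on the arc is the
  useful direction, as it limits how fast the base is used up.\<close>

lemma slit_arc_le_sinh:
  assumes N: "N \<ge> 1" "lam > 0"
  shows "slit_arc N lam \<le> 4 * real N * sinh (lam / (2 * real N))"
proof -
  define x where "x = lam / (2 * real N)"
  define E where "E = exp x"
  have E: "E > 0" by (simp add: E_def)
  have EE: "exp (lam / real N) = E * E"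
    unfolding E_def x_def by (simp flip: exp_add)
  note c = slit_cos_bounds[OF N]
  have ne: "E * E + 1 \<noteq> 0" "1 + E * E \<noteq> 0" using mult_pos_pos[OF E E] by linarith+
  have d: "slit_delta N lam = (E * E - 1) / (E * E + 1)"
    unfolding slit_delta_def EE using ne by (simp add: divide_simps)
  have "(slit_cos N lam)\<^sup>2 = 1 - (slit_delta N lam)\<^sup>2"
    using slit_delta_bounds[OF N] by (simp add: slit_cos_def power_le_one)
  also have "\<dots> = (2 * E / (E * E + 1))\<^sup>2"
    unfolding d using E ne by (simp add: divide_simps) (simp add: power2_eq_square algebra_simps)
  finally have e1: "slit_cos N lam = 2 * E / (E * E + 1)"
    using E c by (simp add: power2_eq_iff_nonneg)
  have e2: "sqrt (1 - (slit_cos N lam)\<^sup>2) = slit_delta N lam"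
    using slit_delta_bounds[OF N] by (simp add: slit_cos_def power_le_one)
  have "sqrt (1 - (slit_cos N lam)\<^sup>2) / slit_cos N lam = (E * E - 1) / (2 * E)"
    unfolding e2 unfolding d e1 using ne(1) by simp
  also have "\<dots> = (E - inverse E) / 2" using E by (simp add: field_simps)
  also have "\<dots> = sinh x" by (simp add: sinh_field_def E_def exp_minus)
  finally have "arccos (slit_cos N lam) \<le> sinh x" using arccos_le_tan[OF c(1,3)] by simp
  then have "4 * real N * arccos (slit_cos N lam) \<le> 4 * real N * sinh x" by (intro mult_left_mono) auto
  then show ?thesis by (simp add: slit_arc_def x_def)
qed

lemma eventually_slit_arc_le:
  assumes "lam > 0" "2 * lam < A"
  shows "\<forall>\<^sub>F N in sequentially. slit_arc N lam \<le> A"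
proof -
  have "(\<lambda>N. 4 * real N * sinh (lam / (2 * real N))) \<longlonglongrightarrow> 2 * lam"
    using assms(1) by real_asymp
  then have "\<forall>\<^sub>F N in sequentially. 4 * real N * sinh (lam / (2 * real N)) < A"
    using assms(2) by (rule order_tendstoD)
  with eventually_ge_at_top[of 1] show ?thesis
    by eventually_elim (use slit_arc_le_sinh assms(1) in force)
qed

text \<open>The slots have length \<open>1 / m\<close>, where \<open>m\<close> is so large that a crowded slot has probability at most \<open>1 / N\<close>.\<close>

lemma expected_completion_time_ge:
  fixes t :: nat
  assumes N: "N \<ge> 1" "lam > 0" and ppp: "poisson_point_process M (arrival_intensity N) P"
    and t: "1 \<le> t" and K: "0 \<le> K" and e: "0 < e" and A: "slit_arc N lam \<le> A"
    and c0: "c0 = A * (1 + e) / e"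
  shows "ennreal (real t * (1 - (1 / real N + (K + c0) / (2 * pi * real N) * exp ((1 + e) * A * (real t + 1)) + exp (- K / 2))))
    \<le> (\<integral>\<^sup>+w. tree_completion_time N lam (P w) \<partial>M)"
proof -
  let ?p = "2 * pi * real N"
  have p: "?p > 0" using N by simp
  have a: "0 < slit_arc N lam" using slit_arc_bounds[OF N] by simp
  have A0: "0 < A" using a A by simp
  have c0': "0 < c0" using A0 e by (simp add: c0)
  \<comment> \<open>The first summand brings the probability of a crowded slot below
    \<open>1 / N\<close>; the second gives \<open>h * ?p \<le> 1 / 2\<close>, so the factor
    \<open>exp (- (h * ?p))\<close> is at least \<open>1 / 2\<close>.\<close>
  obtain m :: nat where m: "(real t + 1) * ?p\<^sup>2 * real N + 2 * ?p + 1 < real m" using reals_Archimedean2 by blast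
  have nn: "0 \<le> (real t + 1) * ?p\<^sup>2 * real N" by simp
  have m0: "0 < real m" using m nn p by linarith
  define h where "h = 1 / real m"
  have hm: "0 < h" "h * real m = 1" using m0 by (simp_all add: h_def)
  interpret arrivals_process M N P lam h by unfold_locales (use N ppp hm in auto)
  \<comment> \<open>The births are sought in the slots from \<open>t * m\<close> to
    \<open>(t + 1) * m\<close>, which make up the time window from \<open>t\<close> to
    \<open>t + 1\<close>.\<close>
  define b where "b = real ((t + 1) * m) * (h * ?p)\<^sup>2 +
      (K + c0) / (?p + c0) * exp ((1 + e) * (h * exp (- (h * ?p))) * slit_arc N lam * ((t + 1) * m)) +
      exp (- (h * exp (- (h * ?p))) * K * ((t + 1) * m - t * m))"
  have cc: "slit_arc N lam * (1 + e) \<le> c0 * e"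
    using A e by (simp add: c0 mult_right_mono)
  have "1 \<le> t * m" "t * m \<le> (t + 1) * m" using t m0 by (auto simp: Suc_le_eq)
  from expected_completion_time[OF this K e c0' cc]
  have main: "ennreal (real (t * m) * h * (1 - b)) \<le> (\<integral>\<^sup>+w. tree_completion_time N lam (P w) \<partial>M)"
    by (simp add: b_def)
  have tm: "real (t * m) * h = real t" using hm(2) by (simp add: mult.assoc mult.commute[of h])
  have hp: "h * ?p \<le> 1 / 2" "0 \<le> h * ?p"
  proof -
    have "2 * ?p \<le> real m" using m nn by linarith
    then show "h * ?p \<le> 1 / 2" using m0 by (simp add: h_def field_simps)
    show "0 \<le> h * ?p" using hm p by simp
  qed
  have x: "1 / 2 \<le> exp (- (h * ?p))" "exp (- (h * ?p)) \<le> 1"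
    using exp_ge_add_one_self[of "- (h * ?p)"] hp by auto
  have b1: "real ((t + 1) * m) * (h * ?p)\<^sup>2 \<le> 1 / real N"
  proof -
    have "real ((t + 1) * m) * (h * ?p)\<^sup>2 = (real t + 1) * ?p\<^sup>2 * (h * (h * real m))"
      by (simp add: power2_eq_square algebra_simps)
    also have "\<dots> = (real t + 1) * ?p\<^sup>2 / real m" unfolding hm by (simp add: h_def)
    also have "\<dots> \<le> 1 / real N"
    proof -
      have "(real t + 1) * ?p\<^sup>2 * real N \<le> 1 * real m" using m p by linarith
      then show ?thesis using m0 N by (subst frac_le_eq) (auto simp: divide_le_0_iff)
    qed
    finally show ?thesis .
  qed
  have b2: "(K + c0) / (?p + c0) * exp ((1 + e) * (h * exp (- (h * ?p))) * slit_arc N lam * ((t + 1) * m)) \<le>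
      (K + c0) / ?p * exp ((1 + e) * A * (real t + 1))"
  proof (rule mult_mono)
    show "(K + c0) / (?p + c0) \<le> (K + c0) / ?p" using K c0' p by (intro divide_left_mono) auto
    have "(1 + e) * (h * exp (- (h * ?p))) * slit_arc N lam * ((t + 1) * m) = (1 + e) * slit_arc N lam * (real t + 1) * exp (- (h * ?p)) * (h * real m)"
      by (simp add: algebra_simps)
    also have "\<dots> = ((1 + e) * slit_arc N lam * (real t + 1)) * exp (- (h * ?p))" unfolding hm by simp
    also have "\<dots> \<le> ((1 + e) * A * (real t + 1)) * 1"
      by (intro mult_mono x(2) A) (use e a A0 in auto)
    finally show "exp ((1 + e) * (h * exp (- (h * ?p))) * slit_arc N lam * ((t + 1) * m)) \<le> exp ((1 + e) * A * (real t + 1))" by simp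
  qed (use K c0' p in auto)
  have b3: "exp (- (h * exp (- (h * ?p))) * K * ((t + 1) * m - t * m)) \<le> exp (- K / 2)"
  proof -
    have "(t + 1) * m - t * m = m" by simp
    then have "- (h * exp (- (h * ?p))) * K * ((t + 1) * m - t * m) = - (exp (- (h * ?p)) * K * (h * real m))" by simp
    also have "\<dots> = - (exp (- (h * ?p)) * K)" unfolding hm by simp
    also have "\<dots> \<le> - K / 2" using mult_right_mono[OF x(1) K] by simp
    finally show ?thesis by simp
  qed
  have "b \<le> 1 / real N + (K + c0) / ?p * exp ((1 + e) * A * (real t + 1)) + exp (- K / 2)"
    unfolding b_def by (intro add_mono b1 b2 b3)
  then have "ennreal (real t * (1 - (1 / real N + (K + c0) / ?p * exp ((1 + e) * A * (real t + 1)) + exp (- K / 2)))) \<le> ennreal (real t * (1 - b))"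
    by (intro ennreal_leI mult_left_mono) auto
  also have "\<dots> \<le> (\<integral>\<^sup>+w. tree_completion_time N lam (P w) \<partial>M)" using main unfolding tm .
  finally show ?thesis .
qed

text \<open>The cutoff \<open>K\<close> is \<open>ln N\<close>. The critical term is of order
  \<open>ln N * N powr (q \<theta> - 1)\<close>, which vanishes because
  \<open>q \<theta> < 1\<close>; the subtracted \<open>1\<close> leaves room for rounding the time
  down to an integer.\<close>

lemma completion_rate_tendsto:
  fixes \<theta> q c0 :: real
  assumes "0 < \<theta>" "q * \<theta> < 1"
  shows "(\<lambda>N. (\<theta> * ln (real N) - 1) / ln (real N) *
     (1 - (1 / real N + (ln (real N) + c0) / (2 * pi * real N) * exp (q * (\<theta> * ln (real N) + 1)) + exp (- ln (real N) / 2)))) \<longlonglongrightarrow> \<theta>"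
proof -
  define s where "s = 1 - q * \<theta>"
  have s: "s > 0" using assms by (simp add: s_def)
  have "(\<lambda>N. (\<theta> * ln (real N) - 1) / ln (real N)) \<longlonglongrightarrow> \<theta>" by real_asymp
  moreover have "(\<lambda>N. 1 / real N) \<longlonglongrightarrow> 0" by real_asymp
  moreover define X where "X N = exp q / (2 * pi) * ((ln (real N) + c0) * exp (- s * ln (real N)))" for N :: nat
  have "(\<lambda>N. (ln (real N) + c0) * exp (- s * ln (real N))) \<longlonglongrightarrow> 0" using s by real_asymp
  from tendsto_mult_left[OF this, of "exp q / (2 * pi)"] have "X \<longlonglongrightarrow> 0" by (simp add: X_def[abs_def])
  moreover have "(\<lambda>N. exp (- ln (real N) / 2)) \<longlonglongrightarrow> 0" by real_asymp
  ultimately have "(\<lambda>N. (\<theta> * ln (real N) - 1) / ln (real N) *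
     (1 - (1 / real N + X N + exp (- ln (real N) / 2)))) \<longlonglongrightarrow> \<theta> * (1 - (0 + 0 + 0))"
    by (intro tendsto_mult tendsto_diff tendsto_add tendsto_const)
  then have "(\<lambda>N. (\<theta> * ln (real N) - 1) / ln (real N) *
     (1 - (1 / real N + (ln (real N) + c0) / (2 * pi) * exp q * exp (- s * ln (real N)) + exp (- ln (real N) / 2)))) \<longlonglongrightarrow> \<theta>"
    by (simp add: X_def mult_ac)
  moreover have "\<forall>\<^sub>F N in sequentially. (\<theta> * ln (real N) - 1) / ln (real N) *
     (1 - (1 / real N + (ln (real N) + c0) / (2 * pi) * exp q * exp (- s * ln (real N)) + exp (- ln (real N) / 2))) =
     (\<theta> * ln (real N) - 1) / ln (real N) *
     (1 - (1 / real N + (ln (real N) + c0) / (2 * pi * real N) * exp (q * (\<theta> * ln (real N) + 1)) + exp (- ln (real N) / 2)))"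
    using eventually_gt_at_top[of 0]
  proof eventually_elim
    case (elim N)
    have "exp (q * (\<theta> * ln (real N) + 1)) = exp (ln (real N)) * (exp q * exp (- s * ln (real N)))"
      unfolding exp_add[symmetric] by (simp add: s_def algebra_simps)
    then have "exp (q * (\<theta> * ln (real N) + 1)) = real N * (exp q * exp (- s * ln (real N)))"
      using elim by simp
    then show ?case using elim by simp
  qed
  ultimately show ?thesis by (rule Lim_transform_eventually)
qed

theorem proposition4p1:
  fixes lam :: real
    and M :: "nat \<Rightarrow> 'w measure"
    and P :: "nat \<Rightarrow> 'w \<Rightarrow> (real \<times> real) set"
  assumes "lam > 0"
    and "\<And>N. N \<ge> 1 \<Longrightarrow> poisson_point_process (M N) (arrival_intensity N) (P N)"
  shows "liminf (\<lambda>N. (\<integral>\<^sup>+ w. tree_completion_time N lam (P N w) \<partial>M N) / ennreal (ln (real N)))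
           \<ge> ennreal (1 / (2 * lam))"
  unfolding le_Liminf_iff
proof (intro allI impI)
  fix y :: ennreal assume y: "y < ennreal (1 / (2 * lam))"
  then obtain r where r: "y = ennreal r" "0 \<le> r" by (cases y) auto
  have lam: "lam > 0" by fact
  have r2: "r < 1 / (2 * lam)" using y r lam by (simp add: ennreal_less_iff)
  \<comment> \<open>The midpoint leaves room on both sides: above \<open>r\<close> for the limit,
    below \<open>1 / (2 * lam)\<close> for the rate condition.\<close>
  define \<theta> where "\<theta> = (r + 1 / (2 * lam)) / 2"
  have \<theta>: "r < \<theta>" "\<theta> < 1 / (2 * lam)" using r2 by (auto simp: \<theta>_def)
  then have \<theta>0: "0 < \<theta>" using r(2) by linarith
  define g where "g = 2 * lam * \<theta>"
  have g: "0 < g" "g < 1" using \<theta> \<theta>0 lam by (auto simp: g_def field_simps)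
  \<comment> \<open>Two factors \<open>1 + e\<close> occur, one from convexity and one from
    replacing \<open>2 * lam\<close> by \<open>A\<close>. Since
    \<open>(1 + e)\<^sup>2 \<le> 1 + 3 e\<close>, this choice gives
    \<open>g (1 + e)\<^sup>2 \<le> g + 3/4 g (1 - g) < 1\<close>.\<close>
  define e where "e = (1 - g) / 4"
  have e: "0 < e" "e \<le> 1" using g by (auto simp: e_def)
  define A where "A = 2 * lam * (1 + e)"
  define c0 where "c0 = A * (1 + e) / e"
  have A: "2 * lam < A" using lam e by (simp add: A_def algebra_simps)
  have q: "(1 + e) * A * \<theta> < 1"
  proof -
    have "e * e \<le> e" using e by (simp add: mult_left_le)
    then have "g * ((1 + e) * (1 + e)) \<le> g * (1 + 3 * e)"
      using g by (intro mult_left_mono) (auto simp: algebra_simps)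
    also have "\<dots> = g + 3 / 4 * g * (1 - g)" by (simp add: e_def algebra_simps)
    also have "\<dots> < g + (1 - g)"
    proof -
      have "3 / 4 * g * (1 - g) < 1 * (1 - g)" using g by (intro mult_strict_right_mono) auto
      then show ?thesis by simp
    qed
    finally show ?thesis by (simp add: A_def g_def mult_ac)
  qed
  let ?v = "\<lambda>N. 1 - (1 / real N + (ln (real N) + c0) / (2 * pi * real N) * exp ((1 + e) * A * (\<theta> * ln (real N) + 1)) + exp (- ln (real N) / 2))"
  have "\<forall>\<^sub>F N in sequentially. r < (\<theta> * ln (real N) - 1) / ln (real N) * ?v N"
    using completion_rate_tendsto[OF \<theta>0 q, of c0] \<theta>(1) by (rule order_tendstoD)
  moreover have "\<forall>\<^sub>F N in sequentially. 2 \<le> \<theta> * ln (real N)" using \<theta>0 by real_asymp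
  moreover have "\<forall>\<^sub>F N in sequentially. (3 :: nat) \<le> N" by (rule eventually_ge_at_top)
  moreover note eventually_slit_arc_le[OF lam A]
  ultimately show "\<forall>\<^sub>F N in sequentially. y < (\<integral>\<^sup>+ w. tree_completion_time N lam (P N w) \<partial>M N) / ennreal (ln (real N))"
  proof eventually_elim
    case (elim N)
    have N: "N \<ge> 1" using elim by simp
    have ln: "0 < ln (real N)" using elim by simp
    define t where "t = nat \<lfloor>\<theta> * ln (real N)\<rfloor>"
    have t: "\<theta> * ln (real N) - 1 \<le> real t" "real t \<le> \<theta> * ln (real N)" using elim(2) by (auto simp: t_def)
    have t1: "1 \<le> t" using t elim(2) by linarith
    have c0: "0 < c0" using A lam e by (simp add: c0_def)
    have pos: "0 < (\<theta> * ln (real N) - 1) / ln (real N)" using elim(2) ln by simp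
    have "0 < (\<theta> * ln (real N) - 1) / ln (real N) * ?v N" using elim(1) r(2) by linarith
    \<comment> \<open>Positivity of the probability bound permits replacing
      \<open>\<theta> * ln (real N) - 1\<close> by the larger \<open>real t\<close> in the
      product.\<close>
    then have v: "0 < ?v N" using pos zero_less_mult_pos by blast
    let ?u = "1 - (1 / real N + (ln (real N) + c0) / (2 * pi * real N) * exp ((1 + e) * A * (real t + 1)) + exp (- ln (real N) / 2))"
    have "?v N \<le> ?u"
    proof -
      have "(1 + e) * A * (real t + 1) \<le> (1 + e) * A * (\<theta> * ln (real N) + 1)"
        using t e A lam by (intro mult_left_mono) auto
      then have "(ln (real N) + c0) / (2 * pi * real N) * exp ((1 + e) * A * (real t + 1)) \<le>
          (ln (real N) + c0) / (2 * pi * real N) * exp ((1 + e) * A * (\<theta> * ln (real N) + 1))"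
        using ln c0 by (intro mult_left_mono) auto
      then show ?thesis by simp
    qed
    have "r < (\<theta> * ln (real N) - 1) * ?v N / ln (real N)" using elim(1) by simp
    also have "\<dots> \<le> real t * ?u / ln (real N)"
      using t v \<open>?v N \<le> ?u\<close> ln by (intro divide_right_mono mult_mono) auto
    finally have "y < ennreal (real t * ?u / ln (real N))" using r by (simp add: ennreal_less_iff)
    also have "\<dots> = ennreal (real t * ?u) / ennreal (ln (real N))"
      using v \<open>?v N \<le> ?u\<close> ln by (intro divide_ennreal[symmetric]) auto
    also have "\<dots> \<le> (\<integral>\<^sup>+ w. tree_completion_time N lam (P N w) \<partial>M N) / ennreal (ln (real N))"
    proof (rule divide_right_mono_ennreal)
      show "ennreal (real t * ?u) \<le> (\<integral>\<^sup>+ w. tree_completion_time N lam (P N w) \<partial>M N)"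
        by (rule expected_completion_time_ge[OF N lam assms(2)[OF N] t1 _ e(1) elim(4) c0_def]) (use ln in simp)
    qed
    finally show ?case .
  qed
qed

end
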